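(* Let $u,v\in S_\infty$ be such that there exists an integer $p>0$ for which $\ell(us_i)>\ell(u)$ for all $i<p$ and $\ell(vs_i)>\ell(v)$ for all $i>p$. Then $$\mathfrak{S}_u(x;y)\,\mathfrak{S}_v(x;z)=\sum_{w\in S_\infty}e_{uv}^w(y;z)\,\mathfrak{S}_w(x;y).$$
   Context: **Permutations.** $\mathbb{N}=\{1,2,3,\dots\}$. $S_\infty$ is the group of bijections $\mathbb{N}\to\mathbb{N}$ fixing all but finitely many elements, with product $(uv)(i)=u(v(i))$ and identity $1$; $S_n\subset S_\infty$ is the subgroup of $u$ with $u(i)=i$ for $i>n$. $s_i$ ($i\ge 1$) is the transposition of $i$ and $i+1$; $t_{ab}=t_{ba}$ ($a\ne b$) is the transposition of $a$ and $b$. $\ell(u)$ is the number of pairs $i<j$ with $u(i)>u(j)$. **Double Schubert polynomials.** Work in the polynomial ring $\mathbb{Z}[x,y,z]$ in the variables $x_i,y_i,z_i$ ($i\in\mathbb{N}$). $s_i$ acts by the ring automorphism exchanging $x_i$ and $x_{i+1}$ and fixing all other variables. Put $\partial^{s_i}(P)=\frac{P-s_i(P)}{x_i-x_{i+1}}$, and $\partial^u=\partial^{s_{i_1}}\cdots\partial^{s_{i_m}}$ for any reduced word $u=s_{i_1}\cdots s_{i_m}$, $m=\ell(u)$ (independent of the choice). Let $w_0(n)\in S_{n+1}$ be given by $w_0(n)(i)=n+2-i$ for $i\le n+1$, and $\mathfrak{S}_{w_0(n)}(x;y)=\prod_{i,j\ge 1,\ i+j\le n+1}(x_i-y_j)$.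 For $u\in S_{n+1}$, $\mathfrak{S}_u(x;y)=\partial^{u^{-1}w_0(n)}(\mathfrak{S}_{w_0(n)}(x;y))$ (independent of $n$). $\mathfrak{S}_v(x;z)$ is obtained by replacing each $y_j$ by $z_j$. **Code, dominant approximation.** The code of $v\in S_\infty$ is the sequence $\mathfrak{c}_i(v)=\#\{j>i\mid v(i)>v(j)\}$, $i\ge1$. $v$ is dominant if $\mathfrak{c}(v)$ is a partition (weakly decreasing). The dominant approximation $\mu_v$ is defined recursively: if $v$ is dominant, $\mu_v=v$; otherwise let $i$ be the maximal index with $\mathfrak{c}_i(v)<\mathfrak{c}_{i+1}(v)$ and put $\mu_v=\mu_{vs_i}$ (this terminates). $\lambda(v)$ is the partition conjugate to the code of $\mu_v$: $\lambda_i(v)=\#\{j\mid \mathfrak{c}_j(\mu_v)\ge i\}$. **The relation $\xrightarrow{k}$ and weights.** For $u,u'\in S_\infty$ and a positive integer $k$, write $u\xrightarrow{k}u'$ if there exist $p$ with $0\le p\le k$ and transpositions $t_{a_1b_1},\dots,t_{a_pb_p}$ such that (1) $a_i\le k<b_i$ for all $i$; (2) $a_i\ne a_j$ for $i\neq j$; (3) $\ell(ut_{a_1b_1}\cdots t_{a_ib_i})=\ell(u)+i$ for all $i$; (4) $u'=ut_{a_1b_1}\cdots t_{a_pb_p}$. If $u\xrightarrow{k}w$, let $P_k(u,w)=\{u(i)\mid i\le k,\ u(i)=w(i)\}$ and $\mathrm{weight}_{u,k}^w(y;z_j)=\prod_{i\in P_k(u,w)}(y_i-z_j)$ (empty product $=1$).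 For a partition $\lambda=(\lambda_1,\dots,\lambda_m)$ of length $m$, $\mathrm{Path}_\lambda(u,w)$ is the set of sequences $(u_0,\dots,u_m)$ in $S_\infty$ with $u=u_0\xrightarrow{\lambda_1}u_1\xrightarrow{\lambda_2}\cdots\xrightarrow{\lambda_m}u_m=w$, and for such a path $P$, $\mathrm{weight}_{P,\lambda}(y;z)=\prod_{i=1}^m\mathrm{weight}_{u_{i-1},\lambda_i}^{u_i}(y;z_i)$. **The coefficients.** $d_{u,\lambda}^w(y;z)=\sum_{P\in\mathrm{Path}_\lambda(u,w)}\mathrm{weight}_{P,\lambda}(y;z)$. For $u,v,w\in S_\infty$: if $\ell(wv^{-1}\mu_v)=\ell(w)+\ell(v^{-1}\mu_v)$ then $e_{uv}^w(y;z)=d_{u,\lambda(v)}^{wv^{-1}\mu_v}(y;z)$; otherwise $e_{uv}^w(y;z)=0$. *)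

theory Defs
  imports "HOL-Combinatorics.Permutations" "HOL-Library.Poly_Mapping"
begin

text \<open>
  The index set is the set of positive integers. Permutations are functions on \<^typ>\<open>nat\<close> that
  fix 0, the product is composition.
\<close>

definition S_inf :: "(nat \<Rightarrow> nat) set" where
  "S_inf = {u. u permutes {1..} \<and> finite {i. u i \<noteq> i}}"

definition adj :: "nat \<Rightarrow> nat \<Rightarrow> nat" where
  "adj i = transpose i (Suc i)"

definition perm_length :: "(nat \<Rightarrow> nat) \<Rightarrow> nat" where
  "perm_length u = card {(i, j). 1 \<le> i \<and> i < j \<and> u i > u j}"

definition word_prod :: "nat list \<Rightarrow> nat \<Rightarrow> nat" where
  "word_prod is = foldr (\<lambda>i p. adj i \<circ> p) is id"

definition reduced_word :: "(nat \<Rightarrow> nat) \<Rightarrow> nat list \<Rightarrow> bool" where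
  "reduced_word u is \<longleftrightarrow>
     (\<forall>i\<in>set is. 1 \<le> i) \<and> word_prod is = u \<and> length is = perm_length u"

text \<open>
  A monomial is a finitely supported exponent function on the variables. The variables with
  index 0 are present in the type, but they do not occur in any of the polynomials below.
\<close>

datatype var = X nat | Y nat | Z nat

type_synonym mpoly = "(var \<Rightarrow>\<^sub>0 nat) \<Rightarrow>\<^sub>0 int"

text \<open>
  The order on variables has no meaning of its own: it is there because the library proves that
  \<^typ>\<open>mpoly\<close> is an integral domain only for linearly ordered variables.
\<close>

fun var_index :: "var \<Rightarrow> nat" where
  "var_index (X i) = 3 * i"
| "var_index (Y i) = 3 * i + 1"
| "var_index (Z i) = 3 * i + 2"

lemma var_index_eq_iff: "var_index v = var_index w \<longleftrightarrow> v = w"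
  by (cases v; cases w; simp; presburger)

instantiation var :: linorder
begin

definition less_eq_var :: "var \<Rightarrow> var \<Rightarrow> bool" where
  "v \<le> w \<longleftrightarrow> var_index v \<le> var_index w"

definition less_var :: "var \<Rightarrow> var \<Rightarrow> bool" where
  "v < w \<longleftrightarrow> var_index v < var_index w"

instance
  by standard (auto simp: less_eq_var_def less_var_def var_index_eq_iff[symmetric])

end

definition Var :: "var \<Rightarrow> mpoly" where
  "Var v = Poly_Mapping.single (Poly_Mapping.single v 1) 1"

text \<open>The ring endomorphism that sends each variable \<open>v\<close> to \<open>f v\<close>.\<close>

definition poly_subst :: "(var \<Rightarrow> mpoly) \<Rightarrow> mpoly \<Rightarrow> mpoly" where
  "poly_subst f P =
     (\<Sum>m\<in>Poly_Mapping.keys P. of_int (Poly_Mapping.lookup P m) *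
        (\<Prod>v\<in>Poly_Mapping.keys m. f v ^ Poly_Mapping.lookup m v))"

definition swap_x :: "nat \<Rightarrow> mpoly \<Rightarrow> mpoly" where
  "swap_x i = poly_subst (\<lambda>v. case v of X j \<Rightarrow> Var (X (adj i j)) | _ \<Rightarrow> Var v)"

text \<open>The exact quotient by \<open>x\<^sub>i - x\<^sub>i\<^sub>+\<^sub>1\<close>; it is unique since \<^typ>\<open>mpoly\<close> is an integral domain.\<close>

definition divdiff :: "nat \<Rightarrow> mpoly \<Rightarrow> mpoly" where
  "divdiff i P = (THE Q. (Var (X i) - Var (X (Suc i))) * Q = P - swap_x i P)"

definition divdiff_perm :: "(nat \<Rightarrow> nat) \<Rightarrow> mpoly \<Rightarrow> mpoly" where
  "divdiff_perm u P = foldr divdiff (SOME is. reduced_word u is) P"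

definition w0 :: "nat \<Rightarrow> nat \<Rightarrow> nat" where
  "w0 n i = (if 1 \<le> i \<and> i \<le> n + 1 then n + 2 - i else i)"

definition schubert_w0 :: "nat \<Rightarrow> mpoly" where
  "schubert_w0 n =
     (\<Prod>(i, j)\<in>{(i, j). 1 \<le> i \<and> 1 \<le> j \<and> i + j \<le> n + 1}. Var (X i) - Var (Y j))"

text \<open>
  The polynomial does not depend on the \<open>n\<close> with \<open>u \<in> S\<^sub>n\<^sub>+\<^sub>1\<close> that is used to compute it; the
  least one is taken.
\<close>

definition schubert_xy :: "(nat \<Rightarrow> nat) \<Rightarrow> mpoly" where
  "schubert_xy u =
     (let n = (LEAST n. u permutes {1..n + 1})
      in divdiff_perm (inv u \<circ> w0 n) (schubert_w0 n))"

definition schubert_xz :: "(nat \<Rightarrow> nat) \<Rightarrow> mpoly" where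
  "schubert_xz v =
     poly_subst (\<lambda>a. case a of Y j \<Rightarrow> Var (Z j) | _ \<Rightarrow> Var a) (schubert_xy v)"

definition perm_code :: "(nat \<Rightarrow> nat) \<Rightarrow> nat \<Rightarrow> nat" where
  "perm_code v i = card {j. i < j \<and> v i > v j}"

definition dominant :: "(nat \<Rightarrow> nat) \<Rightarrow> bool" where
  "dominant v \<longleftrightarrow> (\<forall>i\<ge>1. perm_code v (Suc i) \<le> perm_code v i)"

definition last_code_ascent :: "(nat \<Rightarrow> nat) \<Rightarrow> nat" where
  "last_code_ascent v = Max {i. 1 \<le> i \<and> perm_code v i < perm_code v (Suc i)}"

partial_function (tailrec) dom_approx :: "(nat \<Rightarrow> nat) \<Rightarrow> nat \<Rightarrow> nat" where
  "dom_approx v = (if dominant v then v else dom_approx (v \<circ> adj (last_code_ascent v)))"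

definition lam_part :: "(nat \<Rightarrow> nat) \<Rightarrow> nat \<Rightarrow> nat" where
  "lam_part v i = card {j. 1 \<le> j \<and> i \<le> perm_code (dom_approx v) j}"

text \<open>
  The list of the nonzero parts: the parts decrease weakly, so these are the first \<open>m\<close> ones,
  where \<open>m\<close> is their number.
\<close>

definition lam :: "(nat \<Rightarrow> nat) \<Rightarrow> nat list" where
  "lam v = map (lam_part v) [1..<Suc (card {i. 1 \<le> i \<and> lam_part v i \<noteq> 0})]"

definition transp_prod :: "(nat \<times> nat) list \<Rightarrow> nat \<Rightarrow> nat" where
  "transp_prod ts = foldr (\<lambda>(a, b) p. transpose a b \<circ> p) ts id"

definition arrow :: "nat \<Rightarrow> (nat \<Rightarrow> nat) \<Rightarrow> (nat \<Rightarrow> nat) \<Rightarrow> bool" where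
  "arrow k u u' \<longleftrightarrow>
     (\<exists>ts. length ts \<le> k \<and>
        (\<forall>(a, b)\<in>set ts. 1 \<le> a \<and> a \<le> k \<and> k < b) \<and>
        distinct (map fst ts) \<and>
        (\<forall>i. 1 \<le> i \<and> i \<le> length ts \<longrightarrow>
           perm_length (u \<circ> transp_prod (take i ts)) = perm_length u + i) \<and>
        u' = u \<circ> transp_prod ts)"

definition fixed_values :: "nat \<Rightarrow> (nat \<Rightarrow> nat) \<Rightarrow> (nat \<Rightarrow> nat) \<Rightarrow> nat set" where
  "fixed_values k u w = {u i | i. 1 \<le> i \<and> i \<le> k \<and> u i = w i}"

definition weight :: "nat \<Rightarrow> (nat \<Rightarrow> nat) \<Rightarrow> (nat \<Rightarrow> nat) \<Rightarrow> nat \<Rightarrow> mpoly" where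
  "weight k u w j = (\<Prod>i\<in>fixed_values k u w. Var (Y i) - Var (Z j))"

definition Path :: "nat list \<Rightarrow> (nat \<Rightarrow> nat) \<Rightarrow> (nat \<Rightarrow> nat) \<Rightarrow> (nat \<Rightarrow> nat) list set" where
  "Path ls u w =
     {us. length us = Suc (length ls) \<and> set us \<subseteq> S_inf \<and>
          us ! 0 = u \<and> us ! length ls = w \<and>
          (\<forall>i<length ls. arrow (ls ! i) (us ! i) (us ! Suc i))}"

text \<open>
  Lists are indexed from 0: the step from \<open>us ! i\<close> to \<open>us ! Suc i\<close> uses the part \<open>ls ! i\<close>, which
  is the \<open>(i + 1)\<close>-th one, and the variable \<open>z\<^sub>i\<^sub>+\<^sub>1\<close>.
\<close>

definition path_weight :: "nat list \<Rightarrow> (nat \<Rightarrow> nat) list \<Rightarrow> mpoly" where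
  "path_weight ls us = (\<Prod>i<length ls. weight (ls ! i) (us ! i) (us ! Suc i) (Suc i))"

definition d_coeff :: "(nat \<Rightarrow> nat) \<Rightarrow> nat list \<Rightarrow> (nat \<Rightarrow> nat) \<Rightarrow> mpoly" where
  "d_coeff u ls w = (\<Sum>us\<in>Path ls u w. path_weight ls us)"

definition e_coeff :: "(nat \<Rightarrow> nat) \<Rightarrow> (nat \<Rightarrow> nat) \<Rightarrow> (nat \<Rightarrow> nat) \<Rightarrow> mpoly" where
  "e_coeff u v w =
     (let x = inv v \<circ> dom_approx v
      in if perm_length (w \<circ> x) = perm_length w + perm_length x
         then d_coeff u (lam v) (w \<circ> x) else 0)"

end

theory Submission
  imports Defs
begin

text \<open>
  The core is a Pieri formula: multiplying \<open>\<SS>\<^sub>u(x;y)\<close> by \<open>(x\<^sub>1 - z) \<cdots> (x\<^sub>k - z)\<close> gives the sum of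
  \<open>\<SS>\<^sub>w(x;y)\<close> over \<open>u \<rightarrow>\<^sub>k w\<close> with the stated weights. The factor does not involve y, so it commutes
  with the divided differences in y, which lower \<open>u\<close> by left multiplication. Hence it suffices to
  treat the longest element of \<open>S\<^sub>N\<close>, where all products are explicit, and to see how the weighted
  relation changes when the values \<open>i\<close> and \<open>i + 1\<close> of \<open>u\<close> are exchanged.

  If \<open>v\<close> is dominant, \<open>\<SS>\<^sub>v(x;z)\<close> is a product of such factors, one for each part of \<open>\<lambda>(v)\<close>, and
  the theorem is the iterated Pieri formula. In general \<open>\<SS>\<^sub>v\<close> arises from the Schubert polynomial
  of the dominant approximation by divided differences \<open>\<partial>\<^sub>i\<close> with \<open>i < p\<close>. These are linear over
  \<open>\<SS>\<^sub>u\<close> because \<open>u\<close> has no descent below \<open>p\<close>.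
\<close>

section \<open>Substitution homomorphisms\<close>

lemma poly_mapping_sum_single:
  fixes p :: "'a \<Rightarrow>\<^sub>0 'b::comm_monoid_add"
  shows "p = (\<Sum>m\<in>Poly_Mapping.keys p. Poly_Mapping.single m (Poly_Mapping.lookup p m))"
  by (rule poly_mapping_eqI)
     (auto simp: lookup_sum lookup_single when_def not_in_keys_iff_lookup_eq_zero)

lemma poly_mapping_add_induct [case_names single add]:
  fixes p :: "'a \<Rightarrow>\<^sub>0 'b::comm_monoid_add"
  assumes single: "\<And>m c. P (Poly_Mapping.single m c)"
    and add: "\<And>p q. P p \<Longrightarrow> P q \<Longrightarrow> P (p + q)"
  shows "P p"
proof -
  have "P (\<Sum>m\<in>A. Poly_Mapping.single m (f m))" if "finite A" for A :: "'a set" and f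
    using that
  proof (induction A)
    case empty
    then show ?case using single[of undefined 0] by simp
  next
    case (insert x F)
    then show ?case using single add by simp
  qed
  then show ?thesis
    by (subst poly_mapping_sum_single) auto
qed

definition mono_eval :: "(var \<Rightarrow> mpoly) \<Rightarrow> (var \<Rightarrow>\<^sub>0 nat) \<Rightarrow> mpoly" where
  "mono_eval f m = (\<Prod>v\<in>Poly_Mapping.keys m. f v ^ Poly_Mapping.lookup m v)"

lemma mono_eval_superset:
  assumes "finite K" "Poly_Mapping.keys m \<subseteq> K"
  shows "mono_eval f m = (\<Prod>v\<in>K. f v ^ Poly_Mapping.lookup m v)"
  unfolding mono_eval_def
  by (rule prod.mono_neutral_left) (use assms in \<open>auto simp: not_in_keys_iff_lookup_eq_zero\<close>)

lemma mono_eval_add: "mono_eval f (m + m') = mono_eval f m * mono_eval f m'"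
proof -
  define K where "K = Poly_Mapping.keys m \<union> Poly_Mapping.keys m'"
  have K: "finite K" "Poly_Mapping.keys m \<subseteq> K" "Poly_Mapping.keys m' \<subseteq> K"
    "Poly_Mapping.keys (m + m') \<subseteq> K"
    using keys_add[of m m'] by (auto simp: K_def)
  show ?thesis
    using K by (simp add: mono_eval_superset[of K] lookup_add power_add prod.distrib)
qed

lemma poly_subst_superset:
  assumes "finite K" "Poly_Mapping.keys P \<subseteq> K"
  shows "poly_subst f P = (\<Sum>m\<in>K. of_int (Poly_Mapping.lookup P m) * mono_eval f m)"
  unfolding poly_subst_def mono_eval_def
  by (rule sum.mono_neutral_left) (use assms in \<open>auto simp: not_in_keys_iff_lookup_eq_zero\<close>)

lemma poly_subst_add [simp]: "poly_subst f (P + Q) = poly_subst f P + poly_subst f Q"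
proof -
  define K where "K = Poly_Mapping.keys P \<union> Poly_Mapping.keys Q"
  have K: "finite K" "Poly_Mapping.keys P \<subseteq> K" "Poly_Mapping.keys Q \<subseteq> K"
    "Poly_Mapping.keys (P + Q) \<subseteq> K"
    using keys_add[of P Q] by (auto simp: K_def)
  show ?thesis
    using K by (simp add: poly_subst_superset[of K] lookup_add algebra_simps sum.distrib)
qed

lemma poly_subst_single:
  "poly_subst f (Poly_Mapping.single m c) = of_int c * mono_eval f m"
  by (subst poly_subst_superset[of "{m}"]) auto

lemma poly_subst_mult [simp]: "poly_subst f (P * Q) = poly_subst f P * poly_subst f Q"
proof (induction P rule: poly_mapping_add_induct)
  case (single m c)
  show ?case
    by (induction Q rule: poly_mapping_add_induct)
       (simp_all add: mult_single poly_subst_single mono_eval_add algebra_simps)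
next
  case (add p q)
  then show ?case by (simp add: algebra_simps)
qed

lemma poly_subst_of_int [simp]: "poly_subst f (of_int c) = of_int c"
proof -
  have "of_int c = (Poly_Mapping.single 0 c :: mpoly)"
    by (metis of_int_eq_id id_apply single_of_int)
  then show ?thesis
    by (simp add: poly_subst_single mono_eval_def)
qed

lemma poly_subst_0 [simp]: "poly_subst f 0 = 0"
  and poly_subst_1 [simp]: "poly_subst f 1 = 1"
  using poly_subst_of_int[of f 0] poly_subst_of_int[of f 1] by simp_all

lemma poly_subst_Var [simp]: "poly_subst f (Var v) = f v"
  by (simp add: Var_def poly_subst_single mono_eval_def)

lemma poly_subst_diff [simp]: "poly_subst f (P - Q) = poly_subst f P - poly_subst f Q"
  by (metis add_diff_cancel diff_add_cancel poly_subst_add)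

lemma poly_subst_uminus [simp]: "poly_subst f (- P) = - poly_subst f P"
  using poly_subst_diff[of f 0 P] by simp

lemma poly_subst_sum [simp]: "poly_subst f (sum g A) = (\<Sum>a\<in>A. poly_subst f (g a))"
  by (induction A rule: infinite_finite_induct) auto

lemma poly_subst_prod [simp]: "poly_subst f (prod g A) = (\<Prod>a\<in>A. poly_subst f (g a))"
  by (induction A rule: infinite_finite_induct) auto

lemma single_single_conv_Var_power:
  "(Poly_Mapping.single (Poly_Mapping.single v n) 1 :: mpoly) = Var v ^ n"
proof (induction n)
  case (Suc n)
  have "Poly_Mapping.single v (Suc n) = Poly_Mapping.single v 1 + Poly_Mapping.single v n"
    by (metis add.commute plus_1_eq_Suc single_add)
  then have "(Poly_Mapping.single (Poly_Mapping.single v (Suc n)) 1 :: mpoly)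
      = Var v * Poly_Mapping.single (Poly_Mapping.single v n) 1"
    by (simp add: Var_def mult_single)
  then show ?case using Suc by simp
qed simp

lemma mpoly_induct [case_names of_int Var add mult]:
  assumes const: "\<And>c. P (of_int c)" and var: "\<And>v. P (Var v)"
    and add: "\<And>p q. P p \<Longrightarrow> P q \<Longrightarrow> P (p + q)" and mult: "\<And>p q. P p \<Longrightarrow> P q \<Longrightarrow> P (p * q)"
  shows "P (p :: mpoly)"
proof (induction p rule: poly_mapping_add_induct)
  case (single m c)
  have "P (Poly_Mapping.single m 1)"
  proof (induction m rule: poly_mapping_add_induct)
    case (single v n)
    have "P (Var v ^ n)"
      by (induction n) (use const[of 1] var mult in auto)
    then show ?case by (simp only: single_single_conv_Var_power)
  next
    case (add m m')
    have "Poly_Mapping.single (m + m') 1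
        = (Poly_Mapping.single m 1 * Poly_Mapping.single m' 1 :: mpoly)"
      by (simp add: mult_single)
    with add mult show ?case by simp
  qed
  moreover have "Poly_Mapping.single m c = (of_int c * Poly_Mapping.single m 1 :: mpoly)"
  proof -
    have "of_int c = (Poly_Mapping.single 0 c :: mpoly)"
      by (metis of_int_eq_id id_apply single_of_int)
    then show ?thesis by (simp add: mult_single)
  qed
  ultimately show ?case using mult const by simp
qed (rule add)

lemma poly_subst_comp: "poly_subst f (poly_subst g P) = poly_subst (\<lambda>v. poly_subst f (g v)) P"
  by (induction P rule: mpoly_induct) auto

lemma poly_subst_id [simp]: "poly_subst Var P = P"
  by (induction P rule: mpoly_induct) auto

lemma lookup_Var: "Poly_Mapping.lookup (Var v) (Poly_Mapping.single w 1) = (if v = w then 1 else 0)"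
proof -
  have "Poly_Mapping.single v (1::nat) = Poly_Mapping.single w 1 \<longleftrightarrow> v = w"
    by (metis lookup_single_eq lookup_single_not_eq zero_neq_one)
  then show ?thesis
    unfolding Var_def lookup_single when_def by simp
qed

lemma Var_eq_iff [simp]: "Var v = Var w \<longleftrightarrow> v = w"
  by (metis lookup_Var zero_neq_one)

section \<open>Divided differences\<close>

definition swap :: "var \<Rightarrow> var \<Rightarrow> mpoly \<Rightarrow> mpoly" where
  "swap a b = poly_subst (\<lambda>v. Var (transpose a b v))"

lemma swap_simps [simp]:
  "swap a b (P + Q) = swap a b P + swap a b Q"
  "swap a b (P - Q) = swap a b P - swap a b Q"
  "swap a b (P * Q) = swap a b P * swap a b Q"
  "swap a b (- P) = - swap a b P"
  "swap a b 0 = 0" "swap a b 1 = 1" "swap a b (of_int c) = of_int c"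
  "swap a b (sum g A) = (\<Sum>x\<in>A. swap a b (g x))"
  "swap a b (prod g A) = (\<Prod>x\<in>A. swap a b (g x))"
  "swap a b (Var v) = Var (transpose a b v)"
  by (simp_all add: swap_def)

lemma swap_conj: "swap a b (swap c d P) = swap (transpose a b c) (transpose a b d) (swap a b P)"
  unfolding swap_def poly_subst_comp
  by (simp, rule arg_cong[where f = "\<lambda>g. poly_subst g P"])
     (auto simp: fun_eq_iff transpose_def)

lemma swap_swap [simp]: "swap a b (swap a b P) = P"
  by (simp add: swap_def poly_subst_comp)

lemma swap_commute: "swap a b = swap b a"
  by (simp add: swap_def transpose_commute)

lemma dd_exists: "\<exists>Q. (Var a - Var b) * Q = P - swap a b P"
proof (induction P rule: mpoly_induct)
  case (of_int c)
  then show ?case by (intro exI[of _ 0]) simp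
next
  case (Var v)
  consider "v = a" | "v = b" "v \<noteq> a" | "v \<noteq> a" "v \<noteq> b" by blast
  then show ?case
  proof cases
    case 1 then show ?thesis by (intro exI[of _ 1]) simp
  next
    case 2 then show ?thesis by (intro exI[of _ "-1"]) simp
  next
    case 3 then show ?thesis by (intro exI[of _ 0]) simp
  qed
next
  case (add p q)
  then obtain r s where "(Var a - Var b) * r = p - swap a b p" "(Var a - Var b) * s = q - swap a b q"
    by auto
  then show ?case by (intro exI[of _ "r + s"]) (simp add: algebra_simps)
next
  case (mult p q)
  then obtain r s where rs: "(Var a - Var b) * r = p - swap a b p" "(Var a - Var b) * s = q - swap a b q"
    by auto
  have "(Var a - Var b) * (r * q + swap a b p * s)
      = ((Var a - Var b) * r) * q + swap a b p * ((Var a - Var b) * s)"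
    by (simp add: algebra_simps)
  also have "\<dots> = p * q - swap a b (p * q)"
    unfolding rs by (simp add: algebra_simps)
  finally show ?case by blast
qed

definition dd :: "var \<Rightarrow> var \<Rightarrow> mpoly \<Rightarrow> mpoly" where
  "dd a b P = (THE Q. (Var a - Var b) * Q = P - swap a b P)"

lemma dd_unique:
  assumes "a \<noteq> b" "(Var a - Var b) * Q = P - swap a b P"
  shows "dd a b P = Q"
  unfolding dd_def
proof (rule the_equality)
  fix Q' assume "(Var a - Var b) * Q' = P - swap a b P"
  with assms have "(Var a - Var b) * Q' = (Var a - Var b) * Q" by simp
  with assms(1) show "Q' = Q" by simp
qed (fact assms(2))

lemma dd_eq:
  assumes "a \<noteq> b"
  shows "(Var a - Var b) * dd a b P = P - swap a b P"
  using dd_exists[of a b P] dd_unique[OF assms] by metis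

lemma dd_swap:
  assumes "a \<noteq> b" "swap a b P = P"
  shows "dd a b P = 0"
  using assms by (intro dd_unique) auto

lemma swap_dd:
  assumes "a \<noteq> b"
  shows "swap a b (dd a b P) = dd a b P"
proof -
  have "swap a b ((Var a - Var b) * dd a b P) = swap a b P - P"
    unfolding dd_eq[OF assms] by simp
  then have "(Var b - Var a) * swap a b (dd a b P) = swap a b P - P" by simp
  then have "(Var a - Var b) * swap a b (dd a b P) = P - swap a b P"
    by (metis minus_diff_eq mult_minus_left)
  then show ?thesis using dd_unique[OF assms] by metis
qed

lemma dd_dd [simp]: "a \<noteq> b \<Longrightarrow> dd a b (dd a b P) = 0"
  by (simp add: dd_swap swap_dd)

lemma dd_add: "a \<noteq> b \<Longrightarrow> dd a b (P + Q) = dd a b P + dd a b Q"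
  by (rule dd_unique) (simp_all only: distrib_left dd_eq swap_simps not_False_eq_True, simp_all)

lemma dd_0 [simp]: "a \<noteq> b \<Longrightarrow> dd a b 0 = 0"
  by (rule dd_unique) simp_all

lemma dd_uminus: "a \<noteq> b \<Longrightarrow> dd a b (- P) = - dd a b P"
  by (rule dd_unique) (simp_all add: dd_eq)

lemma dd_diff: "a \<noteq> b \<Longrightarrow> dd a b (P - Q) = dd a b P - dd a b Q"
  using dd_add[of a b P "- Q"] by (simp add: dd_uminus)

lemma dd_sum: "a \<noteq> b \<Longrightarrow> dd a b (sum g A) = (\<Sum>x\<in>A. dd a b (g x))"
  by (induction A rule: infinite_finite_induct) (auto simp: dd_add)

lemma dd_mult:
  assumes "a \<noteq> b"
  shows "dd a b (P * Q) = dd a b P * Q + swap a b P * dd a b Q"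
proof (rule dd_unique[OF assms])
  have "(Var a - Var b) * (dd a b P * Q + swap a b P * dd a b Q)
      = ((Var a - Var b) * dd a b P) * Q + swap a b P * ((Var a - Var b) * dd a b Q)"
    by (simp add: algebra_simps)
  also have "\<dots> = P * Q - swap a b (P * Q)"
    unfolding dd_eq[OF assms] by (simp add: algebra_simps)
  finally show "(Var a - Var b) * (dd a b P * Q + swap a b P * dd a b Q) = P * Q - swap a b (P * Q)" .
qed

lemma dd_mult_sym: "a \<noteq> b \<Longrightarrow> swap a b P = P \<Longrightarrow> dd a b (P * Q) = P * dd a b Q"
  by (simp add: dd_mult dd_swap)

lemma dd_Var: "a \<noteq> b \<Longrightarrow> dd a b (Var v) = (if v = a then 1 else if v = b then -1 else 0)"
  by (rule dd_unique) auto

lemma dd_linear_mult_sym: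
  assumes "a \<noteq> b" "swap a b P = P" "c \<noteq> a" "c \<noteq> b"
  shows "dd a b ((Var a - Var c) * P) = P"
  using assms by (simp add: dd_mult dd_swap dd_diff dd_Var)

lemma swap_dd_conj:
  assumes "c \<noteq> d"
  shows "swap a b (dd c d P) = dd (transpose a b c) (transpose a b d) (swap a b P)"
proof (rule dd_unique[symmetric])
  show "transpose a b c \<noteq> transpose a b d"
    using assms by (auto simp: transpose_def)
  have "swap a b ((Var c - Var d) * dd c d P) = swap a b (P - swap c d P)"
    unfolding dd_eq[OF assms] ..
  then show "(Var (transpose a b c) - Var (transpose a b d)) * swap a b (dd c d P)
      = swap a b P - swap (transpose a b c) (transpose a b d) (swap a b P)"
    using swap_conj by simp
qed

lemma dd_commute:
  assumes "a \<noteq> b" "c \<noteq> d" "{a, b} \<inter> {c, d} = {}"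
  shows "dd a b (dd c d P) = dd c d (dd a b P)"
proof (rule dd_unique[OF assms(1)])
  have t: "transpose c d a = a" "transpose c d b = b" "transpose a b c = c" "transpose a b d = d"
    using assms by (auto simp: transpose_def)
  have "swap c d (Var a - Var b) = Var a - Var b" using t by simp
  then have "(Var a - Var b) * dd c d (dd a b P) = dd c d ((Var a - Var b) * dd a b P)"
    using assms by (simp add: dd_mult_sym)
  also have "\<dots> = dd c d (P - swap a b P)"
    using assms by (simp add: dd_eq)
  also have "\<dots> = dd c d P - dd c d (swap a b P)"
    using assms by (simp add: dd_diff)
  also have "dd c d (swap a b P) = swap a b (dd c d P)"
    using assms t by (simp add: swap_dd_conj)
  finally show "(Var a - Var b) * dd c d (dd a b P) = dd c d P - swap a b (dd c d P)" .
qed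

lemma dd_braid_expand:
  assumes "a \<noteq> b" "b \<noteq> c" "a \<noteq> c"
  shows "(Var a - Var b) * (Var a - Var c) * (Var b - Var c) * dd a b (dd b c (dd a b P))
    = P - swap a b P - swap b c P + swap a b (swap b c P) + swap b c (swap a b P)
      - swap a b (swap b c (swap a b P))"
proof -
  define Q where "Q = dd a b P"
  define R where "R = dd b c Q"
  have Q: "(Var a - Var b) * Q = P - swap a b P"
    using assms by (simp add: Q_def dd_eq)
  have R: "(Var b - Var c) * R = Q - swap b c Q"
    using assms by (simp add: R_def dd_eq)
  have S: "(Var a - Var b) * dd a b R = R - swap a b R"
    using assms by (simp add: dd_eq)
  have t: "transpose a b c = c" "transpose b c a = a"
    using assms by (auto simp: transpose_def)
  have sQ: "swap a b Q = Q"
    using assms by (simp add: Q_def swap_dd)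
  have R': "(Var a - Var c) * swap a b R = Q - swap a b (swap b c Q)"
    using arg_cong[OF R, of "swap a b"] sQ t by simp
  have Q1: "(Var a - Var c) * swap b c Q = swap b c P - swap b c (swap a b P)"
    using arg_cong[OF Q, of "swap b c"] t by simp
  have Q2: "(Var b - Var c) * swap a b (swap b c Q)
      = swap a b (swap b c P) - swap a b (swap b c (swap a b P))"
    using arg_cong[OF Q1, of "swap a b"] t by simp
  have "(Var a - Var b) * (Var a - Var c) * (Var b - Var c) * dd a b R
      = (Var a - Var c) * (Var b - Var c) * ((Var a - Var b) * dd a b R)"
    by (simp add: algebra_simps)
  also have "\<dots> = (Var a - Var c) * ((Var b - Var c) * R)
      - (Var b - Var c) * ((Var a - Var c) * swap a b R)"
    unfolding S by (simp add: algebra_simps)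
  also have "\<dots> = (Var a - Var b) * Q - (Var a - Var c) * swap b c Q
      + (Var b - Var c) * swap a b (swap b c Q)"
    unfolding R R' by (simp add: algebra_simps)
  also have "\<dots> = P - swap a b P - swap b c P + swap a b (swap b c P) + swap b c (swap a b P)
      - swap a b (swap b c (swap a b P))"
    unfolding Q Q1 Q2 by (simp only: diff_diff_eq2 diff_diff_eq add_diff_eq diff_add_eq ac_simps)
  finally show ?thesis
    unfolding R_def Q_def .
qed

lemma dd_braid:
  assumes "a \<noteq> b" "b \<noteq> c" "a \<noteq> c"
  shows "dd a b (dd b c (dd a b P)) = dd b c (dd a b (dd b c P))"
proof -
  have neg: "dd x y F = - dd y x F" if "x \<noteq> y" for x y F
  proof (rule dd_unique[OF that])
    have "(Var x - Var y) * - dd y x F = (Var y - Var x) * dd y x F"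
      by (simp add: algebra_simps)
    then show "(Var x - Var y) * - dd y x F = F - swap x y F"
      using that by (simp add: dd_eq swap_commute)
  qed
  have sw: "swap a b (swap b c (swap a b P)) = swap b c (swap a b (swap b c P))"
  proof -
    have "swap a b (swap b c (swap a b P)) = swap a c P"
      using swap_conj[of a b b c "swap a b P"] assms by (simp add: transpose_def)
    also have "swap a c P = swap b c (swap a b (swap b c P))"
      using swap_conj[of b c a b "swap b c P"] assms by (simp add: transpose_def)
    finally show ?thesis .
  qed
  define d where "d = (Var a - Var b) * (Var a - Var c) * (Var b - Var c)"
  have "d \<noteq> 0" using assms by (simp add: d_def)
  have "dd b c (dd a b (dd b c P)) = - dd c b (dd b a (dd c b P))"
    using assms by (simp add: neg[of b c] neg[of a b] dd_uminus)
  moreover have "d = - ((Var c - Var b) * (Var c - Var a) * (Var b - Var a))"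
    by (simp add: d_def algebra_simps)
  ultimately have "d * dd b c (dd a b (dd b c P))
      = (Var c - Var b) * (Var c - Var a) * (Var b - Var a) * dd c b (dd b a (dd c b P))"
    by (simp only: minus_mult_minus)
  also have "\<dots> = d * dd a b (dd b c (dd a b P))"
    unfolding d_def using assms sw
    by (simp add: dd_braid_expand swap_commute[of c b] swap_commute[of b a])
  finally show ?thesis using \<open>d \<noteq> 0\<close> by simp
qed

lemma swap_x_conv_swap: "swap_x i = swap (X i) (X (Suc i))"
  unfolding swap_x_def swap_def
  by (rule arg_cong[where f = poly_subst])
     (auto simp: fun_eq_iff adj_def transpose_def split: var.split)

lemma divdiff_conv_dd: "divdiff i = dd (X i) (X (Suc i))"
  by (simp add: fun_eq_iff divdiff_def dd_def swap_x_conv_swap)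

declare One_nat_def [simp del]

section \<open>Lengths of permutations\<close>

lemma S_infI: "u permutes {1..N} \<Longrightarrow> u \<in> S_inf"
  unfolding S_inf_def
  by (auto elim: permutes_subset intro!: finite_subset[of "{i. u i \<noteq> i}" "{1..N}"] dest: permutes_not_in)

lemma S_inf_permutes:
  assumes "u \<in> S_inf"
  obtains N where "u permutes {1..N}" "M \<le> N"
proof -
  have u: "u permutes {1..}" "finite {i. u i \<noteq> i}"
    using assms by (auto simp: S_inf_def)
  obtain B where B: "\<And>i. u i \<noteq> i \<Longrightarrow> i \<le> B"
    using u(2) by (auto simp: finite_nat_set_iff_bounded_le)
  have "u permutes {1..max B M}"
    using u(1) B by (auto simp: permutes_def intro: le_max_iff_disj[THEN iffD2])
  then show thesis using that by auto
qed

lemma permutes_atLeastAtMost_mono: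
  fixes u :: "nat \<Rightarrow> nat"
  shows "u permutes {1..N} \<Longrightarrow> N \<le> M \<Longrightarrow> u permutes {1..M}"
  by (auto intro: permutes_subset)

lemma adj_permutes: "1 \<le> i \<Longrightarrow> i < N \<Longrightarrow> adj i permutes {1..N}"
  unfolding adj_def by (rule permutes_swap_id) auto

lemma adj_adj [simp]: "adj i (adj i j) = j" "adj i \<circ> adj i = id"
  by (simp_all add: adj_def)

lemma adj_simps [simp]: "adj i i = Suc i" "adj i (Suc i) = i"
  by (simp_all add: adj_def)

lemma adj_other [simp]: "j \<noteq> i \<Longrightarrow> j \<noteq> Suc i \<Longrightarrow> adj i j = j"
  by (simp add: adj_def)

lemma comp_adj_adj [simp]: "u \<circ> adj i \<circ> adj i = u"
  by (simp add: fun_eq_iff)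

lemma S_inf_comp: "u \<in> S_inf \<Longrightarrow> v \<in> S_inf \<Longrightarrow> u \<circ> v \<in> S_inf"
  by (metis S_infI S_inf_permutes permutes_atLeastAtMost_mono permutes_compose)

lemma permutes_comp_adj:
  "u permutes {1..N} \<Longrightarrow> 1 \<le> i \<Longrightarrow> i < N \<Longrightarrow> u \<circ> adj i permutes {1..N}"
  by (intro permutes_compose adj_permutes)

lemma S_inf_inv: "u \<in> S_inf \<Longrightarrow> inv u \<in> S_inf"
  by (metis S_infI S_inf_permutes permutes_inv)

lemma S_inf_transpose:
  assumes "1 \<le> a" "1 \<le> b" shows "transpose a b \<in> S_inf"
  by (rule S_infI[of _ "max a b"]) (use assms in \<open>auto intro: permutes_swap_id\<close>)

lemma S_inf_adj: "1 \<le> i \<Longrightarrow> adj i \<in> S_inf"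
  unfolding adj_def by (rule S_inf_transpose) auto

lemma S_inf_comp_adj: "u \<in> S_inf \<Longrightarrow> 1 \<le> i \<Longrightarrow> u \<circ> adj i \<in> S_inf"
  by (intro S_inf_comp S_inf_adj)

lemma S_inf_id: "id \<in> S_inf"
  by (rule S_infI[of _ 0]) auto

lemma S_inf_inj: "u \<in> S_inf \<Longrightarrow> inj u"
  by (auto simp: S_inf_def permutes_inj)

lemma S_inf_bij: "u \<in> S_inf \<Longrightarrow> bij u"
  by (auto simp: S_inf_def permutes_bij)

lemma S_inf_eq_iff: "u \<in> S_inf \<Longrightarrow> u i = u j \<longleftrightarrow> i = j"
  by (auto dest: S_inf_inj injD)

lemma S_inf_0: "u \<in> S_inf \<Longrightarrow> u 0 = 0"
  by (auto simp: S_inf_def permutes_def)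

lemma permutes_le_iff:
  fixes u :: "nat \<Rightarrow> nat"
  assumes "u permutes {1..N}" shows "u i \<le> N \<longleftrightarrow> i \<le> N"
  using assms permutes_in_image[OF assms, of i] permutes_not_in[OF assms, of i]
  by (cases "i = 0") auto

definition inversions :: "(nat \<Rightarrow> nat) \<Rightarrow> (nat \<times> nat) set" where
  "inversions u = {(i, j). 1 \<le> i \<and> i < j \<and> u i > u j}"

lemma perm_length_conv: "perm_length u = card (inversions u)"
  by (simp add: perm_length_def inversions_def)

lemma inversions_subset:
  assumes "u permutes {1..N}" shows "inversions u \<subseteq> {1..N} \<times> {1..N}"
proof -
  have "j \<le> N" if "i < j" "u j < u i" for i j
  proof (rule ccontr)
    assume "\<not> j \<le> N"
    then have "u j = j" using assms by (auto simp: permutes_def)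
    then show False using that permutes_le_iff[OF assms, of i] permutes_not_in[OF assms, of i]
        \<open>\<not> j \<le> N\<close> by (cases "i \<le> N") auto
  qed
  then show ?thesis unfolding inversions_def by force
qed

lemma finite_inversions: "u \<in> S_inf \<Longrightarrow> finite (inversions u)"
  by (metis S_inf_permutes inversions_subset finite_SigmaI finite_atLeastAtMost finite_subset)

lemma perm_length_le:
  assumes "u permutes {1..N}" shows "perm_length u \<le> N * N"
  using card_mono[OF _ inversions_subset[OF assms]]
  by (simp add: perm_length_conv card_cartesian_product)

lemma adj_less: "a < b \<Longrightarrow> (a, b) \<noteq> (i, Suc i) \<Longrightarrow> adj i a < adj i b"
  by (auto simp: adj_def transpose_def)

lemma adj_ge_1: "1 \<le> i \<Longrightarrow> 1 \<le> a \<Longrightarrow> 1 \<le> adj i a"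
  by (auto simp: adj_def transpose_def)

lemma perm_length_ascent:
  assumes "u \<in> S_inf" "1 \<le> i" "u i < u (Suc i)"
  shows "perm_length (u \<circ> adj i) = Suc (perm_length u)"
proof -
  let ?f = "\<lambda>(a, b). (adj i a, adj i b)"
  have "(a, b) \<in> inversions (u \<circ> adj i) \<longleftrightarrow> (a, b) \<in> insert (i, Suc i) (?f ` inversions u)" for a b
  proof (cases "(a, b) = (i, Suc i)")
    case True
    then show ?thesis using assms by (simp add: inversions_def)
  next
    case False
    have img: "(a, b) \<in> ?f ` inversions u \<longleftrightarrow> (adj i a, adj i b) \<in> inversions u"
      by (force simp: image_iff)
    have 1: "adj i a < adj i b \<Longrightarrow> a < b" if "u (adj i b) < u (adj i a)"
      using adj_less[of "adj i a" "adj i b" i] that assms(3) by (cases "adj i a = i \<and> adj i b = Suc i") auto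
    have 2: "a < b \<Longrightarrow> adj i a < adj i b"
      using False adj_less by blast
    have 3: "1 \<le> a \<longleftrightarrow> 1 \<le> adj i a"
      using adj_ge_1[of i a] adj_ge_1[of i "adj i a"] assms(2) by auto
    show ?thesis unfolding insert_iff img using False 1 2 3 by (auto simp: inversions_def)
  qed
  then have eq: "inversions (u \<circ> adj i) = insert (i, Suc i) (?f ` inversions u)"
    by auto
  have "inj_on ?f (inversions u)"
    by (rule inj_onI) (auto, (metis adj_adj(1))+)
  moreover have "(i, Suc i) \<notin> ?f ` inversions u"
  proof
    assume "(i, Suc i) \<in> ?f ` inversions u"
    then obtain a b where "(a, b) \<in> inversions u" "i = adj i a" "Suc i = adj i b" by auto
    then have "a = Suc i" "b = i" by (metis adj_adj(1) adj_simps)+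
    with \<open>(a, b) \<in> inversions u\<close> show False by (auto simp: inversions_def)
  qed
  ultimately show ?thesis
    unfolding perm_length_conv eq using finite_inversions[OF assms(1)]
    by (simp add: card_image)
qed

lemma perm_length_descent:
  assumes "u \<in> S_inf" "1 \<le> i" "u (Suc i) < u i"
  shows "perm_length u = Suc (perm_length (u \<circ> adj i))"
  using perm_length_ascent[of "u \<circ> adj i" i] assms S_inf_comp S_inf_adj by simp

lemma perm_length_adj_gt_iff:
  assumes "u \<in> S_inf" "1 \<le> i"
  shows "perm_length u < perm_length (u \<circ> adj i) \<longleftrightarrow> u i < u (Suc i)"
  using perm_length_ascent[OF assms] perm_length_descent[OF assms] S_inf_eq_iff[OF assms(1), of i "Suc i"]
  by (cases "u i" "u (Suc i)" rule: linorder_cases) auto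

lemma perm_length_transpose:
  assumes "u \<in> S_inf" "1 \<le> a" "a < b" "u a < u b"
  shows "perm_length (u \<circ> transpose a b)
    = Suc (perm_length u) + 2 * card {c. a < c \<and> c < b \<and> u a < u c \<and> u c < u b}"
  using assms
proof (induction "b - a" arbitrary: u a)
  case 0
  then show ?case by simp
next
  case (Suc d)
  show ?case
  proof (cases "b = Suc a")
    case True
    then have "{c. a < c \<and> c < b \<and> u a < u c \<and> u c < u b} = {}" by auto
    then show ?thesis using True Suc.prems perm_length_ascent[of u a] by (simp add: adj_def)
  next
    case False
    define v where "v = u \<circ> adj a"
    have v: "v \<in> S_inf" using Suc.prems by (simp add: v_def S_inf_comp S_inf_adj)
    have va: "v a = u (Suc a)" "v (Suc a) = u a" by (simp_all add: v_def)
    have vc: "v c = u c" if "Suc a < c" for c using that by (simp add: v_def)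
    define w where "w = v \<circ> transpose (Suc a) b"
    have w: "w \<in> S_inf" unfolding w_def using v Suc.prems by (intro S_inf_comp S_inf_transpose) auto
    have ut: "u \<circ> transpose a b = w \<circ> adj a"
      using Suc.prems False by (auto simp: fun_eq_iff w_def v_def adj_def transpose_def)
    have wa: "w a = u (Suc a)" "w (Suc a) = u b"
      using Suc.prems False va by (auto simp: w_def vc)
    let ?C = "{c. Suc a < c \<and> c < b \<and> u a < u c \<and> u c < u b}"
    have "{c. Suc a < c \<and> c < b \<and> v (Suc a) < v c \<and> v c < v b} = ?C"
      using Suc.prems False by (auto simp: va vc)
    then have lw: "perm_length w = Suc (perm_length v) + 2 * card ?C"
      using Suc.hyps(1)[of "Suc a" v] Suc.hyps(2) Suc.prems False v va vc[of b]
      unfolding w_def by simp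
    have ne: "u (Suc a) \<noteq> u a" "u (Suc a) \<noteq> u b"
      using S_inf_eq_iff[OF Suc.prems(1)] False Suc.prems by auto
    have fin: "finite ?C" by (rule finite_subset[of _ "{..b}"]) auto
    consider "u (Suc a) < u a" | "u a < u (Suc a)" "u (Suc a) < u b" | "u b < u (Suc a)"
      using ne by linarith
    then show ?thesis
    proof cases
      case 1
      then have "{c. a < c \<and> c < b \<and> u a < u c \<and> u c < u b} = ?C"
        by (auto, metis Suc_lessI less_asym)
      moreover have "perm_length u = Suc (perm_length v)"
        using 1 Suc.prems perm_length_descent[of u a] by (simp add: v_def)
      moreover have "perm_length (w \<circ> adj a) = Suc (perm_length w)"
        using 1 wa w Suc.prems by (intro perm_length_ascent) auto
      ultimately show ?thesis using lw ut by simp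
    next
      case 2
      then have "{c. a < c \<and> c < b \<and> u a < u c \<and> u c < u b} = insert (Suc a) ?C"
        using Suc.prems False by auto
      moreover have "perm_length v = Suc (perm_length u)"
        using 2 Suc.prems perm_length_ascent[of u a] by (simp add: v_def)
      moreover have "perm_length (w \<circ> adj a) = Suc (perm_length w)"
        using 2 wa w Suc.prems by (intro perm_length_ascent) auto
      ultimately show ?thesis using lw ut fin by simp
    next
      case 3
      then have "{c. a < c \<and> c < b \<and> u a < u c \<and> u c < u b} = ?C"
        by (auto, metis Suc_lessI less_asym)
      moreover have "perm_length v = Suc (perm_length u)"
        using 3 Suc.prems perm_length_ascent[of u a] by (simp add: v_def)
      moreover have "perm_length w = Suc (perm_length (w \<circ> adj a))"
        using 3 wa w Suc.prems by (intro perm_length_descent) auto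
      ultimately show ?thesis using lw ut by simp
    qed
  qed
qed

definition covers :: "(nat \<Rightarrow> nat) \<Rightarrow> nat \<Rightarrow> nat \<Rightarrow> bool" where
  "covers u a b \<longleftrightarrow> u a < u b \<and> (\<forall>c. a < c \<and> c < b \<longrightarrow> \<not> (u a < u c \<and> u c < u b))"

lemma covers_iff_length:
  assumes "u \<in> S_inf" "1 \<le> a" "a < b"
  shows "perm_length (u \<circ> transpose a b) = Suc (perm_length u) \<longleftrightarrow> covers u a b"
proof (cases "u a < u b")
  case True
  have "finite {c. a < c \<and> c < b \<and> u a < u c \<and> u c < u b}"
    by (rule finite_subset[of _ "{..b}"]) auto
  then show ?thesis
    using perm_length_transpose[OF assms True] True by (auto simp: covers_def)
next
  case False
  let ?v = "u \<circ> transpose a b"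
  have "?v \<in> S_inf" using assms by (intro S_inf_comp S_inf_transpose) auto
  moreover have "?v a < ?v b"
    using False S_inf_eq_iff[OF assms(1), of a b] assms(3) by auto
  moreover have "?v \<circ> transpose a b = u" by (simp add: fun_eq_iff)
  ultimately have "perm_length u > perm_length ?v"
    using perm_length_transpose[of ?v a b] assms by simp
  then show ?thesis using False by (simp add: covers_def)
qed

lemma word_prod_Nil [simp]: "word_prod [] = id"
  and word_prod_Cons [simp]: "word_prod (i # is) = adj i \<circ> word_prod is"
  by (simp_all add: word_prod_def)

lemma word_prod_append: "word_prod (is @ js) = word_prod is \<circ> word_prod js"
  by (induction "is") (simp_all add: comp_assoc)

lemma word_prod_S_inf: "\<forall>i\<in>set is. 1 \<le> i \<Longrightarrow> word_prod is \<in> S_inf"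
  by (induction "is") (auto simp: S_inf_id intro!: S_inf_comp S_inf_adj)

lemma perm_length_comp_word_prod_le:
  assumes "v \<in> S_inf" "\<forall>i\<in>set is. 1 \<le> i"
  shows "perm_length (v \<circ> word_prod is) \<le> perm_length v + length is"
  using assms
proof (induction "is" arbitrary: v)
  case (Cons i "is")
  have "perm_length (v \<circ> adj i \<circ> word_prod is) \<le> perm_length (v \<circ> adj i) + length is"
    using Cons.prems by (intro Cons.IH S_inf_comp_adj) simp_all
  moreover have "perm_length (v \<circ> adj i) \<le> Suc (perm_length v)"
    using perm_length_ascent[of v i] perm_length_descent[of v i] Cons.prems
      S_inf_eq_iff[of v i "Suc i"] by (cases "v i" "v (Suc i)" rule: linorder_cases) auto
  ultimately show "perm_length (v \<circ> word_prod (i # is)) \<le> perm_length v + length (i # is)"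
    by (simp add: comp_assoc)
qed simp

lemma perm_length_id [simp]: "perm_length id = 0"
proof -
  have "{(i::nat, j). 1 \<le> i \<and> i < j \<and> id i > id j} = {}" by auto
  then show ?thesis unfolding perm_length_def by (metis card.empty)
qed

lemma monotone_permutes_eq:
  assumes u: "u permutes {1..N}"
    and asc: "\<And>i. 1 \<le> i \<Longrightarrow> i < N \<Longrightarrow> u i < u (Suc i)"
  shows "u = id"
proof -
  have lo: "i \<le> u i" if "1 \<le> i" "i \<le> N" for i
    using that
  proof (induction i rule: dec_induct)
    case base
    then show ?case using permutes_in_image[OF u, of 1] by auto
  next
    case (step i)
    then show ?case using asc[of i] by force
  qed
  have hi: "u i \<le> i" if "i \<le> N" "1 \<le> i" for i
    using that
  proof (induction i rule: inc_induct)
    case base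
    then show ?case using permutes_in_image[OF u, of N] by auto
  next
    case (step i)
    then show ?case using asc[of i] by force
  qed
  have "u i = i" for i
    using lo[of i] hi[of i] permutes_not_in[OF u, of i] by (cases "i \<in> {1..N}") auto
  then show ?thesis by auto
qed

lemma reduced_word_exists: "x \<in> S_inf \<Longrightarrow> \<exists>is. reduced_word x is"
proof (induction "perm_length x" arbitrary: x)
  case 0
  obtain N where N: "x permutes {1..N}" using S_inf_permutes[OF "0.prems"] .
  have "x i < x (Suc i)" if "1 \<le> i" "i < N" for i
    using perm_length_descent[OF "0.prems", of i] that S_inf_eq_iff[OF "0.prems", of i "Suc i"] 0
    by (cases "x i" "x (Suc i)" rule: linorder_cases) auto
  then have "x = id" using monotone_permutes_eq[OF N] by blast
  then have "reduced_word x []" by (simp add: reduced_word_def)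
  then show ?case by blast
next
  case (Suc l)
  obtain N where N: "x permutes {1..N}" using S_inf_permutes[OF Suc.prems] .
  have "x \<noteq> id" using Suc.hyps(2) by auto
  then obtain i where i: "1 \<le> i" "\<not> x i < x (Suc i)"
    using monotone_permutes_eq[OF N] by blast
  then have d: "x (Suc i) < x i"
    using S_inf_eq_iff[OF Suc.prems, of i "Suc i"] by force
  have len: "perm_length x = Suc (perm_length (x \<circ> adj i))"
    using perm_length_descent[OF Suc.prems i(1) d] .
  obtain js where js: "reduced_word (x \<circ> adj i) js"
    using Suc.hyps(1)[of "x \<circ> adj i"] len Suc.hyps(2) Suc.prems i S_inf_comp S_inf_adj by auto
  then have "reduced_word x (js @ [i])"
    using i len by (auto simp: reduced_word_def word_prod_append)
  then show ?case by blast
qed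

lemma perm_length_comp_le:
  assumes "v \<in> S_inf" "x \<in> S_inf"
  shows "perm_length (v \<circ> x) \<le> perm_length v + perm_length x"
  using reduced_word_exists[OF assms(2)] perm_length_comp_word_prod_le[OF assms(1)]
  by (metis reduced_word_def)

section \<open>Double Schubert polynomials\<close>

definition rev_perm :: "nat \<Rightarrow> nat \<Rightarrow> nat" where
  "rev_perm N i = (if 1 \<le> i \<and> i \<le> N then Suc N - i else i)"

lemma w0_conv_rev_perm: "w0 n = rev_perm (Suc n)"
  by (auto simp: w0_def rev_perm_def fun_eq_iff)

lemma rev_perm_rev_perm [simp]: "rev_perm N (rev_perm N i) = i"
  by (auto simp: rev_perm_def)

lemma rev_perm_permutes: "rev_perm N permutes {1..N}"
proof -
  have "bij_betw (rev_perm N) {1..N} {1..N}"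
    by (rule bij_betwI[where g = "rev_perm N"]) (auto simp: rev_perm_def)
  then show ?thesis by (rule bij_imp_permutes) (auto simp: rev_perm_def)
qed

lemma antimonotone_permutes_eq:
  assumes u: "u permutes {1..N}"
    and desc: "\<And>i. 1 \<le> i \<Longrightarrow> i < N \<Longrightarrow> u (Suc i) < u i"
  shows "u = rev_perm N"
proof -
  have "rev_perm N \<circ> u = id"
  proof (rule monotone_permutes_eq)
    show "rev_perm N \<circ> u permutes {1..N}"
      using u rev_perm_permutes by (rule permutes_compose)
    show "(rev_perm N \<circ> u) i < (rev_perm N \<circ> u) (Suc i)" if "1 \<le> i" "i < N" for i
      using desc[OF that] that permutes_in_image[OF u, of i] permutes_in_image[OF u, of "Suc i"]
      by (auto simp: rev_perm_def)
  qed
  then show ?thesis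
    by (metis comp_id comp_assoc rev_perm_rev_perm comp_def ext)
qed

definition schub_top :: "nat \<Rightarrow> mpoly" where
  "schub_top N = (\<Prod>i\<in>{1..N}. \<Prod>j\<in>{1..N - i}. Var (X i) - Var (Y j))"

lemma schubert_w0_conv: "schubert_w0 n = schub_top (Suc n)"
proof -
  have "{(i, j). 1 \<le> i \<and> 1 \<le> j \<and> i + j \<le> n + 1} = (SIGMA i:{1..Suc n}. {1..Suc n - i})"
    by auto
  then show ?thesis
    unfolding schubert_w0_def schub_top_def by (subst prod.Sigma) simp_all
qed

text \<open>
  The graph of the Schubert polynomials of \<open>S\<^sub>N\<close>. That it is the graph of a function is a
  diamond argument, which uses the commutation and braid relations only.
\<close>

inductive schub_rel :: "nat \<Rightarrow> (nat \<Rightarrow> nat) \<Rightarrow> mpoly \<Rightarrow> bool" for N where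
  top: "schub_rel N (rev_perm N) (schub_top N)"
| step: "schub_rel N u P \<Longrightarrow> 1 \<le> i \<Longrightarrow> i < N \<Longrightarrow> u (Suc i) < u i
    \<Longrightarrow> schub_rel N (u \<circ> adj i) (divdiff i P)"

lemma schub_rel_permutes: "schub_rel N u P \<Longrightarrow> u permutes {1..N}"
proof (induction rule: schub_rel.induct)
  case top
  show ?case by (rule rev_perm_permutes)
next
  case (step u P i)
  then show ?case by (intro permutes_comp_adj)
qed

lemma ascent_induct [consumes 1, case_names top step]:
  assumes u: "u permutes {1..N}"
    and top: "P (rev_perm N)"
    and step: "\<And>u. u permutes {1..N} \<Longrightarrow>
      (\<And>v. v permutes {1..N} \<Longrightarrow> perm_length u < perm_length v \<Longrightarrow> P v) \<Longrightarrow>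
      u \<noteq> rev_perm N \<Longrightarrow> P u"
  shows "P u"
  using u
proof (induction "N * N - perm_length u" arbitrary: u rule: less_induct)
  case less
  show ?case
  proof (cases "u = rev_perm N")
    case False
    show ?thesis
    proof (rule step[OF less.prems _ False])
      fix v :: "nat \<Rightarrow> nat"
      assume "v permutes {1..N}" "perm_length u < perm_length v"
      moreover have "perm_length v \<le> N * N" using calculation(1) by (rule perm_length_le)
      ultimately show "P v" by (intro less.hyps) linarith+
    qed
  qed (use top in simp)
qed

lemma ex_ascent:
  assumes "u permutes {1..N}" "u \<noteq> rev_perm N"
  obtains i where "1 \<le> i" "i < N" "u i < u (Suc i)"
proof -
  have "\<exists>i. 1 \<le> i \<and> i < N \<and> \<not> u (Suc i) < u i"
    using antimonotone_permutes_eq[OF assms(1)] assms(2) by blast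
  moreover have "u i \<noteq> u (Suc i)" for i
    using S_inf_eq_iff[OF S_infI[OF assms(1)], of i "Suc i"] by simp
  ultimately show thesis using that by (meson linorder_neqE_nat)
qed

lemma schub_rel_step':
  assumes "schub_rel N (u \<circ> adj i) P" "1 \<le> i" "i < N" "u i < u (Suc i)"
  shows "schub_rel N u (divdiff i P)"
  using schub_rel.step[OF assms(1-3)] assms(4) by simp

lemma schub_rel_exists: "u permutes {1..N} \<Longrightarrow> \<exists>P. schub_rel N u P"
proof (induction rule: ascent_induct)
  case top
  then show ?case using schub_rel.top by blast
next
  case (step u)
  then obtain i where i: "1 \<le> i" "i < N" "u i < u (Suc i)" using ex_ascent by blast
  have "perm_length u < perm_length (u \<circ> adj i)"
    using i step(1) by (simp add: perm_length_ascent S_infI)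
  then obtain P where "schub_rel N (u \<circ> adj i) P"
    using step i by (meson permutes_comp_adj)
  then show ?case using schub_rel_step' i by blast
qed

lemma schub_rel_unique:
  assumes "u permutes {1..N}" "schub_rel N u P" "schub_rel N u Q"
  shows "P = Q"
  using assms
proof (induction arbitrary: P Q rule: ascent_induct)
  case top
  have "R = schub_top N" if "schub_rel N (rev_perm N) R" for R
    using that
  proof cases
    case (step u P i)
    have "u i = rev_perm N (Suc i)" "u (Suc i) = rev_perm N i"
      by (simp_all add: step(1))
    then have "rev_perm N i < rev_perm N (Suc i)" using step(6) by simp
    then show ?thesis using step(4,5) by (simp add: rev_perm_def split: if_splits)
  qed simp
  with top show ?case by metis
next
  case (step u)
  have S: "u \<in> S_inf" using step(1) by (rule S_infI)
  have inv: "\<exists>i R'. 1 \<le> i \<and> i < N \<and> u i < u (Suc i) \<and> R = divdiff i R' \<and> schub_rel N (u \<circ> adj i) R'"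
    if "schub_rel N u R" for R
    using that
  proof cases
    case (step v P i)
    then show ?thesis by (intro exI[of _ i] exI[of _ P]) auto
  qed (use step in auto)
  have uniq: "R = R'" if "1 \<le> i" "i < N" "u i < u (Suc i)" "schub_rel N (u \<circ> adj i) R"
    "schub_rel N (u \<circ> adj i) R'" for i R R'
  proof -
    have "u \<circ> adj i permutes {1..N}" using step(1) that by (meson permutes_comp_adj)
    moreover have "perm_length u < perm_length (u \<circ> adj i)"
      using that S by (simp add: perm_length_ascent)
    ultimately show ?thesis using step.IH that by blast
  qed
  have main: "divdiff i R = divdiff j R'"
    if ij: "i < j" "1 \<le> i" "j < N" "u i < u (Suc i)" "u j < u (Suc j)"
      and R: "schub_rel N (u \<circ> adj i) R" "schub_rel N (u \<circ> adj j) R'" for i j R R'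
  proof (cases "j = Suc i")
    case False
    define v where "v = u \<circ> adj i \<circ> adj j"
    have v: "v = u \<circ> adj j \<circ> adj i"
      using ij False by (auto simp: v_def fun_eq_iff adj_def transpose_def)
    have "v permutes {1..N}" unfolding v_def
      using step(1) ij by (intro permutes_compose[OF adj_permutes] permutes_compose[OF _ step(1)] adj_permutes) auto
    then obtain T where T: "schub_rel N v T" using schub_rel_exists by blast
    have "schub_rel N (u \<circ> adj i) (divdiff j T)"
      using schub_rel_step'[of N "u \<circ> adj i" j T] T ij False by (simp add: v_def)
    then have "R = divdiff j T" using uniq R ij by auto
    moreover have "schub_rel N (u \<circ> adj j) (divdiff i T)"
      using schub_rel_step'[of N "u \<circ> adj j" i T] T ij False by (simp add: v)
    then have "R' = divdiff i T" using uniq[of j] R ij by auto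
    ultimately show ?thesis
      using ij False by (simp add: divdiff_conv_dd dd_commute)
  next
    case True
    define v where "v = u \<circ> adj i \<circ> adj j \<circ> adj i"
    have v: "v = u \<circ> adj j \<circ> adj i \<circ> adj j"
      using True by (auto simp: v_def fun_eq_iff adj_def transpose_def)
    have ai: "adj i permutes {1..N}" "adj j permutes {1..N}"
      using ij adj_permutes by auto
    have "v permutes {1..N}" unfolding v_def
      using step(1) ai by (meson permutes_compose)
    then obtain T where T: "schub_rel N v T" using schub_rel_exists by blast
    have "schub_rel N (u \<circ> adj i \<circ> adj j) (divdiff i T)"
      by (rule schub_rel_step') (use T ij True in \<open>auto simp: v_def\<close>)
    then have "schub_rel N (u \<circ> adj i) (divdiff j (divdiff i T))"
      by (rule schub_rel_step') (use ij True in auto)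
    then have "R = divdiff j (divdiff i T)" using uniq R ij by auto
    moreover have "schub_rel N (u \<circ> adj j \<circ> adj i) (divdiff j T)"
      by (rule schub_rel_step') (use T ij True in \<open>auto simp: v\<close>)
    then have "schub_rel N (u \<circ> adj j) (divdiff i (divdiff j T))"
      by (rule schub_rel_step') (use ij True in auto)
    then have "R' = divdiff i (divdiff j T)" using uniq[of j] R ij by auto
    ultimately show ?thesis
      using True dd_braid[of "X i" "X (Suc i)" "X (Suc (Suc i))"] by (simp add: divdiff_conv_dd)
  qed
  from inv[OF step(4)] obtain i R where i: "1 \<le> i" "i < N" "u i < u (Suc i)" "P = divdiff i R"
    "schub_rel N (u \<circ> adj i) R" by blast
  from inv[OF step(5)] obtain j R' where j: "1 \<le> j" "j < N" "u j < u (Suc j)" "Q = divdiff j R'"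
    "schub_rel N (u \<circ> adj j) R'" by blast
  consider "i < j" | "i = j" | "j < i" by linarith
  then show ?case
  proof cases
    case 1 then show ?thesis using main[of i j R R'] i j by simp
  next
    case 2 then show ?thesis using uniq i j by auto
  next
    case 3 then show ?thesis using main[of j i R' R] i j by simp
  qed
qed

lemma divdiff_eq_0: "schub_rel N u P \<Longrightarrow> 1 \<le> i \<Longrightarrow> i < N \<Longrightarrow> u i < u (Suc i) \<Longrightarrow> divdiff i P = 0"
proof -
  assume P: "schub_rel N u P" and i: "1 \<le> i" "i < N" "u i < u (Suc i)"
  have u: "u permutes {1..N}" using P by (rule schub_rel_permutes)
  then have "u \<circ> adj i permutes {1..N}" using i by (meson permutes_comp_adj)
  then obtain R where "schub_rel N (u \<circ> adj i) R" using schub_rel_exists by blast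
  then have "schub_rel N u (divdiff i R)" using i schub_rel_step' by blast
  then have "P = divdiff i R" using u P schub_rel_unique by blast
  then show "divdiff i P = 0" by (simp add: divdiff_conv_dd)
qed

section \<open>Codes and dominant permutations\<close>

lemma finite_code_set:
  assumes "u \<in> S_inf" shows "finite {j. i < j \<and> u j < u i}"
proof (cases "i = 0")
  case True then show ?thesis using S_inf_0[OF assms] by simp
next
  case False
  then have "(Pair i) ` {j. i < j \<and> u j < u i} \<subseteq> inversions u" by (auto simp: inversions_def)
  then show ?thesis
    using finite_inversions[OF assms] by (meson finite_imageD finite_subset inj_on_def prod.inject)
qed

lemma perm_code_ascent_le:
  assumes "u \<in> S_inf" "u i < u (Suc i)"
  shows "perm_code u i \<le> perm_code u (Suc i)"
  unfolding perm_code_def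
proof (rule card_mono)
  show "finite {j. Suc i < j \<and> u j < u (Suc i)}" using finite_code_set[OF assms(1)] .
  show "{j. i < j \<and> u j < u i} \<subseteq> {j. Suc i < j \<and> u j < u (Suc i)}"
    using assms(2) by (auto, metis Suc_lessI less_asym)
qed

lemma perm_code_descent_less:
  assumes "u \<in> S_inf" "u (Suc i) < u i"
  shows "perm_code u (Suc i) < perm_code u i"
  unfolding perm_code_def
proof (rule psubset_card_mono)
  show "finite {j. i < j \<and> u j < u i}" using finite_code_set[OF assms(1)] .
  show "{j. Suc i < j \<and> u j < u (Suc i)} \<subset> {j. i < j \<and> u j < u i}"
    using assms(2) by auto
qed

lemma perm_code_comp_adj:
  assumes "u \<in> S_inf" "1 \<le> i" "u i < u (Suc i)"
  shows "perm_code (u \<circ> adj i) i = Suc (perm_code u (Suc i))"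
    and "perm_code (u \<circ> adj i) (Suc i) = perm_code u i"
    and "j \<noteq> i \<Longrightarrow> j \<noteq> Suc i \<Longrightarrow> perm_code (u \<circ> adj i) j = perm_code u j"
proof -
  have "{j. i < j \<and> (u \<circ> adj i) j < (u \<circ> adj i) i} = insert (Suc i) {j. Suc i < j \<and> u j < u (Suc i)}"
    using assms(3) by (auto simp: adj_def transpose_def split: if_splits)
  then show "perm_code (u \<circ> adj i) i = Suc (perm_code u (Suc i))"
    using finite_code_set[OF assms(1)] by (simp add: perm_code_def)
  have "{j. Suc i < j \<and> (u \<circ> adj i) j < (u \<circ> adj i) (Suc i)} = {j. i < j \<and> u j < u i}"
    using assms(3) by (auto simp: adj_def transpose_def split: if_splits)
  then show "perm_code (u \<circ> adj i) (Suc i) = perm_code u i"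
    by (simp add: perm_code_def)
  assume j: "j \<noteq> i" "j \<noteq> Suc i"
  have less: "j < adj i l \<longleftrightarrow> j < l" for l
    using j by (auto simp: adj_def transpose_def)
  have "{l. j < l \<and> (u \<circ> adj i) l < (u \<circ> adj i) j} = adj i ` {l. j < l \<and> u l < u j}"
  proof (intro equalityI subsetI)
    fix l assume "l \<in> {l. j < l \<and> (u \<circ> adj i) l < (u \<circ> adj i) j}"
    then have "adj i l \<in> {l. j < l \<and> u l < u j}" using j less by auto
    then have "adj i (adj i l) \<in> adj i ` {l. j < l \<and> u l < u j}" by blast
    then show "l \<in> adj i ` {l. j < l \<and> u l < u j}" by simp
  next
    fix l assume "l \<in> adj i ` {l. j < l \<and> u l < u j}"
    then obtain m where "l = adj i m" "j < m" "u m < u j" by blast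
    then show "l \<in> {l. j < l \<and> (u \<circ> adj i) l < (u \<circ> adj i) j}"
      using j less[of m] by simp
  qed
  moreover have "inj_on (adj i) A" for A by (metis adj_adj(1) inj_onI)
  ultimately show "perm_code (u \<circ> adj i) j = perm_code u j"
    by (simp add: perm_code_def card_image)
qed

lemma perm_code_rev_perm: "1 \<le> i \<Longrightarrow> perm_code (rev_perm N) i = N - i"
proof -
  assume "1 \<le> i"
  then have "{j. i < j \<and> rev_perm N j < rev_perm N i} = {i<..N}"
    by (auto simp: rev_perm_def split: if_splits)
  then show ?thesis by (simp add: perm_code_def)
qed

lemma dominant_rev_perm: "dominant (rev_perm N)"
  by (auto simp: dominant_def perm_code_rev_perm)

definition diagram_prod :: "nat \<Rightarrow> (nat \<Rightarrow> nat) \<Rightarrow> mpoly" where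
  "diagram_prod N c = (\<Prod>i\<in>{1..N}. \<Prod>j\<in>{1..c i}. Var (X i) - Var (Y j))"

text \<open>
  When rows \<open>i\<close> and \<open>i + 1\<close> have the same length, adding a box to row \<open>i\<close> multiplies the product
  by a linear factor whose divided difference is 1, and the product itself is symmetric.
\<close>

lemma swap_diagram_prod:
  assumes "1 \<le> i" "i < N" "c i = c (Suc i)"
  shows "swap (X i) (X (Suc i)) (diagram_prod N c) = diagram_prod N c"
proof -
  have t: "transpose (X i) (X (Suc i)) (X k) = X (adj i k)" for k
    by (auto simp: adj_def transpose_def)
  have c: "c (adj i k) = c k" for k
    using assms(3) by (auto simp: adj_def transpose_def)
  have "swap (X i) (X (Suc i)) (diagram_prod N c)
      = (\<Prod>k\<in>{1..N}. \<Prod>j\<in>{1..c (adj i k)}. Var (X (adj i k)) - Var (Y j))"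
    by (simp add: diagram_prod_def t c)
  also have "\<dots> = diagram_prod N c"
    unfolding diagram_prod_def
    using assms by (intro prod.reindex_bij_betw[where h = "adj i"] permutes_imp_bij adj_permutes)
  finally show ?thesis .
qed

lemma divdiff_diagram_prod:
  assumes "1 \<le> i" "i < N" "c i = c (Suc i)"
  shows "divdiff i (diagram_prod N (c(i := Suc (c i)))) = diagram_prod N c"
proof -
  have "diagram_prod N (c(i := Suc (c i))) = (Var (X i) - Var (Y (Suc (c i)))) * diagram_prod N c"
  proof -
    have i: "i \<in> {1..N}" "finite {1..N}" using assms by auto
    show ?thesis
      unfolding diagram_prod_def prod.remove[OF i(2,1)]
      by (simp add: mult.commute mult.left_commute)
  qed
  then show ?thesis
    using swap_diagram_prod[OF assms] by (simp add: divdiff_conv_dd dd_linear_mult_sym)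
qed

lemma schub_top_conv: "schub_top N = diagram_prod N (\<lambda>i. N - i)"
  by (simp add: schub_top_def diagram_prod_def)

lemma diagram_prod_cong: "(\<And>i. 1 \<le> i \<Longrightarrow> i \<le> N \<Longrightarrow> c i = d i) \<Longrightarrow> diagram_prod N c = diagram_prod N d"
  by (simp add: diagram_prod_def)

lemma schub_rel_dominant:
  "u permutes {1..N} \<Longrightarrow> dominant u \<Longrightarrow> schub_rel N u (diagram_prod N (perm_code u))"
proof (induction rule: ascent_induct)
  case top
  have "schub_top N = diagram_prod N (perm_code (rev_perm N))"
    unfolding schub_top_conv by (rule diagram_prod_cong) (simp add: perm_code_rev_perm)
  then show ?case using schub_rel.top by metis
next
  case (step u)
  have S: "u \<in> S_inf" using step(1) by (rule S_infI)
  define i where "i = (LEAST i. 1 \<le> i \<and> i < N \<and> u i < u (Suc i))"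
  have i: "1 \<le> i" "i < N" "u i < u (Suc i)"
    using LeastI_ex[of "\<lambda>i. 1 \<le> i \<and> i < N \<and> u i < u (Suc i)"] ex_ascent[OF \<open>u permutes _\<close> \<open>u \<noteq> _\<close>]
    unfolding i_def by blast+
  have before: "u (Suc j) < u j" if "1 \<le> j" "j < i" for j
    using not_less_Least[of j "\<lambda>i. 1 \<le> i \<and> i < N \<and> u i < u (Suc i)"] that i
      S_inf_eq_iff[OF S, of j "Suc j"] unfolding i_def[symmetric]
    by (meson less_trans linorder_neqE_nat n_not_Suc_n)
  let ?v = "u \<circ> adj i"
  have eq: "perm_code u i = perm_code u (Suc i)"
    using step(4) perm_code_ascent_le[OF S i(3)] i(1) by (simp add: dominant_def le_antisym)
  have code: "perm_code ?v = (perm_code u)(i := Suc (perm_code u i))"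
    using perm_code_comp_adj[OF S i(1,3)] eq by (auto simp: fun_eq_iff)
  have "dominant ?v"
    unfolding dominant_def
  proof (intro allI impI)
    fix j :: nat assume "1 \<le> j"
    show "perm_code ?v (Suc j) \<le> perm_code ?v j"
    proof (cases "Suc j = i")
      case True
      then have "perm_code u i < perm_code u j"
        using before[of j] \<open>1 \<le> j\<close> perm_code_descent_less[OF S] by blast
      then show ?thesis using True by (auto simp: code)
    next
      case False
      then show ?thesis using step(4) \<open>1 \<le> j\<close> by (auto simp: code dominant_def intro: le_SucI)
    qed
  qed
  moreover have "?v permutes {1..N}" using step(1) i by (meson permutes_comp_adj)
  moreover have "perm_length u < perm_length ?v" using i S by (simp add: perm_length_ascent)
  ultimately have "schub_rel N ?v (diagram_prod N (perm_code ?v))" by (intro step.IH)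
  then have "schub_rel N u (divdiff i (diagram_prod N (perm_code ?v)))"
    using i schub_rel_step' by blast
  then show ?case
    unfolding code using divdiff_diagram_prod[of i N "perm_code u"] i eq by simp
qed

lemma schub_rel_Suc: "schub_rel N u P \<Longrightarrow> schub_rel (Suc N) u P"
proof (induction rule: schub_rel.induct)
  case top
  have "rev_perm N permutes {1..Suc N}"
    using rev_perm_permutes by (rule permutes_atLeastAtMost_mono) simp
  then have "schub_rel (Suc N) (rev_perm N) (diagram_prod (Suc N) (perm_code (rev_perm N)))"
    using dominant_rev_perm by (rule schub_rel_dominant)
  moreover have "diagram_prod (Suc N) (perm_code (rev_perm N)) = schub_top N"
    unfolding schub_top_def diagram_prod_def
    by (auto simp: prod.nat_ivl_Suc' perm_code_rev_perm)
  ultimately show ?case by simp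
next
  case (step u P i)
  then show ?case by (intro schub_rel.step) simp_all
qed

lemma schub_rel_mono: "N \<le> M \<Longrightarrow> schub_rel N u P \<Longrightarrow> schub_rel M u P"
  by (induction M rule: dec_induct) (auto intro: schub_rel_Suc)

definition schub :: "(nat \<Rightarrow> nat) \<Rightarrow> mpoly" where
  "schub u = (THE P. \<exists>N. schub_rel N u P)"

lemma schub_eq:
  assumes "schub_rel N u P" shows "schub u = P"
  unfolding schub_def
proof (rule the_equality)
  fix Q assume "\<exists>M. schub_rel M u Q"
  then obtain M where M: "schub_rel M u Q" by blast
  have "schub_rel (max M N) u Q" "schub_rel (max M N) u P"
    using M assms by (auto intro: schub_rel_mono[rotated])
  then show "Q = P" using schub_rel_unique schub_rel_permutes by blast
qed (use assms in blast)

lemma schub_rel_schub: "u permutes {1..N} \<Longrightarrow> schub_rel N u (schub u)"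
  using schub_rel_exists schub_eq by metis

lemma schub_rev_perm: "schub (rev_perm N) = schub_top N"
  using schub_eq schub_rel.top by blast

lemma schub_dominant: "u permutes {1..N} \<Longrightarrow> dominant u \<Longrightarrow> schub u = diagram_prod N (perm_code u)"
  using schub_rel_dominant schub_eq by blast

lemma divdiff_schub:
  assumes "u \<in> S_inf" "1 \<le> i"
  shows "divdiff i (schub u) = (if u (Suc i) < u i then schub (u \<circ> adj i) else 0)"
proof -
  obtain N where N: "u permutes {1..N}" "Suc i \<le> N" using S_inf_permutes[OF assms(1)] .
  have r: "schub_rel N u (schub u)" using N schub_rel_schub by blast
  show ?thesis
  proof (cases "u (Suc i) < u i")
    case True
    then have "schub_rel N (u \<circ> adj i) (divdiff i (schub u))"
      using r N assms by (intro schub_rel.step) auto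
    then show ?thesis using True schub_eq by metis
  next
    case False
    then have "u i < u (Suc i)"
      using S_inf_eq_iff[OF assms(1), of i "Suc i"] by force
    then show ?thesis using divdiff_eq_0[OF r] N assms False by simp
  qed
qed

lemma divdiff_0 [simp]: "divdiff i 0 = 0"
  by (simp add: divdiff_conv_dd)

lemma foldr_divdiff_schub:
  assumes "w \<in> S_inf" "\<forall>i\<in>set is. 1 \<le> i"
  shows "foldr divdiff is (schub w)
    = (if perm_length (w \<circ> inv (word_prod is)) + length is = perm_length w
       then schub (w \<circ> inv (word_prod is)) else 0)"
  using assms(2)
proof (induction "is")
  case Nil
  then show ?case by simp
next
  case (Cons i "is")
  define v where "v = w \<circ> inv (word_prod is)"
  have p: "word_prod is \<in> S_inf" using Cons.prems by (intro word_prod_S_inf) auto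
  have v: "v \<in> S_inf" unfolding v_def using assms(1) p by (intro S_inf_comp S_inf_inv)
  have i: "1 \<le> i" using Cons.prems by simp
  have adj_inv: "inv (adj i) = adj i"
    by (rule inv_unique_comp) simp_all
  have "inv (adj i \<circ> word_prod is) = inv (word_prod is) \<circ> inv (adj i)"
    using p S_inf_bij S_inf_adj[OF i] by (intro o_inv_distrib) auto
  then have v': "w \<circ> inv (word_prod (i # is)) = v \<circ> adj i"
    by (simp add: v_def adj_inv comp_assoc)
  have "v \<circ> word_prod is = w"
    using p by (simp add: v_def comp_assoc S_inf_inj)
  then have le: "perm_length w \<le> perm_length v + length is"
    using perm_length_comp_word_prod_le[OF v, of "is"] Cons.prems by auto
  have IH: "foldr divdiff is (schub w) = (if perm_length v + length is = perm_length w then schub v else 0)"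
    unfolding v_def using Cons.prems by (intro Cons.IH) simp
  consider "v (Suc i) < v i" | "v i < v (Suc i)"
    using S_inf_eq_iff[OF v, of i "Suc i"] by force
  then have "divdiff i (if perm_length v + length is = perm_length w then schub v else 0)
    = (if perm_length (v \<circ> adj i) + Suc (length is) = perm_length w then schub (v \<circ> adj i) else 0)"
  proof cases
    case 1
    then have "perm_length v = Suc (perm_length (v \<circ> adj i))" using perm_length_descent v i by blast
    then show ?thesis using 1 divdiff_schub[OF v i] by simp
  next
    case 2
    then have "perm_length (v \<circ> adj i) = Suc (perm_length v)" using perm_length_ascent v i by blast
    then show ?thesis using 2 le divdiff_schub[OF v i] by simp
  qed
  then show "foldr divdiff (i # is) (schub w)
    = (if perm_length (w \<circ> inv (word_prod (i # is))) + length (i # is) = perm_length w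
       then schub (w \<circ> inv (word_prod (i # is))) else 0)"
    by (simp only: v' foldr.simps o_apply IH list.size add_0_right add_Suc_right)
qed

lemma ascending_word:
  assumes "u permutes {1..N}"
  shows "\<exists>is. (\<forall>i\<in>set is. 1 \<le> i) \<and> u \<circ> word_prod is = rev_perm N
    \<and> perm_length u + length is = perm_length (rev_perm N)"
  using assms
proof (induction rule: ascent_induct)
  case top
  show ?case by (intro exI[of _ "[]"]) simp
next
  case (step u)
  then obtain i where i: "1 \<le> i" "i < N" "u i < u (Suc i)" using ex_ascent by blast
  have l: "perm_length (u \<circ> adj i) = Suc (perm_length u)"
    using i step(1) by (simp add: perm_length_ascent S_infI)
  then obtain js where "\<forall>i\<in>set js. 1 \<le> i" "u \<circ> adj i \<circ> word_prod js = rev_perm N"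
    "perm_length (u \<circ> adj i) + length js = perm_length (rev_perm N)"
    using step i by (metis lessI permutes_comp_adj)
  then have "(\<forall>i\<in>set (i # js). 1 \<le> i) \<and> u \<circ> word_prod (i # js) = rev_perm N
    \<and> perm_length u + length (i # js) = perm_length (rev_perm N)"
    using i l by (simp add: comp_assoc)
  then show ?case by blast
qed

lemma schubert_xy_eq_schub:
  assumes "u \<in> S_inf" shows "schubert_xy u = schub u"
proof -
  define n where "n = (LEAST n. u permutes {1..n + 1})"
  obtain N where "u permutes {1..N}" "1 \<le> N" using S_inf_permutes[OF assms] .
  then have "\<exists>n. u permutes {1..n + 1}" by (intro exI[of _ "N - 1"]) simp
  then have n: "u permutes {1..Suc n}" unfolding n_def by (metis (mono_tags, lifting) LeastI_ex Suc_eq_plus1)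
  let ?w = "rev_perm (Suc n)"
  define x where "x = inv u \<circ> ?w"
  have w: "?w \<in> S_inf" using rev_perm_permutes by (rule S_infI)
  have x: "x \<in> S_inf" using assms w by (auto simp: x_def intro: S_inf_comp S_inf_inv)
  have ux: "u \<circ> x = ?w"
    using surj_iff[THEN iffD1, OF bij_is_surj[OF S_inf_bij[OF assms]]]
    by (simp add: x_def comp_assoc[symmetric])
  obtain ws where ws: "reduced_word x ws" "ws = (SOME is. reduced_word x is)"
    using reduced_word_exists[OF x] someI_ex by metis
  obtain js where js: "\<forall>i\<in>set js. 1 \<le> i" "u \<circ> word_prod js = ?w"
    "perm_length u + length js = perm_length ?w" using ascending_word[OF n] by blast
  have "word_prod js = x"
    by (metis js(2) x_def comp_assoc id_comp S_inf_inj[OF assms] inv_o_cancel)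
  then have "perm_length x \<le> length js"
    using perm_length_comp_word_prod_le[OF S_inf_id js(1)] by simp
  then have "perm_length u + perm_length x = perm_length ?w"
    using js(3) perm_length_comp_le[OF assms x] ux by simp
  moreover have "?w \<circ> inv x = u"
    using ux surj_iff[THEN iffD1, OF bij_is_surj[OF S_inf_bij[OF x]]] by (metis comp_assoc comp_id)
  ultimately have "foldr divdiff ws (schub ?w) = schub u"
    using ws(1) foldr_divdiff_schub[OF w, of ws] by (auto simp: reduced_word_def)
  then show ?thesis
    unfolding schubert_xy_def Let_def n_def[symmetric] w0_conv_rev_perm divdiff_perm_def
      schubert_w0_conv schub_rev_perm x_def[symmetric] ws(2)[symmetric] by simp
qed

section \<open>A noncrossing description of the Pieri relation\<close>

text \<open>
  The chain condition defining \<open>u \<rightarrow>\<^sub>k w\<close> is equivalent to conditions on pairs of positions: the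
  intervals between \<open>u c\<close> and \<open>w c\<close> do not cross, and nested intervals are ordered by position.
  Hence a chain from \<open>u\<close> to \<open>w\<close> may start with any unfinished \<open>a \<le> k\<close> whose final value \<open>w a\<close> is
  at a position above \<open>k\<close> in \<open>u\<close>.
\<close>

locale noncrossing =
  fixes k :: nat and u w :: "nat \<Rightarrow> nat"
  assumes u: "u \<in> S_inf" and w: "w \<in> S_inf"
    and up: "a \<le> k \<Longrightarrow> u a \<le> w a"
    and down: "k < b \<Longrightarrow> w b \<le> u b"
    and low: "a \<le> k \<Longrightarrow> c \<le> k \<Longrightarrow> u a < u c \<and> u c < w a \<or> u a < w c \<and> w c < w a \<Longrightarrow>
      u a < u c \<and> u c < w a \<and> u a < w c \<and> w c < w a \<and> c < a"
    and mixed: "a \<le> k \<Longrightarrow> k < b \<Longrightarrow> u a < u b \<and> u b < w a \<longleftrightarrow> u a < w b \<and> w b < w a"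
    and high: "k < b \<Longrightarrow> k < c \<Longrightarrow> w b < u c \<and> u c < u b \<or> w b < w c \<and> w c < u b \<Longrightarrow>
      w b < u c \<and> u c < u b \<and> w b < w c \<and> w c < u b \<and> b < c"
    and no_drop: "k < b \<Longrightarrow> k < c \<Longrightarrow> w b = u c \<Longrightarrow> b = c"
begin

lemma u_eq: "u i = u j \<longleftrightarrow> i = j" and w_eq: "w i = w j \<longleftrightarrow> i = j"
  using u w S_inf_eq_iff by auto

lemma first_step:
  assumes a: "a \<le> k" and b: "k < b" and wa: "w a = u b" and ne: "u a \<noteq> w a"
  shows "covers u a b" "noncrossing k (u \<circ> transpose a b) w"
proof -
  have a1: "1 \<le> a" using ne S_inf_0[OF u] S_inf_0[OF w] by (cases "a = 0") auto
  have ab: "a < b" using a b by simp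
  have lt: "u a < u b" using up[OF a] wa ne by simp
  have wb: "w b \<le> u a" using mixed[OF a b] down[OF b] wa w_eq[of a b] ab by auto
  show "covers u a b"
    unfolding covers_def
  proof (intro conjI allI impI notI)
    fix c assume c: "a < c \<and> c < b" "u a < u c \<and> u c < u b"
    show False
    proof (cases "c \<le> k")
      case True then show False using low[OF a, of c] c wa by auto
    next
      case False then show False using high[OF b, of c] c wb by auto
    qed
  qed (fact lt)
  define u1 where "u1 = u \<circ> transpose a b"
  have u1: "u1 a = u b" "u1 b = u a" and u1': "\<And>c. c \<noteq> a \<Longrightarrow> c \<noteq> b \<Longrightarrow> u1 c = u c"
    by (simp_all add: u1_def)
  show "noncrossing k u1 w"
  proof
    show "u1 \<in> S_inf" unfolding u1_def using u a1 ab by (intro S_inf_comp S_inf_transpose) auto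
    show "w \<in> S_inf" by (rule w)
  next
    fix c assume "c \<le> k" then show "u1 c \<le> w c"
      using up[of c] wa u1 u1'[of c] b by (cases "c = a") auto
  next
    fix c assume "k < c" then show "w c \<le> u1 c"
      using down[of c] wb u1 u1'[of c] a by (cases "c = b") auto
  next
    fix x c assume xc: "x \<le> k" "c \<le> k"
      "u1 x < u1 c \<and> u1 c < w x \<or> u1 x < w c \<and> w c < w x"
    have "x \<noteq> a" using xc(3) wa u1 by auto
    then show "u1 x < u1 c \<and> u1 c < w x \<and> u1 x < w c \<and> w c < w x \<and> c < x"
      using xc low[of x c] wa u1 u1'[of x] u1'[of c] b by (cases "c = a") auto
  next
    fix x c assume xc: "x \<le> k" "k < c"
    have x: "x \<noteq> b" and c: "c \<noteq> a" using xc a b by auto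
    show "u1 x < u1 c \<and> u1 c < w x \<longleftrightarrow> u1 x < w c \<and> w c < w x"
    proof (cases "x = a")
      case True then show ?thesis using wa u1 by auto
    next
      case False
      then have ux: "u1 x = u x" using x u1' by simp
      show ?thesis
      proof (cases "c = b")
        case True
        have "(u x < u a \<and> u a < w x) = (u x < w a \<and> w a < w x)"
          using low[OF xc(1) a] by blast
        then show ?thesis using mixed[OF xc] True wa ux u1 by simp
      next
        case False
        then show ?thesis using mixed[OF xc] ux u1'[OF c] by simp
      qed
    qed
  next
    fix x c assume xc: "k < x" "k < c"
      "w x < u1 c \<and> u1 c < u1 x \<or> w x < w c \<and> w c < u1 x"
    have ne: "x \<noteq> a" "c \<noteq> a" using xc a by auto
    have *: "x \<noteq> c" using xc(3) by auto
    show "w x < u1 c \<and> u1 c < u1 x \<and> w x < w c \<and> w c < u1 x \<and> x < c"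
    proof (cases "x = b")
      case True
      then have uc: "u1 c = u c" using * ne u1' by simp
      have h: "w b < u c \<and> u c < u b \<and> w b < w c \<and> w c < u b \<and> b < c"
        using high[OF b xc(2)] xc(3) True uc u1 lt by auto
      have "u c < u a"
      proof (rule ccontr)
        assume "\<not> u c < u a"
        then have "u a < u c" using u_eq[of a c] ne by simp
        then show False using mixed[OF a xc(2)] h wa xc(3) True uc u1 by auto
      qed
      then show ?thesis using h True uc u1 down[OF xc(2)] by auto
    next
      case False
      then have ux: "u1 x = u x" using ne u1' by simp
      show ?thesis
      proof (cases "c = b")
        case True
        have "\<not> (u a < u x \<and> u x < u b)" if "w x < u a"
          using mixed[OF a xc(1)] that wa by auto
        moreover have "u x \<noteq> u b" using u_eq False by simp
        ultimately have "w x < u b \<and> u b < u x \<or> w x < w b \<and> w b < u x"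
          using xc(3) True ux u1 lt by auto
        then have "w x < u b \<and> u b < u x \<and> w x < w b \<and> w b < u x \<and> x < b"
          by (rule high[OF xc(1) b])
        then show ?thesis using True ux u1 lt wb by auto
      next
        case False
        then show ?thesis using high[OF xc(1,2)] xc(3) ux u1'[OF ne(2)] by simp
      qed
    qed
  next
    fix p q assume pq: "k < p" "k < q" "w p = u1 q"
    show "p = q"
    proof (cases "q = b")
      case True
      show ?thesis
      proof (rule ccontr)
        assume "p \<noteq> q"
        then have ne: "u p \<noteq> u b" "u p \<noteq> u a" using True u_eq pq(1) a by auto
        have wp: "w p = u a" using True pq(3) u1 by simp
        then have "u a < u p" using down[OF pq(1)] ne by simp
        then have "u b < u p" using mixed[OF a pq(1)] wp wa ne by auto
        then show False using high[OF pq(1) b] wp lt wb by auto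
      qed
    next
      case False
      then show ?thesis using no_drop[OF pq(1,2)] pq(3) u1'[of q] a pq by auto
    qed
  qed
qed

lemma ex_first:
  assumes "u \<noteq> w"
  obtains a b where "a \<le> k" "k < b" "w a = u b" "u a \<noteq> w a"
proof -
  obtain N where N: "u permutes {1..N}" using S_inf_permutes[OF u] .
  obtain M where M: "w permutes {1..M}" "N \<le> M" using S_inf_permutes[OF w] .
  have moved: "c \<le> M" if "u c \<noteq> w c" for c
    using that permutes_not_in[OF M(1), of c]
      permutes_not_in[OF permutes_atLeastAtMost_mono[OF N M(2)], of c] by force
  have surj_u: "\<exists>c. u c = y" for y using S_inf_bij[OF u] by (metis bij_pointE)
  show thesis
  proof (cases "\<exists>a\<le>k. u a \<noteq> w a")
    case True
    define a where "a = arg_max w (\<lambda>a. a \<le> k \<and> u a \<noteq> w a)"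
    obtain a0 where a0: "a0 \<le> k \<and> u a0 \<noteq> w a0" using True by blast
    have a: "a \<le> k \<and> u a \<noteq> w a" and max: "\<And>c. c \<le> k \<and> u c \<noteq> w c \<Longrightarrow> w c \<le> w a"
    proof -
      have "\<forall>y. y \<le> k \<and> u y \<noteq> w y \<longrightarrow> w y < Suc M"
        using moved permutes_le_iff[OF M(1)] by (auto simp: less_Suc_eq_le)
      then show "a \<le> k \<and> u a \<noteq> w a" "\<And>c. c \<le> k \<and> u c \<noteq> w c \<Longrightarrow> w c \<le> w a"
        unfolding a_def using arg_max_nat_lemma[of "\<lambda>a. a \<le> k \<and> u a \<noteq> w a" a0 w "Suc M"] a0 by auto
    qed
    obtain b where b: "u b = w a" using surj_u by blast
    have "k < b"
    proof (rule ccontr)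
      assume "\<not> k < b"
      then have "u b \<noteq> w b" using b a w_eq by auto
      then show False using max[of b] up[of b] b \<open>\<not> k < b\<close> by auto
    qed
    then show thesis using that a b by metis
  next
    case False
    then have "\<exists>b. k < b \<and> u b \<noteq> w b" using assms by (metis ext not_le)
    then obtain b where b: "k < b" "u b \<noteq> w b" and min: "\<And>c. k < c \<Longrightarrow> u c \<noteq> w c \<Longrightarrow> u b \<le> u c"
      using ex_has_least_nat[of "\<lambda>b. k < b \<and> u b \<noteq> w b" _ u] by blast
    obtain c where c: "u c = w b" using surj_u by blast
    have "c \<noteq> b" using c b by auto
    then have "u c \<noteq> w c" using c w_eq by metis
    then show thesis using False min[of c] down[OF b(1)] c b by (metis not_le le_antisym)
  qed
qed

text \<open>
  Following the values upwards from \<open>w c\<close> through positions at most \<open>k\<close>, one either jumps over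
  \<open>M\<close> or ends at a position above \<open>k\<close>, whose interval then covers everything passed on the way.
\<close>

lemma ascend:
  assumes "c \<le> k" "u c < w c" "w c < M"
  shows "(\<exists>p>k. w c \<le> u p \<and> u p < M \<and> w p \<le> u c) \<or>
    (\<exists>c'\<le>k. w c \<le> u c' \<and> u c' < M \<and> M \<le> w c')"
  using assms
proof (induction "M - w c" arbitrary: c rule: less_induct)
  case less
  have surj_u: "\<exists>c. u c = y" for y using S_inf_bij[OF u] by (metis bij_pointE)
  obtain p where p: "u p = w c" using surj_u by blast
  show ?case
  proof (cases "k < p")
    case True
    then have "w p \<le> u c"
      using mixed[OF less.prems(1) True] down[OF True] p w_eq[of p c] less.prems(1) by auto
    then show ?thesis using True p less.prems by auto
  next
    case False
    then have pk: "p \<le> k" by simp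
    have "p \<noteq> c" using p less.prems by auto
    then have "u p \<noteq> w p" using p w_eq by metis
    then have up': "u p < w p" using up[OF pk] by simp
    show ?thesis
    proof (cases "w p < M")
      case False
      then show ?thesis using pk p less.prems by auto
    next
      case True
      from less.hyps[of p] True pk up' p less.prems
      consider q where "q > k" "w p \<le> u q" "u q < M" "w q \<le> u p"
        | c' where "c' \<le> k" "w p \<le> u c'" "u c' < M" "M \<le> w c'"
        by (metis diff_less_mono2)
      then show ?thesis
      proof cases
        case 1
        have "w q \<noteq> w c" using 1 less.prems w_eq by auto
        then have "w q \<le> u c"
          using 1 p up' mixed[OF less.prems(1) 1(1)] by auto
        then show ?thesis using 1 p up' by (intro disjI1 exI[of _ q]) auto
      next
        case 2
        then show ?thesis using p up' by (intro disjI2 exI[of _ c']) auto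
      qed
    qed
  qed
qed

lemma descend_step:
  assumes "c \<le> k" "u c < w c" "k < b" "w b \<le> u c" "w c \<le> u b" "w b \<le> M" "M < w c"
    and "\<And>p. k < p \<Longrightarrow> u p < u b \<Longrightarrow> w c \<le> u p \<Longrightarrow> w c \<le> w p"
  shows "\<exists>c'\<le>k. w b \<le> u c' \<and> u c' \<le> M \<and> M < w c'"
  using assms
proof (induction "u c" arbitrary: c rule: less_induct)
  case less
  show ?case
  proof (cases "u c \<le> M")
    case True
    then show ?thesis using less.prems by blast
  next
    case False
    obtain p where p: "w p = u c" using S_inf_bij[OF w] by (metis bij_pointE)
    have pc: "p \<noteq> c" using p less.prems by auto
    have pk: "p \<le> k"
    proof (rule ccontr)
      assume "\<not> p \<le> k"
      then have kp: "k < p" by simp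
      have "p \<noteq> b" using p False less.prems by auto
      then have upb: "u p < u b"
        using high[OF less.prems(3) kp] p False less.prems less.hyps by auto
      have "u c < u p" using pc u_eq[of p c] down[OF kp] p by auto
      then show False
        using mixed[OF less.prems(1) kp] less.prems(8)[OF kp upb] less.prems(2) p by (cases "w c \<le> u p") auto
    qed
    have "u p \<noteq> w p" using p pc u_eq by metis
    then have up': "u p < w p" using up[OF pk] by simp
    have "w b \<le> u p"
    proof (rule ccontr)
      assume "\<not> w b \<le> u p"
      then show False using mixed[OF pk less.prems(3)] p up' less.prems False w_eq[of p b] pk by auto
    qed
    moreover have "w p \<le> w q" if q: "k < q" "u q < u b" "w p \<le> u q" for q
    proof (cases "w c \<le> u q")
      case True
      then show ?thesis using less.prems(8)[OF q(1,2)] less.prems(2) p by simp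
    next
      case False
      moreover have "u c \<noteq> u q" using u_eq less.prems(1) q(1) by auto
      ultimately show ?thesis using mixed[OF less.prems(1) q(1)] q p by auto
    qed
    ultimately show ?thesis
      using less.hyps[of p] p up' pk less.prems(2-6) False by simp
  qed
qed

lemma descend:
  assumes "k < b" "w b \<le> M" "M < u b"
  shows "\<exists>c\<le>k. w b \<le> u c \<and> u c \<le> M \<and> M < w c"
proof -
  obtain p where p: "w p = u b" using S_inf_bij[OF w] by (metis bij_pointE)
  have "p \<noteq> b" using p assms by auto
  then have pk: "p \<le> k" using no_drop[of p b] p assms by force
  have "u p \<noteq> w p" using \<open>p \<noteq> b\<close> p u_eq by metis
  then have lt: "u p < w p" using up[OF pk] by simp
  have "w b \<le> u p" using mixed[OF pk assms(1)] p lt assms by auto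
  then show ?thesis using descend_step[of p b M] pk lt assms p by simp
qed

end

lemma noncrossing_refl: "u \<in> S_inf \<Longrightarrow> noncrossing k u u"
  by unfold_locales (auto dest: S_inf_eq_iff)

lemma noncrossing_prepend:
  assumes u: "u \<in> S_inf" and a: "a \<le> k" "1 \<le> a" and b: "k < b" and wa: "w a = u b" and cov: "covers u a b"
    and nc: "noncrossing k (u \<circ> transpose a b) w"
  shows "noncrossing k u w"
proof -
  define u1 where "u1 = u \<circ> transpose a b"
  have u1: "u1 a = u b" "u1 b = u a" and u1': "\<And>c. c \<noteq> a \<Longrightarrow> c \<noteq> b \<Longrightarrow> u1 c = u c"
    by (simp_all add: u1_def)
  interpret n1: noncrossing k u1 w using nc by (simp only: u1_def)
  have ab: "a < b" "a \<noteq> b" using a b by auto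
  have lt: "u a < u b" and gap: "\<And>c. a < c \<Longrightarrow> c < b \<Longrightarrow> u a < u c \<Longrightarrow> u c < u b \<Longrightarrow> False"
    using cov by (auto simp: covers_def)
  have ueq: "u i = u j \<longleftrightarrow> i = j" for i j using u S_inf_eq_iff by blast
  have wb: "w b \<le> u a" using n1.down[OF b] u1 by simp
  have crossing: False if c: "c \<le> k" "u c < u a" "u a < w c" "w c < w a" for c
  proof -
    have ca: "c \<noteq> a" "c \<noteq> b" using c b by auto
    have wbc: "u c < w b" using n1.mixed[OF c(1) b] u1 u1'[OF ca] c wa by auto
    from n1.ascend[of c "w a"] c u1'[OF ca]
    consider p where "p > k" "w c \<le> u1 p" "u1 p < w a" "w p \<le> u c"
      | c' where "c' \<le> k" "w c \<le> u1 c'" "u1 c' < w a" "w a \<le> w c'" by auto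
    then show False
    proof cases
      case 1
      then have "p \<noteq> b" "p \<noteq> a" using u1 c a by auto
      then have "b < p" using gap[of p] 1 c wa u1'[of p] a ab by force
      then show False using n1.high[OF 1(1) b] 1 u1 wbc c by auto
    next
      case 2
      then have ne: "c' \<noteq> a" "c' \<noteq> b" using u1 wa b by auto
      then have "w c' \<noteq> w a" using n1.w_eq by simp
      then have "a < c'" using n1.low[OF 2(1) a(1)] 2 u1 wa by auto
      then show False using gap[of c'] 2 c ne u1'[of c'] wa b by auto
    qed
  qed
  have mixed_a: "u a < u c \<and> u c < w a \<longleftrightarrow> u a < w c \<and> w c < w a" if c: "k < c" for c
  proof (cases "c = b")
    case True
    then show ?thesis using wa wb by auto
  next
    case False
    have ca: "c \<noteq> a" using c a by auto
    show ?thesis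
    proof
      assume in_u: "u a < u c \<and> u c < w a"
      then have bc: "b < c" using gap[of c] wa a c False by force
      have "\<not> w c \<le> u a"
      proof
        assume "w c \<le> u a"
        moreover have "w c \<noteq> u a" using n1.no_drop[OF c b] u1 False by auto
        ultimately show False using n1.high[OF c b] u1 u1'[OF ca False] in_u bc by auto
      qed
      then show "u a < w c \<and> w c < w a" using n1.down[OF c] u1'[OF ca False] in_u by auto
    next
      assume in_w: "u a < w c \<and> w c < w a"
      have "\<not> w a < u c"
      proof
        assume "w a < u c"
        then obtain d where d: "d \<le> k" "w c \<le> u1 d" "u1 d \<le> w a" "w a < w d"
          using n1.descend[OF c, of "w a"] in_w u1'[OF ca False] by auto
        then have ne: "d \<noteq> a" "d \<noteq> b" using b by auto
        then have "u1 d < w a" using d u1'[OF ne] ueq[of d b] wa by auto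
        then have "a < d" using n1.low[OF d(1) a(1)] d u1 wa by auto
        then show False using gap[of d] d \<open>u1 d < w a\<close> u1'[OF ne] in_w wa b by auto
      qed
      moreover have "u c \<noteq> w a" using ueq[of c b] False wa by simp
      ultimately show "u a < u c \<and> u c < w a"
        using n1.down[OF c] u1'[OF ca False] in_w by auto
    qed
  qed
  show ?thesis
  proof
    show "u \<in> S_inf" "w \<in> S_inf" by (fact u, rule n1.w)
  next
    fix c assume "c \<le> k" then show "u c \<le> w c"
      using n1.up[of c] wa lt u1'[of c] b by (cases "c = a") auto
  next
    fix c assume "k < c" then show "w c \<le> u c"
      using n1.down[of c] u1 u1'[of c] a lt by (cases "c = b") auto
  next
    fix x c assume xc: "x \<le> k" "c \<le> k"
      "u x < u c \<and> u c < w x \<or> u x < w c \<and> w c < w x"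
    have b': "x \<noteq> b" "c \<noteq> b" using xc b by auto
    show "u x < u c \<and> u c < w x \<and> u x < w c \<and> w c < w x \<and> c < x"
    proof (cases "x = a")
      case True
      then have ca: "c \<noteq> a" using xc(3) by auto
      then have uc: "u1 c = u c" using b' u1' by simp
      have wca: "w c \<noteq> w a" using ca n1.w_eq by simp
      show ?thesis
      proof (cases "u a < u c")
        case True
        then have uca: "u c < u b" using \<open>x = a\<close> xc(3) wa n1.up[OF xc(2)] uc by auto
        then have "\<not> a < c" using gap[of c] True xc(2) b by auto
        then have "c < a" using ca by simp
        moreover have "\<not> w a < w c"
        proof
          assume "w a < w c"
          then have "a < c" using n1.low[OF xc(2) a(1)] u1 uc wa uca by auto
          then show False using \<open>c < a\<close> by simp
        qed
        ultimately show ?thesis using \<open>x = a\<close> True uca wa uc n1.up[OF xc(2)] wca by auto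
      next
        case False
        then have "u c < u a" using ueq[of c a] ca by simp
        then show ?thesis using crossing[OF xc(2)] xc(3) \<open>x = a\<close> by auto
      qed
    next
      case False
      then have ux: "u1 x = u x" using b' u1' by simp
      show ?thesis
      proof (cases "c = a")
        case True
        have "u x < u a \<and> u a < w x \<or> u x < w a \<and> w a < w x" using xc(3) True by simp
        moreover have "w x \<noteq> w a" using False n1.w_eq by simp
        moreover have "u x \<noteq> u a" using False ueq by simp
        ultimately have "u x < w a \<and> w a < w x"
          using crossing[OF xc(1)] lt wa by (cases "w x < w a") auto
        then have "a < x" using n1.low[OF xc(1) a(1)] u1 ux wa by auto
        moreover have "u x < u a"
        proof (rule ccontr)
          assume "\<not> u x < u a"
          then show False using gap[of x] \<open>a < x\<close> xc(1) b \<open>u x \<noteq> u a\<close> \<open>u x < w a \<and> w a < w x\<close> wa by auto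
        qed
        ultimately show ?thesis using \<open>u x < w a \<and> w a < w x\<close> True lt wa by auto
      next
        case False
        then show ?thesis using n1.low[OF xc(1,2)] xc(3) ux u1'[OF False b'(2)] by simp
      qed
    qed
  next
    fix x c assume xc: "x \<le> k" "k < c"
    have ne: "x \<noteq> b" "c \<noteq> a" using xc a b by auto
    show "u x < u c \<and> u c < w x \<longleftrightarrow> u x < w c \<and> w c < w x"
    proof (cases "x = a")
      case True
      then show ?thesis using mixed_a xc by simp
    next
      case False
      then have ux: "u1 x = u x" using ne u1' by simp
      show ?thesis
      proof (cases "c = b")
        case True
        have "u x < u a \<and> u a < w x \<longleftrightarrow> u x < w a \<and> w a < w x"
        proof
          assume l: "u x < u a \<and> u a < w x"
          have "w x \<noteq> w a" using False n1.w_eq by simp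
          then show "u x < w a \<and> w a < w x" using l crossing[OF xc(1)] lt wa by (cases "w x < w a") auto
        next
          assume r: "u x < w a \<and> w a < w x"
          then have "a < x" using n1.low[OF xc(1) a(1)] u1 ux wa by auto
          then show "u x < u a \<and> u a < w x"
            using gap[of x] xc(1) b r ueq[of x a] wa lt by (cases "u x < u a") auto
        qed
        then show ?thesis using n1.mixed[OF xc(1) b] True u1 ux wa by auto
      next
        case False
        then show ?thesis using n1.mixed[OF xc] ux u1'[OF ne(2)] by simp
      qed
    qed
  next
    fix x c assume xc: "k < x" "k < c"
      "w x < u c \<and> u c < u x \<or> w x < w c \<and> w c < u x"
    have ne: "x \<noteq> a" "c \<noteq> a" using xc a by auto
    have *: "x \<noteq> c" using xc(3) by auto
    show "w x < u c \<and> u c < u x \<and> w x < w c \<and> w c < u x \<and> x < c"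
    proof (cases "x = b")
      case True
      then have uc: "u1 c = u c" using * ne u1' by simp
      have bc: "b < c" if "u a < u c" "u c < u b"
        using gap[of c] that a xc(2) * True by force
      have ne': "w c \<noteq> u a" using n1.no_drop[OF xc(2) b] u1 * True by auto
      show ?thesis
      proof (cases "u c < u a")
        case True
        then have "w c < u a" using n1.down[OF xc(2)] uc by simp
        then have "w b < u1 c \<and> u1 c < u1 b \<or> w b < w c \<and> w c < u1 b"
          using xc(3) \<open>x = b\<close> True u1 uc by auto
        then have "w b < u1 c \<and> u1 c < u1 b \<and> w b < w c \<and> w c < u1 b \<and> b < c"
          by (rule n1.high[OF b xc(2)])
        then show ?thesis using \<open>x = b\<close> lt u1 uc by auto
      next
        case False
        then have gt: "u a < u c" using ueq[of c a] ne by simp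
        have "\<not> (w b < w c \<and> w c < u a)"
          using n1.high[OF b xc(2)] u1 uc gt by auto
        then have "u a < w c \<and> u c < w a"
          using xc(3) mixed_a[OF xc(2)] \<open>x = b\<close> gt wa ne' by auto
        then show ?thesis using \<open>x = b\<close> bc gt wa wb mixed_a[OF xc(2)] by auto
      qed
    next
      case False
      then have ux: "u1 x = u x" using ne u1' by simp
      show ?thesis
      proof (cases "c = b")
        case True
        have bx: "b < x" if "u a < u x" "u x < u b"
          using gap[of x] that a xc(1) False by force
        have ne': "w x \<noteq> u a" using n1.no_drop[OF xc(1) b] u1 False by auto
        have ne'': "u x \<noteq> u b" using ueq False by simp
        have "w x < u1 b \<and> u1 b < u1 x \<or> w x < w b \<and> w b < u1 x"
          using xc(3) True mixed_a[OF xc(1)] ux u1 wa lt ne' by auto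
        then have "w x < u1 b \<and> u1 b < u1 x \<and> w x < w b \<and> w b < u1 x \<and> x < b"
          by (rule n1.high[OF xc(1) b])
        moreover from this have "u b < u x"
          using bx ne'' ux u1 by (cases "u x < u b") auto
        ultimately show ?thesis using True ux u1 lt by auto
      next
        case False
        then show ?thesis using n1.high[OF xc(1,2)] xc(3) ux u1'[OF ne(2)] by simp
      qed
    qed
  next
    fix p q assume pq: "k < p" "k < q" "w p = u q"
    show "p = q"
    proof (cases "q = b")
      case True
      then have "p = a" using pq wa n1.w_eq by metis
      then show ?thesis using pq a by simp
    next
      case False
      then show ?thesis using n1.no_drop[OF pq(1,2)] pq(3) u1'[of q] a pq by auto
    qed
  qed
qed

fun cover_chain :: "(nat \<Rightarrow> nat) \<Rightarrow> (nat \<times> nat) list \<Rightarrow> bool" where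
  "cover_chain u [] \<longleftrightarrow> True"
| "cover_chain u ((a, b) # ts) \<longleftrightarrow> covers u a b \<and> cover_chain (u \<circ> transpose a b) ts"

lemma transp_prod_simps [simp]:
  "transp_prod [] = id" "transp_prod ((a, b) # ts) = transpose a b \<circ> transp_prod ts"
  by (simp_all add: transp_prod_def)

lemma length_chain_iff:
  assumes "u \<in> S_inf" "\<forall>(a, b)\<in>set ts. 1 \<le> a \<and> a < b"
  shows "(\<forall>i. 1 \<le> i \<and> i \<le> length ts \<longrightarrow>
           perm_length (u \<circ> transp_prod (take i ts)) = perm_length u + i) \<longleftrightarrow> cover_chain u ts"
  using assms
proof (induction ts arbitrary: u)
  case Nil
  then show ?case by simp
next
  case (Cons t ts)
  obtain a b where t: "t = (a, b)" by (cases t)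
  have ab: "1 \<le> a" "a < b" using Cons.prems t by auto
  define v where "v = u \<circ> transpose a b"
  have v: "v \<in> S_inf" unfolding v_def using Cons.prems(1) ab by (intro S_inf_comp S_inf_transpose) auto
  have first: "perm_length v = perm_length u + 1 \<longleftrightarrow> covers u a b"
    using covers_iff_length[OF Cons.prems(1) ab] by (simp only: v_def Suc_eq_plus1)
  have tk: "u \<circ> transp_prod (take (Suc i) (t # ts)) = v \<circ> transp_prod (take i ts)" for i
    by (simp add: t v_def comp_assoc)
  have "(\<forall>i. 1 \<le> i \<and> i \<le> length (t # ts) \<longrightarrow>
           perm_length (u \<circ> transp_prod (take i (t # ts))) = perm_length u + i)
      \<longleftrightarrow> (\<forall>i\<le>length ts. perm_length (v \<circ> transp_prod (take i ts)) = perm_length u + Suc i)"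
    (is "?L \<longleftrightarrow> ?R")
  proof
    assume L: ?L
    show ?R
    proof (intro allI impI)
      fix i assume "i \<le> length ts"
      then show "perm_length (v \<circ> transp_prod (take i ts)) = perm_length u + Suc i"
        using L[rule_format, of "Suc i"] unfolding tk by (simp only: list.size, simp)
    qed
  next
    assume R: ?R
    show ?L
    proof (intro allI impI)
      fix i assume i: "1 \<le> i \<and> i \<le> length (t # ts)"
      then obtain j where "i = Suc j" "j \<le> length ts" by (cases i) auto
      then show "perm_length (u \<circ> transp_prod (take i (t # ts))) = perm_length u + i"
        using R[rule_format, of j] by (simp only: tk)
    qed
  qed
  also have "\<dots> \<longleftrightarrow> perm_length v = perm_length u + 1 \<and> (\<forall>i. 1 \<le> i \<and> i \<le> length ts \<longrightarrow>
           perm_length (v \<circ> transp_prod (take i ts)) = perm_length v + i)" (is "_ \<longleftrightarrow> ?R'")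
  proof
    assume R: ?R
    have "perm_length v = perm_length u + 1"
      using R[rule_format, of 0] by simp
    then show ?R' using R by simp
  next
    assume R': ?R'
    show ?R
    proof (intro allI impI)
      fix i assume "i \<le> length ts"
      then show "perm_length (v \<circ> transp_prod (take i ts)) = perm_length u + Suc i"
        using R' by (cases "i = 0") auto
    qed
  qed
  also have "\<dots> \<longleftrightarrow> covers u a b \<and> cover_chain v ts"
  proof -
    have "(\<forall>i. 1 \<le> i \<and> i \<le> length ts \<longrightarrow>
           perm_length (v \<circ> transp_prod (take i ts)) = perm_length v + i) \<longleftrightarrow> cover_chain v ts"
      using Cons.prems(2) by (intro Cons.IH[OF v]) simp
    then show ?thesis by (simp only: first)
  qed
  finally show ?case by (simp only: t cover_chain.simps v_def)
qed

lemma transp_prod_other: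
  "\<forall>(a, b)\<in>set ts. a \<noteq> c \<and> b \<noteq> c \<Longrightarrow> transp_prod ts c = c"
  by (induction ts) auto

lemma noncrossing_if_chain:
  assumes "u \<in> S_inf" "\<forall>(a, b)\<in>set ts. 1 \<le> a \<and> a \<le> k \<and> k < b" "distinct (map fst ts)" "cover_chain u ts"
  shows "noncrossing k u (u \<circ> transp_prod ts)"
  using assms
proof (induction ts arbitrary: u)
  case Nil
  then show ?case using noncrossing_refl by simp
next
  case (Cons t ts)
  obtain a b where t: "t = (a, b)" by (cases t)
  have ab: "1 \<le> a" "a \<le> k" "k < b" using Cons.prems t by auto
  define v where "v = u \<circ> transpose a b"
  have v: "v \<in> S_inf" unfolding v_def using Cons.prems(1) ab by (intro S_inf_comp S_inf_transpose) auto
  have cov: "covers u a b" "cover_chain v ts" using Cons.prems(4) by (simp_all add: t v_def)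
  have w: "u \<circ> transp_prod (t # ts) = v \<circ> transp_prod ts" by (simp add: t v_def comp_assoc)
  have "noncrossing k v (v \<circ> transp_prod ts)"
    using Cons.prems cov v by (intro Cons.IH) auto
  moreover have "transp_prod ts a = a"
    using Cons.prems(2,3) ab by (intro transp_prod_other) (force simp: t)
  then have "(v \<circ> transp_prod ts) a = u b" by (simp add: v_def)
  ultimately have "noncrossing k u (v \<circ> transp_prod ts)"
    using noncrossing_prepend[OF Cons.prems(1) ab(2,1,3) _ cov(1)] by (simp only: v_def)
  then show ?case by (simp only: w)
qed

lemma noncrossing_induct [consumes 1, case_names refl step]:
  assumes "noncrossing k u w"
    and refl: "P w"
    and step: "\<And>u a b. noncrossing k u w \<Longrightarrow> 1 \<le> a \<Longrightarrow> a \<le> k \<Longrightarrow> k < b \<Longrightarrow> w a = u b \<Longrightarrow> u a \<noteq> w a \<Longrightarrow>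
      covers u a b \<Longrightarrow> noncrossing k (u \<circ> transpose a b) w \<Longrightarrow> P (u \<circ> transpose a b) \<Longrightarrow> P u"
  shows "P u"
  using assms(1)
proof (induction "card {a. a \<le> k \<and> u a \<noteq> w a}" arbitrary: u rule: less_induct)
  case less
  interpret noncrossing k u w by (rule less.prems)
  show ?case
  proof (cases "u = w")
    case True
    then show ?thesis using refl by simp
  next
    case False
    then obtain a b where ab: "a \<le> k" "k < b" "w a = u b" "u a \<noteq> w a" using ex_first by blast
    define v where "v = u \<circ> transpose a b"
    have cov: "covers u a b" and nc: "noncrossing k v w"
      unfolding v_def using first_step[OF ab] by blast+
    have va: "v a = w a" using ab by (simp add: v_def)
    have vc: "v c = u c" if "c \<le> k" "c \<noteq> a" for c using that ab by (simp add: v_def)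
    have "{c. c \<le> k \<and> v c \<noteq> w c} \<subset> {c. c \<le> k \<and> u c \<noteq> w c}"
    proof (rule psubsetI)
      show "{c. c \<le> k \<and> v c \<noteq> w c} \<subseteq> {c. c \<le> k \<and> u c \<noteq> w c}"
        using va vc by (auto, metis)
      have "a \<in> {c. c \<le> k \<and> u c \<noteq> w c} - {c. c \<le> k \<and> v c \<noteq> w c}" using va ab by simp
      then show "{c. c \<le> k \<and> v c \<noteq> w c} \<noteq> {c. c \<le> k \<and> u c \<noteq> w c}" by blast
    qed
    then have "card {c. c \<le> k \<and> v c \<noteq> w c} < card {c. c \<le> k \<and> u c \<noteq> w c}"
      by (intro psubset_card_mono) simp_all
    from less.hyps[OF this nc] have "P v" .
    moreover have "1 \<le> a" using ab(4) S_inf_0[OF u] S_inf_0[OF w] by (cases "a = 0") auto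
    ultimately show ?thesis using step[OF less.prems] ab cov nc by (simp only: v_def)
  qed
qed

lemma chain_if_noncrossing:
  assumes "noncrossing k u w"
  shows "\<exists>ts. (\<forall>(a, b)\<in>set ts. 1 \<le> a \<and> a \<le> k \<and> k < b) \<and> distinct (map fst ts) \<and>
    fst ` set ts \<subseteq> {a. u a \<noteq> w a} \<and> cover_chain u ts \<and> w = u \<circ> transp_prod ts"
  using assms
proof (induction rule: noncrossing_induct)
  case refl
  show ?case by (intro exI[of _ "[]"]) simp
next
  case (step u a b)
  define v where "v = u \<circ> transpose a b"
  obtain ts where ts: "\<forall>(a, b)\<in>set ts. 1 \<le> a \<and> a \<le> k \<and> k < b" "distinct (map fst ts)"
    "fst ` set ts \<subseteq> {c. v c \<noteq> w c}" "cover_chain v ts" "w = v \<circ> transp_prod ts"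
    using step.IH unfolding v_def by blast
  have "a \<notin> fst ` set ts" using ts(3) step.hyps by (auto simp: v_def)
  moreover have "u c \<noteq> w c" if "c \<in> fst ` set ts" for c
  proof -
    have "c \<noteq> a" "c \<noteq> b" using that calculation ts(1) step.hyps by auto
    then show ?thesis using that ts(3) by (auto simp: v_def)
  qed
  ultimately have "(\<forall>(a, b)\<in>set ((a, b) # ts). 1 \<le> a \<and> a \<le> k \<and> k < b) \<and> distinct (map fst ((a, b) # ts)) \<and>
    fst ` set ((a, b) # ts) \<subseteq> {a. u a \<noteq> w a} \<and> cover_chain u ((a, b) # ts) \<and>
    w = u \<circ> transp_prod ((a, b) # ts)"
    using ts step.hyps by (auto simp: v_def comp_assoc)
  then show ?case by blast
qed

lemma arrow_iff_noncrossing: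
  assumes "u \<in> S_inf"
  shows "arrow k u w \<longleftrightarrow> noncrossing k u w"
proof
  assume "arrow k u w"
  then obtain ts where ts: "\<forall>(a, b)\<in>set ts. 1 \<le> a \<and> a \<le> k \<and> k < b" "distinct (map fst ts)"
    "\<forall>i. 1 \<le> i \<and> i \<le> length ts \<longrightarrow> perm_length (u \<circ> transp_prod (take i ts)) = perm_length u + i"
    "w = u \<circ> transp_prod ts"
    unfolding arrow_def by blast
  have "\<forall>(a, b)\<in>set ts. 1 \<le> a \<and> a < b" using ts(1) by fastforce
  then have "cover_chain u ts" using length_chain_iff[OF assms] ts(3) by blast
  then show "noncrossing k u w" unfolding ts(4) by (intro noncrossing_if_chain assms ts)
next
  assume "noncrossing k u w"
  then obtain ts where ts: "\<forall>(a, b)\<in>set ts. 1 \<le> a \<and> a \<le> k \<and> k < b" "distinct (map fst ts)"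
    "cover_chain u ts" "w = u \<circ> transp_prod ts"
    using chain_if_noncrossing by blast
  have "\<forall>(a, b)\<in>set ts. 1 \<le> a \<and> a < b" using ts(1) by fastforce
  then have len: "\<forall>i. 1 \<le> i \<and> i \<le> length ts \<longrightarrow> perm_length (u \<circ> transp_prod (take i ts)) = perm_length u + i"
    using length_chain_iff[OF assms] ts(3) by blast
  have "length ts = card (set (map fst ts))" using ts(2) distinct_card by fastforce
  also have "\<dots> \<le> card {1..k}" by (rule card_mono) (use ts(1) in auto)
  finally have "length ts \<le> k" by simp
  then show "arrow k u w" unfolding arrow_def using ts len by blast
qed

lemma noncrossing_permutes:
  assumes "noncrossing k u w" "u permutes {1..N}" "k \<le> N"
  shows "w permutes {1..Suc N}"
proof -
  interpret noncrossing k u w by fact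
  have fix_u: "u c = c" if "N < c" for c using permutes_not_in[OF assms(2), of c] that by simp
  have "w b = b" if b: "Suc N < b" for b
  proof (rule ccontr)
    assume "w b \<noteq> b"
    then have lt: "w b < b" using down[of b] fix_u[of b] b assms(3) by simp
    obtain q where q: "u q = w b" using S_inf_bij[OF u] by (metis bij_pointE)
    have "q \<le> k"
    proof (rule ccontr)
      assume "\<not> q \<le> k"
      then have "b = q" using no_drop[of b q] q b assms(3) by simp
      then show False using q fix_u[of b] lt b by simp
    qed
    then have "w b \<le> N" using q permutes_le_iff[OF assms(2), of q] assms(3) by simp
    then show False
      using high[of b "Suc N"] b assms(3) fix_u[of b] fix_u[of "Suc N"] by simp
  qed
  moreover have "w 0 = 0" using S_inf_0[OF w] .
  ultimately have "w x = x" if "x \<notin> {1..Suc N}" for x using that by (cases "x = 0") auto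
  then show ?thesis using S_inf_bij[OF w] by (auto simp: permutes_def bij_def dest: injD) (metis surjD)
qed

section \<open>Exchanging two adjacent values\<close>

lemma noncrossing_S_inf: "noncrossing k u w \<Longrightarrow> u \<in> S_inf" "noncrossing k u w \<Longrightarrow> w \<in> S_inf"
  by (auto simp: noncrossing_def)

lemma noncrossing_up: "noncrossing k u w \<Longrightarrow> a \<le> k \<Longrightarrow> u a \<le> w a"
  by (auto simp: noncrossing_def)

lemma adj_eq_iff [simp]: "adj i x = adj i y \<longleftrightarrow> x = y"
  by (metis adj_adj(1))

lemma adj_less_iff: "adj i p < adj i q \<longleftrightarrow> (p < q \<and> (p, q) \<noteq> (i, Suc i)) \<or> (p, q) = (Suc i, i)"
  by (auto simp: adj_def transpose_def)

lemma adj_comp_adj_comp [simp]: "adj i \<circ> (adj i \<circ> u) = u"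
  by (simp add: fun_eq_iff)

lemma adj_comp_conv_transpose:
  assumes u: "u \<in> S_inf" and "u \<alpha> = i" "u \<beta> = Suc i"
  shows "adj i \<circ> u = u \<circ> transpose \<alpha> \<beta>"
proof
  fix c
  show "(adj i \<circ> u) c = (u \<circ> transpose \<alpha> \<beta>) c"
  proof (cases "c = \<alpha> \<or> c = \<beta>")
    case True
    then show ?thesis using assms by auto
  next
    case False
    then have "u c \<noteq> i" "u c \<noteq> Suc i" using assms S_inf_eq_iff[OF u] by metis+
    then show ?thesis using False by simp
  qed
qed

lemma covers_adj:
  assumes u: "u \<in> S_inf" and "u \<alpha> = i" "u \<beta> = Suc i" "\<alpha> < \<beta>" "covers u a b" "a < b" "\<not> (a = \<alpha> \<and> b = \<beta>)"
  shows "covers (adj i \<circ> u) a b"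
proof -
  have pos: "u c = i \<longleftrightarrow> c = \<alpha>" "u c = Suc i \<longleftrightarrow> c = \<beta>" for c
    using assms(2,3) S_inf_eq_iff[OF u] by metis+
  show ?thesis
    using assms(4-) unfolding covers_def by (auto simp: adj_less_iff pos)
qed

lemma covers_values:
  "u a = i \<Longrightarrow> u b = Suc i \<Longrightarrow> covers u a b"
  by (auto simp: covers_def)

lemma noncrossing_adj_refl: "w \<in> S_inf \<Longrightarrow> 1 \<le> i \<Longrightarrow> noncrossing k (adj i \<circ> w) (adj i \<circ> w)"
  by (intro noncrossing_refl S_inf_comp S_inf_adj)

lemma noncrossing_prepend':
  assumes "noncrossing k v w" "u \<in> S_inf" "a \<le> k" "1 \<le> a" "k < b" "covers u a b" "w a = u b"
    and "v = u \<circ> transpose a b"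
  shows "noncrossing k u w"
  by (rule noncrossing_prepend[where a = a and b = b]) (use assms in auto)

text \<open>
  As long as no step exchanges the values \<open>i\<close> and \<open>i + 1\<close> themselves, a chain keeps \<open>i\<close> to the
  left of \<open>i + 1\<close>, since a step that moves one of them past the other is not a cover.
\<close>

lemma noncrossing_adj_if:
  assumes "noncrossing k u w" "1 \<le> i"
    and "u \<alpha> = i" "u \<beta> = Suc i" "\<alpha> < \<beta>" "\<not> (\<alpha> \<le> k \<and> w \<alpha> = Suc i)"
    and "w \<gamma> = i" "w \<delta> = Suc i"
  shows "\<gamma> < \<delta> \<and> noncrossing k (adj i \<circ> u) (adj i \<circ> w)"
  using assms
proof (induction arbitrary: \<alpha> \<beta> rule: noncrossing_induct)
  case refl
  have w: "w \<in> S_inf" using assms(1) by (rule noncrossing_S_inf)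
  have "\<alpha> = \<gamma>" "\<beta> = \<delta>" using refl S_inf_eq_iff[OF w] by metis+
  have "noncrossing k (adj i \<circ> w) (adj i \<circ> w)"
    using w refl(1) by (rule noncrossing_adj_refl)
  then show ?case using \<open>\<alpha> = \<gamma>\<close> \<open>\<beta> = \<delta>\<close> refl(4) by blast
next
  case (step u a b)
  have S: "u \<in> S_inf" "w \<in> S_inf" using step(1) noncrossing_S_inf by auto
  have pos: "u c = i \<longleftrightarrow> c = \<alpha>" "u c = Suc i \<longleftrightarrow> c = \<beta>" for c
    using step.prems(2,3) S_inf_eq_iff[OF S(1)] by metis+
  have ab: "a < b" using step by simp
  have exc: "\<not> (a = \<alpha> \<and> b = \<beta>)" using step.prems step.hyps by auto
  define v where "v = u \<circ> transpose a b"
  define \<alpha>' where "\<alpha>' = transpose a b \<alpha>"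
  define \<beta>' where "\<beta>' = transpose a b \<beta>"
  have v: "v \<alpha>' = i" "v \<beta>' = Suc i"
    using step.prems by (simp_all add: v_def \<alpha>'_def \<beta>'_def)
  have gap: "\<not> (u a < u c \<and> u c < u b)" if "a < c" "c < b" for c
    using that step.hyps by (auto simp: covers_def)
  have lt: "u a < u b" using step.hyps by (simp add: covers_def)
  have "\<alpha>' < \<beta>'"
  proof -
    consider "a = \<alpha>" | "b = \<alpha>" | "a = \<beta>" | "b = \<beta>" "a \<noteq> \<alpha>" | "a \<notin> {\<alpha>, \<beta>}" "b \<notin> {\<alpha>, \<beta>}" by blast
    then show ?thesis
    proof cases
      case 1
      then have "b < \<beta>" using gap[of \<beta>] exc lt pos(2)[of b] step.prems(2,3,4)
        by (cases b \<beta> rule: linorder_cases) auto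
      then show ?thesis using 1 step.prems(4) by (simp add: \<alpha>'_def \<beta>'_def)
    next
      case 2
      then have "b \<noteq> \<beta>" "a \<noteq> \<beta>" using step.prems(4) ab by auto
      then show ?thesis using 2 step.prems(4) ab by (auto simp: \<alpha>'_def \<beta>'_def)
    next
      case 3
      then show ?thesis using step.prems(4) ab by (simp add: \<alpha>'_def \<beta>'_def)
    next
      case 4
      then have "\<alpha> < a" using gap[of \<alpha>] lt step.prems(2,3,4) pos(1)[of a]
        by (cases a \<alpha> rule: linorder_cases) auto
      then show ?thesis using 4 step.prems(4) by (simp add: \<alpha>'_def \<beta>'_def)
    next
      case 5
      then show ?thesis using step.prems(4) by (simp add: \<alpha>'_def \<beta>'_def)
    qed
  qed
  moreover have "\<not> (\<alpha>' \<le> k \<and> w \<alpha>' = Suc i)"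
  proof
    assume *: "\<alpha>' \<le> k \<and> w \<alpha>' = Suc i"
    show False
    proof (cases "\<alpha>' = \<alpha>")
      case False
      then have "\<alpha>' = a" using * step.hyps by (auto simp: \<alpha>'_def transpose_def split: if_splits)
      then have "w \<alpha>' = i" using v(1) step.hyps by (simp add: v_def)
      then show ?thesis using * by simp
    qed (use * step.prems in auto)
  qed
  ultimately have IH: "\<gamma> < \<delta>" "noncrossing k (adj i \<circ> v) (adj i \<circ> w)"
    using step.IH[of \<alpha>' \<beta>'] v step.prems unfolding v_def by blast+
  have "noncrossing k (adj i \<circ> u) (adj i \<circ> w)"
  proof (rule noncrossing_prepend'[OF IH(2) _ step.hyps(3,2,4)])
    show "adj i \<circ> u \<in> S_inf" using S step.prems(1) by (intro S_inf_comp S_inf_adj)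
    show "(adj i \<circ> w) a = (adj i \<circ> u) b" using step.hyps by simp
    show "covers (adj i \<circ> u) a b"
      using covers_adj[OF S(1) step.prems(2,3,4) _ ab exc] step.hyps by simp
    show "adj i \<circ> v = adj i \<circ> u \<circ> transpose a b" by (simp only: v_def comp_assoc)
  qed
  then show ?case using IH by blast
qed

lemma noncrossing_adj_only_if:
  assumes "noncrossing k u w" "1 \<le> i"
    and "u \<alpha> = Suc i" "u \<beta> = i" "\<alpha> < \<beta>" "\<not> (\<beta> \<le> k \<and> w \<beta> = Suc i)"
    and "w \<gamma> = Suc i" "w \<delta> = i" "\<gamma> < \<delta>"
  shows "noncrossing k (adj i \<circ> u) (adj i \<circ> w)"
  using assms
proof (induction arbitrary: \<alpha> \<beta> rule: noncrossing_induct)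
  case refl
  show ?case using assms(1) refl(1) by (intro noncrossing_adj_refl noncrossing_S_inf)
next
  case (step u a b)
  have S: "u \<in> S_inf" "w \<in> S_inf" using step(1) noncrossing_S_inf by auto
  have pos: "u c = Suc i \<longleftrightarrow> c = \<alpha>" "u c = i \<longleftrightarrow> c = \<beta>" for c
    using step.prems(2,3) S_inf_eq_iff[OF S(1)] by metis+
  have ab: "a < b" using step by simp
  define v where "v = u \<circ> transpose a b"
  define \<alpha>' where "\<alpha>' = transpose a b \<alpha>"
  define \<beta>' where "\<beta>' = transpose a b \<beta>"
  have v: "v \<alpha>' = Suc i" "v \<beta>' = i"
    using step.prems by (simp_all add: v_def \<alpha>'_def \<beta>'_def)
  have gap: "\<not> (u a < u c \<and> u c < u b)" if "a < c" "c < b" for c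
    using that step.hyps by (auto simp: covers_def)
  have lt: "u a < u b" using step.hyps by (simp add: covers_def)
  have exc: "\<not> (\<beta>' \<le> k \<and> w \<beta>' = Suc i)"
  proof
    assume *: "\<beta>' \<le> k \<and> w \<beta>' = Suc i"
    show False
    proof (cases "\<beta>' = \<beta>")
      case False
      then have "\<beta>' = a" using * step.hyps by (auto simp: \<beta>'_def transpose_def split: if_splits)
      then have "w \<beta>' = i" using v(2) step.hyps by (simp add: v_def)
      then show ?thesis using * by simp
    qed (use * step.prems in auto)
  qed
  have order: "\<alpha>' < \<beta>'"
  proof (rule ccontr)
    assume "\<not> \<alpha>' < \<beta>'"
    moreover have "\<alpha>' \<noteq> \<beta>'" using v by auto
    ultimately have "\<beta>' < \<alpha>'" by simp
    moreover have "noncrossing k v w" using step.hyps by (simp only: v_def)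
    ultimately have "\<delta> < \<gamma>"
      using noncrossing_adj_if[of k v w i \<beta>' \<alpha>' \<delta> \<gamma>] exc v step.prems by blast
    then show False using step.prems by simp
  qed
  then have IH: "noncrossing k (adj i \<circ> v) (adj i \<circ> w)"
    using step.IH[of \<alpha>' \<beta>'] v exc step.prems unfolding v_def by blast
  show ?case
  proof (rule noncrossing_prepend'[OF IH _ step.hyps(3,2,4)])
    show "adj i \<circ> u \<in> S_inf" using S step.prems(1) by (intro S_inf_comp S_inf_adj)
    show "(adj i \<circ> w) a = (adj i \<circ> u) b" using step.hyps by simp
    show "adj i \<circ> v = adj i \<circ> u \<circ> transpose a b" by (simp only: v_def comp_assoc)
    show "covers (adj i \<circ> u) a b"
      unfolding covers_def
    proof (intro conjI allI impI notI)
      show "(adj i \<circ> u) a < (adj i \<circ> u) b"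
        using lt ab step.prems(4) by (auto simp: adj_less_iff pos)
    next
      fix c assume c: "a < c \<and> c < b"
        "(adj i \<circ> u) a < (adj i \<circ> u) c \<and> (adj i \<circ> u) c < (adj i \<circ> u) b"
      then have "(a = \<alpha> \<and> c = \<beta>) \<or> (c = \<alpha> \<and> b = \<beta>)"
        using gap[of c] by (auto simp: adj_less_iff pos)
      then show False
        using order c(1) step.prems(4) by (auto simp: \<alpha>'_def \<beta>'_def)
    qed
  qed
qed

lemma noncrossing_fixed_value:
  assumes "noncrossing k u w" "1 \<le> i"
    and "u \<alpha> = Suc i" "u \<beta> = i" "\<alpha> < \<beta>" "\<beta> \<le> k" "w \<beta> = i" "w \<alpha> \<noteq> Suc i"
    and "w \<delta> = Suc i"
  shows "\<beta> < \<delta> \<and> noncrossing k u (adj i \<circ> w)"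
  using assms
proof (induction rule: noncrossing_induct)
  case refl
  then show ?case by simp
next
  case (step u a b)
  have S: "u \<in> S_inf" "w \<in> S_inf" using step(1) noncrossing_S_inf by auto
  have pos: "u c = Suc i \<longleftrightarrow> c = \<alpha>" "u c = i \<longleftrightarrow> c = \<beta>" for c
    using step.prems(2,3) S_inf_eq_iff[OF S(1)] by metis+
  have b: "b \<noteq> \<alpha>" "b \<noteq> \<beta>" using step.hyps step.prems by auto
  have a: "a \<noteq> \<beta>" using step.hyps step.prems by auto
  have wa: "(adj i \<circ> w) a = u b" using step.hyps b pos[of b] by simp
  define v where "v = u \<circ> transpose a b"
  have vS: "v \<in> S_inf" using step.hyps noncrossing_S_inf by (simp add: v_def)
  show ?case
  proof (cases "a = \<alpha>")
    case False
    then have "v \<alpha> = Suc i" "v \<beta> = i" using a b step.prems by (simp_all add: v_def)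
    then have IH: "\<beta> < \<delta>" "noncrossing k v (adj i \<circ> w)"
      using step.IH step.prems by (simp_all only: v_def simp_thms)
    then show ?thesis
      using noncrossing_prepend'[OF IH(2) S(1) step.hyps(3,2,4,7) wa v_def] by simp
  next
    case True
    have v: "v \<beta> = i" "v b = Suc i" using True a b step.prems by (simp_all add: v_def)
    have \<beta>b: "\<beta> < b" using step.hyps step.prems by simp
    have nc: "noncrossing k v w" using step.hyps by (simp only: v_def)
    have *: "\<beta> < \<delta> \<and> noncrossing k (adj i \<circ> v) (adj i \<circ> w)"
      by (rule noncrossing_adj_if[OF nc step.prems(1) v \<beta>b]) (use step.prems in auto)
    have "noncrossing k v (adj i \<circ> w)"
    proof (rule noncrossing_prepend'[OF *[THEN conjunct2] vS step.prems(5) _ step.hyps(4)])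
      show "1 \<le> \<beta>" using step.prems by simp
      show "(adj i \<circ> w) \<beta> = v b" using v step.prems by simp
      show "covers v \<beta> b" using v by (rule covers_values)
      show "adj i \<circ> v = v \<circ> transpose \<beta> b" using vS v by (rule adj_comp_conv_transpose)
    qed
    then show ?thesis
      using * noncrossing_prepend'[where w = "adj i \<circ> w", OF _ S(1) step.hyps(3,2,4,7) wa v_def] by blast
  qed
qed

lemma noncrossing_fixed_value_converse:
  assumes "noncrossing k u w" "1 \<le> i"
    and "u \<alpha> = Suc i" "u \<beta> = i" "\<alpha> < \<beta>" "\<beta> \<le> k" "w \<beta> = Suc i"
    and "w \<delta> = i" "\<beta> < \<delta>"
  shows "noncrossing k u (adj i \<circ> w)"
  using assms
proof (induction rule: noncrossing_induct)
  case refl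
  then show ?case by simp
next
  case (step u a b)
  have S: "u \<in> S_inf" "w \<in> S_inf" using step(1) noncrossing_S_inf by auto
  have pos: "u c = Suc i \<longleftrightarrow> c = \<alpha>" "u c = i \<longleftrightarrow> c = \<beta>" for c
    using step.prems(2,3) S_inf_eq_iff[OF S(1)] by metis+
  have b: "b \<noteq> \<alpha>" "b \<noteq> \<beta>" using step.hyps step.prems by auto
  have a: "a \<noteq> \<beta>"
  proof
    assume "a = \<beta>"
    then show False using step.hyps step.prems pos(1)[of b] b by simp
  qed
  have wa: "(adj i \<circ> w) a = u b" using step.hyps b pos[of b] by simp
  define v where "v = u \<circ> transpose a b"
  have vS: "v \<in> S_inf" using step.hyps noncrossing_S_inf by (simp add: v_def)
  have nc: "noncrossing k v w" using step.hyps by (simp only: v_def)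
  have "noncrossing k v (adj i \<circ> w)"
  proof (cases "a = \<alpha>")
    case False
    then have "v \<alpha> = Suc i" "v \<beta> = i" using a b step.prems by (simp_all add: v_def)
    then show ?thesis
      using step.IH step.prems by (simp only: v_def simp_thms)
  next
    case True
    have v: "v \<beta> = i" "v b = Suc i" using True a b step.prems by (simp_all add: v_def)
    have \<beta>b: "\<beta> < b" using step.hyps step.prems by simp
    have eq: "v \<circ> transpose \<beta> b = adj i \<circ> v"
      using adj_comp_conv_transpose[OF vS v] by (rule sym)
    have "noncrossing k (adj i \<circ> v) w"
      using noncrossing.first_step(2)[OF nc step.prems(5) step.hyps(4)] v step.prems by (simp only: eq simp_thms n_not_Suc_n)
    then have "noncrossing k (adj i \<circ> (adj i \<circ> v)) (adj i \<circ> w)"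
      by (rule noncrossing_adj_only_if[of _ _ _ _ \<beta> b \<beta> \<delta>]) (use step.prems step.hyps v \<beta>b in auto)
    then show ?thesis by simp
  qed
  then show ?case
    by (rule noncrossing_prepend'[where w = "adj i \<circ> w", OF _ S(1) step.hyps(3,2,4,7) wa v_def])
qed

lemma noncrossing_raise:
  assumes "noncrossing k u w" "1 \<le> i"
    and "u \<alpha> = i" "u \<beta> = Suc i" "\<alpha> < \<beta>" "\<alpha> \<le> k" "w \<alpha> = Suc i"
  shows "noncrossing k (adj i \<circ> u) w"
proof (cases "\<beta> \<le> k")
  case False
  then have \<beta>: "k < \<beta>" by simp
  have S: "u \<in> S_inf" using assms noncrossing_S_inf by auto
  show ?thesis
    using noncrossing.first_step(2)[OF assms(1,6) \<beta>] assms(3,4,7)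
    by (simp only: adj_comp_conv_transpose[OF S assms(3,4)] n_not_Suc_n simp_thms)
next
  case True
  show ?thesis
    using assms True
  proof (induction rule: noncrossing_induct)
    case refl
    then show ?case by (metis S_inf_eq_iff assms(1) noncrossing_S_inf(2) n_not_Suc_n)
  next
    case (step u a b)
    have S: "u \<in> S_inf" "w \<in> S_inf" using step(1) noncrossing_S_inf by auto
    have pos: "u c = i \<longleftrightarrow> c = \<alpha>" "u c = Suc i \<longleftrightarrow> c = \<beta>" for c
      using step.prems(2,3) S_inf_eq_iff[OF S(1)] by metis+
    have ab: "a < b" using step by simp
    have b: "b \<noteq> \<alpha>" "b \<noteq> \<beta>" using step.hyps step.prems by auto
    have a: "a \<noteq> \<alpha>"
    proof
      assume "a = \<alpha>"
      then show False using step.hyps step.prems pos(2)[of b] b by simp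
    qed
    define v where "v = u \<circ> transpose a b"
    have vS: "v \<in> S_inf" using step.hyps noncrossing_S_inf by (simp add: v_def)
    have nc: "noncrossing k v w" using step.hyps by (simp only: v_def)
    have S': "adj i \<circ> u \<in> S_inf" using S step.prems(1) by (intro S_inf_comp S_inf_adj)
    have wa: "w a = (adj i \<circ> u) b" using step.hyps b pos[of b] by simp
    have cov: "covers (adj i \<circ> u) a b"
      using covers_adj[OF S(1) step.prems(2,3,4) step.hyps(7) ab] a by blast
    have "noncrossing k (adj i \<circ> v) w"
    proof (cases "a = \<beta>")
      case False
      then have "v \<alpha> = i" "v \<beta> = Suc i" using a b step.prems by (simp_all add: v_def)
      then show ?thesis
        using step.IH step.prems by (simp only: v_def simp_thms)
    next
      case True
      have v: "v \<alpha> = i" "v b = Suc i" using True a b step.prems by (simp_all add: v_def)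
      show ?thesis
        using noncrossing.first_step(2)[OF nc step.prems(5) step.hyps(4)] v step.prems(6)
        by (simp only: adj_comp_conv_transpose[OF vS v] n_not_Suc_n simp_thms)
    qed
    then show ?case
      by (rule noncrossing_prepend'[where w = w, OF _ S' step.hyps(3,2,4) cov wa]) (simp only: v_def comp_assoc)
  qed
qed

lemma noncrossing_lower:
  assumes "noncrossing k u w" "1 \<le> i"
    and "u \<alpha> = Suc i" "u \<beta> = i" "\<alpha> < \<beta>" "\<alpha> \<le> k" "w \<alpha> = Suc i" "\<not> (\<beta> \<le> k \<and> w \<beta> = i)"
  shows "noncrossing k (adj i \<circ> u) w"
proof (cases "\<beta> \<le> k")
  case False
  then have \<beta>: "k < \<beta>" by simp
  have S: "u \<in> S_inf" using assms noncrossing_S_inf by auto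
  have eq: "u = adj i \<circ> u \<circ> transpose \<alpha> \<beta>"
    unfolding adj_comp_conv_transpose[OF S assms(4,3)] by (simp add: fun_eq_iff transpose_commute[of \<beta>])
  show ?thesis
  proof (rule noncrossing_prepend'[OF assms(1) _ assms(6) _ \<beta> _ _ eq])
    show "adj i \<circ> u \<in> S_inf" using S assms(2) by (intro S_inf_comp S_inf_adj)
    show "1 \<le> \<alpha>" using S_inf_0[OF S] assms by (cases "\<alpha> = 0") auto
    show "w \<alpha> = (adj i \<circ> u) \<beta>" using assms by simp
    show "covers (adj i \<circ> u) \<alpha> \<beta>" by (rule covers_values[of _ _ i]) (use assms in simp_all)
  qed
next
  case True
  show ?thesis
    using assms True
  proof (induction rule: noncrossing_induct)
    case refl
    then show ?case by simp
  next
    case (step u a b)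
    have S: "u \<in> S_inf" "w \<in> S_inf" using step(1) noncrossing_S_inf by auto
    have pos: "u c = Suc i \<longleftrightarrow> c = \<alpha>" "u c = i \<longleftrightarrow> c = \<beta>" for c
      using step.prems(2,3) S_inf_eq_iff[OF S(1)] by metis+
    have b: "b \<noteq> \<alpha>" "b \<noteq> \<beta>" using step.hyps step.prems by auto
    have a: "a \<noteq> \<alpha>" using step.hyps step.prems by auto
    have a1: "1 \<le> \<alpha>" using S_inf_0[OF S(1)] step.prems by (cases "\<alpha> = 0") auto
    define v where "v = u \<circ> transpose a b"
    have vS: "v \<in> S_inf" using step.hyps noncrossing_S_inf by (simp add: v_def)
    have nc: "noncrossing k v w" using step.hyps by (simp only: v_def)
    have S': "adj i \<circ> u \<in> S_inf" using S step.prems(1) by (intro S_inf_comp S_inf_adj)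
    have wa: "w a = (adj i \<circ> u) b" using step.hyps b pos[of b] by simp
    have lt: "u a < u b" and gap: "\<And>c. a < c \<Longrightarrow> c < b \<Longrightarrow> \<not> (u a < u c \<and> u c < u b)"
      using step.hyps by (auto simp: covers_def)
    have cov: "covers (adj i \<circ> u) a b"
      unfolding covers_def
    proof (intro conjI allI impI notI)
      show "(adj i \<circ> u) a < (adj i \<circ> u) b"
        using lt a b pos[of b] unfolding o_apply adj_less_iff by auto
    next
      fix c assume c: "a < c \<and> c < b" "(adj i \<circ> u) a < (adj i \<circ> u) c \<and> (adj i \<circ> u) c < (adj i \<circ> u) b"
      then show False
        using gap[of c] a b pos[of a] pos[of b] unfolding o_apply adj_less_iff by auto
    qed
    have "noncrossing k (adj i \<circ> v) w"
    proof (cases "a = \<beta>")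
      case False
      then have "v \<alpha> = Suc i" "v \<beta> = i" using a b step.prems by (simp_all add: v_def)
      then show ?thesis
        using step.IH step.prems by (simp only: v_def simp_thms)
    next
      case True
      have v: "v \<alpha> = Suc i" "v b = i" using True a b step.prems by (simp_all add: v_def)
      have eq: "v = adj i \<circ> v \<circ> transpose \<alpha> b"
        unfolding adj_comp_conv_transpose[OF vS v(2,1)] by (simp add: fun_eq_iff transpose_commute[of b])
      show ?thesis
      proof (rule noncrossing_prepend'[OF nc _ step.prems(5) a1 step.hyps(4) _ _ eq])
        show "adj i \<circ> v \<in> S_inf" using vS assms(2) by (intro S_inf_comp S_inf_adj)
        show "w \<alpha> = (adj i \<circ> v) b" using v step.prems by simp
        show "covers (adj i \<circ> v) \<alpha> b" by (rule covers_values[of _ _ i]) (use v in simp_all)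
      qed
    qed
    then show ?case
      by (rule noncrossing_prepend'[where w = w, OF _ S' step.hyps(3,2,4) cov wa]) (simp only: v_def comp_assoc)
  qed
qed

section \<open>Divided differences in the variables y\<close>

definition ddy :: "nat \<Rightarrow> mpoly \<Rightarrow> mpoly" where
  "ddy i = dd (Y i) (Y (Suc i))"

abbreviation swap_y :: "nat \<Rightarrow> mpoly \<Rightarrow> mpoly" where
  "swap_y i \<equiv> swap (Y i) (Y (Suc i))"

lemma transpose_Y [simp]:
  "transpose (Y i) (Y (Suc i)) (Y j) = Y (adj i j)"
  "transpose (Y i) (Y (Suc i)) (X j) = X j"
  "transpose (Y i) (Y (Suc i)) (Z j) = Z j"
  by (auto simp: adj_def transpose_def)

lemma swap_y_diagram_prod:
  assumes "1 \<le> i" "\<And>a. c a < i \<or> Suc i \<le> c a"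
  shows "swap_y i (diagram_prod N c) = diagram_prod N c"
proof -
  have "(\<Prod>b\<in>{1..c a}. Var (X a) - Var (Y (adj i b))) = (\<Prod>b\<in>{1..c a}. Var (X a) - Var (Y b))" for a
  proof (cases "c a < i")
    case True
    then show ?thesis by (intro prod.cong) auto
  next
    case False
    then have "i < c a" using assms(2)[of a] by simp
    then show ?thesis
      using assms(1) by (intro prod.reindex_bij_betw[where h = "adj i"] permutes_imp_bij adj_permutes)
  qed
  then show ?thesis by (simp add: diagram_prod_def)
qed

lemma ddy_schub_top:
  assumes "1 \<le> i" "i < N"
  shows "ddy i (schub_top N) = - divdiff (N - i) (schub_top N)"
proof -
  define r where "r = N - i"
  define c where "c = (\<lambda>a. N - a)(r := N - Suc r)"
  define M where "M = diagram_prod N c"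
  have r: "1 \<le> r" "r < N" "Suc (c r) = i" "c r = c (Suc r)" using assms by (auto simp: r_def c_def)
  have "c(r := Suc (c r)) = (\<lambda>a. N - a)" using r by (auto simp: c_def r_def)
  then have div: "divdiff r (schub_top N) = M"
    using divdiff_diagram_prod[OF r(1,2,4)] by (simp add: M_def schub_top_conv)
  have "schub_top N = (Var (X r) - Var (Y i)) * M"
  proof -
    have rN: "r \<in> {1..N}" "finite {1..N}" using r by auto
    have "N - r = i" using assms by (simp add: r_def)
    then show ?thesis
      unfolding schub_top_conv M_def diagram_prod_def prod.remove[OF rN(2,1)]
      using r(3)[symmetric] by (simp add: c_def mult.commute mult.left_commute)
  qed
  moreover have "swap_y i M = M"
    unfolding M_def using assms by (intro swap_y_diagram_prod) (auto simp: c_def r_def)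
  ultimately have "ddy i (schub_top N) = - M"
    by (simp add: ddy_def dd_mult dd_diff dd_Var dd_swap)
  then show ?thesis using div by (simp add: r_def)
qed

text \<open>
  Left multiplication of the index permutation corresponds to divided differences in the
  variables y, which commute with those in the variables x.
\<close>

lemma ddy_schub:
  assumes "u \<in> S_inf" "1 \<le> i" "u \<alpha> = i" "u \<beta> = Suc i"
  shows "ddy i (schub u) = (if \<beta> < \<alpha> then - schub (adj i \<circ> u) else 0)"
proof -
  obtain N where N: "u permutes {1..N}" "Suc i \<le> N" using S_inf_permutes[OF assms(1)] .
  show ?thesis
    using N(1) assms(3,4)
  proof (induction arbitrary: \<alpha> \<beta> rule: ascent_induct)
    case top
    have S: "rev_perm N \<in> S_inf" using rev_perm_permutes by (rule S_infI)
    have ab: "\<alpha> = Suc N - i" "\<beta> = N - i"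
    proof -
      have "rev_perm N (Suc N - i) = i" "rev_perm N (N - i) = Suc i"
        using N assms(2) by (auto simp: rev_perm_def)
      then show "\<alpha> = Suc N - i" "\<beta> = N - i" using top S_inf_eq_iff[OF S] by metis+
    qed
    have "rev_perm N (Suc (N - i)) < rev_perm N (N - i)" using N assms(2) by (auto simp: rev_perm_def)
    then have "divdiff (N - i) (schub_top N) = schub (rev_perm N \<circ> adj (N - i))"
      using divdiff_schub[OF S, of "N - i"] N by (simp add: schub_rev_perm)
    also have "rev_perm N \<circ> adj (N - i) = adj i \<circ> rev_perm N"
    proof -
      have "adj i \<circ> rev_perm N = rev_perm N \<circ> transpose \<alpha> \<beta>"
        using adj_comp_conv_transpose[OF S top] .
      also have "transpose \<alpha> \<beta> = adj (N - i)"
        using ab N by (simp add: adj_def transpose_commute Suc_diff_le)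
      finally show ?thesis ..
    qed
    finally have A: "divdiff (N - i) (schub_top N) = schub (adj i \<circ> rev_perm N)" .
    have "i < N" using N by simp
    then have "ddy i (schub_top N) = - schub (adj i \<circ> rev_perm N)"
      by (simp only: ddy_schub_top[OF assms(2)] A)
    moreover have "\<beta> < \<alpha>" using ab N by simp
    ultimately show "ddy i (schub (rev_perm N)) = (if \<beta> < \<alpha> then - schub (adj i \<circ> rev_perm N) else 0)"
      by (simp only: schub_rev_perm if_True)
  next
    case (step u)
    have S: "u \<in> S_inf" using step(1) by (rule S_infI)
    obtain j where j: "1 \<le> j" "j < N" "u j < u (Suc j)" using ex_ascent[OF step.hyps] .
    define v where "v = u \<circ> adj j"
    have v: "v permutes {1..N}" "v \<in> S_inf" "perm_length u < perm_length v"
      unfolding v_def using step(1) j S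
      by (auto intro!: permutes_comp_adj S_inf_comp S_inf_adj simp: perm_length_ascent simp del: comp_apply)
    have IH: "ddy i (schub v) = (if adj j \<beta> < adj j \<alpha> then - schub (adj i \<circ> v) else 0)"
      by (rule step.IH[OF v(1,3)]) (use step.prems in \<open>simp_all add: v_def\<close>)
    have "v (Suc j) < v j" using j by (simp add: v_def)
    then have "schub u = divdiff j (schub v)"
      using divdiff_schub[OF v(2) j(1)] by (simp add: v_def)
    then have comm: "ddy i (schub u) = divdiff j (ddy i (schub v))"
      by (simp add: divdiff_conv_dd ddy_def dd_commute)
    have pos: "u c = i \<longleftrightarrow> c = \<alpha>" "u c = Suc i \<longleftrightarrow> c = \<beta>" for c
      using step.prems S_inf_eq_iff[OF S] by metis+
    have ne: "\<alpha> \<noteq> \<beta>" using step.prems by auto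
    show "ddy i (schub u) = (if \<beta> < \<alpha> then - schub (adj i \<circ> u) else 0)"
    proof (cases "adj j \<beta> < adj j \<alpha>")
      case False
      have "\<not> \<beta> < \<alpha>"
      proof
        assume "\<beta> < \<alpha>"
        then have "\<beta> = j" "\<alpha> = Suc j" using False unfolding adj_less_iff by auto
        then show False using j step.prems by simp
      qed
      then show ?thesis using False comm IH by simp
    next
      case True
      have iv: "adj i \<circ> v \<in> S_inf" using v assms(2) by (intro S_inf_comp S_inf_adj)
      have "ddy i (schub u) = - divdiff j (schub (adj i \<circ> v))"
        using comm IH True by (simp add: divdiff_conv_dd dd_uminus)
      also have "divdiff j (schub (adj i \<circ> v)) = (if (adj i \<circ> v) (Suc j) < (adj i \<circ> v) j then schub (adj i \<circ> v \<circ> adj j) else 0)"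
        using divdiff_schub[OF iv j(1)] .
      also have "adj i \<circ> v \<circ> adj j = adj i \<circ> u" by (simp add: v_def comp_assoc)
      also have "(adj i \<circ> v) (Suc j) < (adj i \<circ> v) j \<longleftrightarrow> \<beta> < \<alpha>"
      proof -
        have "(adj i \<circ> v) (Suc j) < (adj i \<circ> v) j \<longleftrightarrow> adj i (u j) < adj i (u (Suc j))"
          by (simp add: v_def)
        also have "\<dots> \<longleftrightarrow> \<not> (\<alpha> = j \<and> \<beta> = Suc j)"
          unfolding adj_less_iff using j pos(1)[of j] pos(2)[of "Suc j"] by auto
        also have "\<dots> \<longleftrightarrow> \<beta> < \<alpha>"
          using True ne unfolding adj_less_iff by auto
        finally show ?thesis .
      qed
      finally show ?thesis by simp
    qed
  qed
qed

section \<open>The Pieri formula\<close>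

lemma finite_fixed_values [simp]: "finite (fixed_values k u w)"
proof -
  have "fixed_values k u w \<subseteq> u ` {1..k}" by (auto simp: fixed_values_def)
  then show ?thesis by (rule finite_subset) simp
qed

lemma mem_fixed_values:
  assumes "u \<in> S_inf" shows "u a \<in> fixed_values k u w \<longleftrightarrow> 1 \<le> a \<and> a \<le> k \<and> w a = u a"
  using S_inf_eq_iff[OF assms] by (auto simp: fixed_values_def)

lemma swap_y_weight: "swap_y i (weight k u w j) = weight k (adj i \<circ> u) (adj i \<circ> w) j"
proof -
  have "fixed_values k (adj i \<circ> u) (adj i \<circ> w) = adj i ` fixed_values k u w"
    by (auto simp: fixed_values_def)
  moreover have "inj_on (adj i) A" for A by (auto intro: inj_onI)
  ultimately show ?thesis by (simp add: weight_def prod.reindex)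
qed

lemma swap_y_weight_sym:
  assumes "i \<in> fixed_values k u w \<longleftrightarrow> Suc i \<in> fixed_values k u w"
  shows "swap_y i (weight k u w j) = weight k u w j"
proof -
  let ?P = "fixed_values k u w"
  have closed: "p \<in> ?P \<Longrightarrow> adj i p \<in> ?P" for p
    using assms by (cases "p = i \<or> p = Suc i") auto
  have "bij_betw (adj i) ?P ?P"
    by (rule bij_betwI[where g = "adj i"]) (use closed in auto)
  then show ?thesis
    unfolding weight_def by (simp add: prod.reindex_bij_betw[where g = "\<lambda>p. Var (Y p) - Var (Z j)"])
qed

lemma weight_remove:
  assumes "p \<in> fixed_values k u w" "fixed_values k u' w' = fixed_values k u w - {p}"
  shows "weight k u w j = (Var (Y p) - Var (Z j)) * weight k u' w' j"
  unfolding weight_def using assms by (simp add: prod.remove)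

definition pieri_coeff :: "nat \<Rightarrow> nat \<Rightarrow> (nat \<Rightarrow> nat) \<Rightarrow> (nat \<Rightarrow> nat) \<Rightarrow> mpoly" where
  "pieri_coeff k j u w = (if noncrossing k u w then weight k u w j else 0)"

lemma pieri_coeff_adj:
  assumes u: "u \<in> S_inf" and w: "w \<in> S_inf" and i: "1 \<le> i"
    and uv: "u \<alpha> = i" "u \<beta> = Suc i" "\<alpha> < \<beta>" and wv: "w \<gamma> = i" "w \<delta> = Suc i"
  shows "pieri_coeff k j u w = - ddy i (pieri_coeff k j (adj i \<circ> u) w)
    + (if \<gamma> < \<delta> then swap_y i (pieri_coeff k j (adj i \<circ> u) (adj i \<circ> w)) else 0)"
proof -
  define U where "U = adj i \<circ> u"
  have U: "U \<in> S_inf" "U \<alpha> = Suc i" "U \<beta> = i" "adj i \<circ> U = u"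
    using u i uv by (simp_all add: U_def S_inf_comp S_inf_adj)
  define W where "W = adj i \<circ> w"
  have W: "W \<in> S_inf" "W \<gamma> = Suc i" "W \<delta> = i" "adj i \<circ> W = w"
    using w i wv by (simp_all add: W_def S_inf_comp S_inf_adj)
  have \<alpha>1: "1 \<le> \<alpha>" using S_inf_0[OF u] uv(1) i by (cases "\<alpha> = 0") auto
  have \<beta>1: "1 \<le> \<beta>" using uv(3) by simp
  have sw: "swap_y i (weight k U W j) = weight k u w j"
    using swap_y_weight[of i k U W j] U W by simp
  define I where "I \<longleftrightarrow> \<alpha> \<le> k \<and> w \<alpha> = Suc i"
  define J where "J \<longleftrightarrow> \<beta> \<le> k \<and> w \<beta> = i"
  have memU: "Suc i \<in> fixed_values k U w \<longleftrightarrow> I" "i \<in> fixed_values k U w \<longleftrightarrow> J"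
    using mem_fixed_values[OF U(1), of \<alpha> k w] mem_fixed_values[OF U(1), of \<beta> k w] U \<alpha>1 \<beta>1
    by (auto simp: I_def J_def)
  have fixed: "fixed_values k u w = fixed_values k U w - {i, Suc i}" if "I \<or> J"
  proof -
    have w\<alpha>\<beta>: "w \<alpha> \<noteq> i \<and> w \<beta> \<noteq> Suc i"
      using that uv(3) S_inf_eq_iff[OF w, of \<alpha> \<beta>] unfolding I_def J_def by force
    have uU: "u c = U c" if "c \<noteq> \<alpha>" "c \<noteq> \<beta>" for c
    proof -
      have "u c \<noteq> i" "u c \<noteq> Suc i" using that uv S_inf_eq_iff[OF u] by metis+
      then show ?thesis by (simp add: U_def)
    qed
    have U_iff: "U c = i \<longleftrightarrow> c = \<beta>" "U c = Suc i \<longleftrightarrow> c = \<alpha>" for c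
      using U(2,3) S_inf_eq_iff[OF U(1)] by metis+
    show ?thesis
    proof (intro equalityI subsetI)
      fix x assume "x \<in> fixed_values k u w"
      then obtain c where c: "x = u c" "1 \<le> c" "c \<le> k" "u c = w c" unfolding fixed_values_def by blast
      then have "c \<noteq> \<alpha>" "c \<noteq> \<beta>" using w\<alpha>\<beta> uv by metis+
      then show "x \<in> fixed_values k U w - {i, Suc i}"
        using c uU[of c] U_iff[of c] unfolding fixed_values_def by (metis (mono_tags, lifting) DiffI mem_Collect_eq empty_iff insert_iff)
    next
      fix x assume "x \<in> fixed_values k U w - {i, Suc i}"
      then obtain c where c: "x = U c" "1 \<le> c" "c \<le> k" "U c = w c" "U c \<noteq> i" "U c \<noteq> Suc i"
        unfolding fixed_values_def by blast
      then show "x \<in> fixed_values k u w"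
        using uU[of c] U_iff[of c] unfolding fixed_values_def by (metis (mono_tags, lifting) mem_Collect_eq)
    qed
  qed
  have symu: "swap_y i (weight k u w j) = weight k u w j" if "I \<or> J"
    using fixed[OF that] by (intro swap_y_weight_sym) auto
  have d0: "ddy i (weight k U w j) = 0" if "I \<longleftrightarrow> J"
    using that swap_y_weight_sym[of i k U w j] memU by (simp add: ddy_def dd_swap)
  consider "I" "\<not> J" | "I" "J" | "\<not> I" "J" | "\<not> I" "\<not> J" by blast
  then have "pieri_coeff k j u w = - ddy i (pieri_coeff k j U w)
    + (if \<gamma> < \<delta> then swap_y i (pieri_coeff k j U W) else 0)"
  proof cases
    case 1
    have "weight k U w j = (Var (Y (Suc i)) - Var (Z j)) * weight k u w j"
      using memU 1 fixed by (intro weight_remove) auto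
    then have "- ddy i (weight k U w j) = weight k u w j"
      using symu 1 by (simp add: ddy_def dd_mult dd_diff dd_Var dd_swap)
    moreover have "noncrossing k u w \<longleftrightarrow> noncrossing k U w"
    proof
      show "noncrossing k U w" if "noncrossing k u w"
        using noncrossing_raise[OF that i uv] 1 by (simp only: U_def I_def)
      show "noncrossing k u w" if "noncrossing k U w"
      proof -
        have "noncrossing k (adj i \<circ> U) w"
          by (rule noncrossing_lower[OF that i U(2,3) uv(3)]) (use 1 in \<open>auto simp: I_def J_def\<close>)
        then show ?thesis by (simp only: U(4))
      qed
    qed
    moreover have "\<not> noncrossing k U W"
      using noncrossing_up[of k U W \<alpha>] U 1 by (auto simp: I_def W_def)
    ultimately show ?thesis by (simp add: pieri_coeff_def ddy_def)
  next
    case 2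
    then have "\<gamma> = \<beta>" "\<delta> = \<alpha>" using wv S_inf_eq_iff[OF w] unfolding I_def J_def by metis+
    moreover have "\<not> noncrossing k u w"
      using noncrossing_up[of k u w \<beta>] uv 2 by (auto simp: J_def)
    ultimately show ?thesis using uv d0 2 by (simp add: pieri_coeff_def ddy_def)
  next
    case 3
    have "weight k U w j = (Var (Y i) - Var (Z j)) * weight k u w j"
      using memU 3 fixed by (intro weight_remove) auto
    then have "ddy i (weight k U w j) = weight k u w j"
      using symu 3 by (simp add: ddy_def dd_mult dd_diff dd_Var dd_swap)
    moreover have \<gamma>: "\<gamma> = \<beta>" using 3 wv S_inf_eq_iff[OF w] unfolding J_def by metis
    moreover have "noncrossing k U w \<longleftrightarrow> \<gamma> < \<delta> \<and> noncrossing k U W"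
    proof
      assume "noncrossing k U w"
      then show "\<gamma> < \<delta> \<and> noncrossing k U W"
        using noncrossing_fixed_value[of k U w i \<alpha> \<beta> \<delta>] i U uv wv 3 \<gamma> by (simp add: I_def J_def W_def)
    next
      assume "\<gamma> < \<delta> \<and> noncrossing k U W"
      then show "noncrossing k U w"
        using noncrossing_fixed_value_converse[of k U W i \<alpha> \<beta> \<delta>] i U W uv 3 \<gamma> by (simp add: J_def)
    qed
    moreover have "\<not> noncrossing k u w"
      using noncrossing_up[of k u w \<beta>] uv 3 by (auto simp: J_def)
    ultimately show ?thesis using sw by (simp add: pieri_coeff_def ddy_def)
  next
    case 4
    have "noncrossing k u w \<longleftrightarrow> \<gamma> < \<delta> \<and> noncrossing k U W"
    proof
      assume "noncrossing k u w"
      then show "\<gamma> < \<delta> \<and> noncrossing k U W"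
        using noncrossing_adj_if[of k u w i \<alpha> \<beta> \<gamma> \<delta>] i uv wv 4 unfolding U_def W_def I_def by blast
    next
      assume "\<gamma> < \<delta> \<and> noncrossing k U W"
      moreover have "\<not> (\<beta> \<le> k \<and> W \<beta> = Suc i)"
        using 4 W(2) wv S_inf_eq_iff[OF W(1), of \<beta> \<gamma>] by (auto simp: J_def)
      ultimately have "noncrossing k (adj i \<circ> U) (adj i \<circ> W)"
        using noncrossing_adj_only_if[of k U W i \<alpha> \<beta> \<gamma> \<delta>] i U W uv by blast
      then show "noncrossing k u w" by (simp only: U W)
    qed
    then show ?thesis using d0 4 sw by (simp add: pieri_coeff_def ddy_def)
  qed
  then show ?thesis by (simp only: U_def W_def)
qed

definition linear_prod :: "nat \<Rightarrow> nat \<Rightarrow> mpoly" where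
  "linear_prod k j = (\<Prod>a\<in>{1..k}. Var (X a) - Var (Z j))"

lemma pieri_step:
  assumes u: "u permutes {1..N}" and k: "k \<le> N" and i: "1 \<le> i" "i < N"
    and uv: "u \<alpha> = i" "u \<beta> = Suc i" "\<alpha> < \<beta>"
    and IH: "linear_prod k j * schub (adj i \<circ> u)
      = (\<Sum>w\<in>{w. w permutes {1..Suc N}}. pieri_coeff k j (adj i \<circ> u) w * schub w)"
  shows "linear_prod k j * schub u = (\<Sum>w\<in>{w. w permutes {1..Suc N}}. pieri_coeff k j u w * schub w)"
proof -
  define U where "U = adj i \<circ> u"
  have S: "u \<in> S_inf" "U \<in> S_inf"
    using S_infI[OF u] i by (simp_all add: U_def S_inf_comp S_inf_adj)
  let ?W = "{w. w permutes {1..Suc N}}"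
  have U: "U \<beta> = i" "U \<alpha> = Suc i" "adj i \<circ> U = u"
    using uv by (simp_all add: U_def)
  have sym: "swap_y i (linear_prod k j) = linear_prod k j"
    by (simp add: linear_prod_def)
  have "linear_prod k j * schub u = - ddy i (linear_prod k j * schub U)"
    using ddy_schub[OF S(2) i(1) U(1,2)] uv(3) U(3) sym by (simp add: ddy_def dd_mult_sym)
  also have "linear_prod k j * schub U = (\<Sum>w\<in>?W. pieri_coeff k j U w * schub w)"
    using IH by (simp only: U_def)
  also have "- ddy i \<dots> = (\<Sum>w\<in>?W. - ddy i (pieri_coeff k j U w) * schub w)
      + (\<Sum>w\<in>?W. swap_y i (pieri_coeff k j U w) * - ddy i (schub w))"
    by (simp add: ddy_def dd_sum dd_mult sum.distrib sum_negf)
  also have "(\<Sum>w\<in>?W. swap_y i (pieri_coeff k j U w) * - ddy i (schub w))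
      = (\<Sum>w\<in>?W. swap_y i (pieri_coeff k j U (adj i \<circ> w)) * - ddy i (schub (adj i \<circ> w)))"
  proof (rule sum.reindex_bij_witness[where i = "\<lambda>w. adj i \<circ> w" and j = "\<lambda>w. adj i \<circ> w"])
    have "adj i permutes {1..Suc N}" using i by (intro adj_permutes) auto
    then show "adj i \<circ> w \<in> ?W" "adj i \<circ> w \<in> ?W" if "w \<in> ?W" for w
      using that by (auto intro: permutes_compose simp del: comp_apply)
  qed simp_all
  also have "(\<Sum>w\<in>?W. - ddy i (pieri_coeff k j U w) * schub w) + \<dots>
      = (\<Sum>w\<in>?W. pieri_coeff k j u w * schub w)"
    unfolding sum.distrib[symmetric]
  proof (rule sum.cong[OF refl])
    fix w assume "w \<in> ?W"
    then have w: "w \<in> S_inf" by (auto intro: S_infI)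
    obtain \<gamma> \<delta> where wv: "w \<gamma> = i" "w \<delta> = Suc i" using S_inf_bij[OF w] by (metis bij_pointE)
    define V where "V = adj i \<circ> w"
    have V: "V \<in> S_inf" "V \<delta> = i" "V \<gamma> = Suc i" "adj i \<circ> V = w"
      using w i wv by (simp_all add: V_def S_inf_comp S_inf_adj)
    have "- ddy i (schub V) = (if \<gamma> < \<delta> then schub w else 0)"
      using ddy_schub[OF V(1) i(1) V(2,3)] V(4) by simp
    then show "- ddy i (pieri_coeff k j U w) * schub w +
        swap_y i (pieri_coeff k j U (adj i \<circ> w)) * - ddy i (schub (adj i \<circ> w)) =
        pieri_coeff k j u w * schub w"
      using pieri_coeff_adj[OF S(1) w i(1) uv wv, of k j]
      unfolding V_def U_def by (simp add: distrib_right left_diff_distrib)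
  qed
  finally show ?thesis .
qed

definition prev_in :: "nat set \<Rightarrow> nat \<Rightarrow> nat" where
  "prev_in D i = Max (insert 0 {c \<in> D. c < i})"

text \<open>
  The permutation obtained from \<open>rev_perm N\<close> by multiplying it by the transpositions of \<open>a\<close> and
  \<open>N + 1\<close>, for \<open>a \<in> D\<close> in increasing order.
\<close>

definition shifted_rev :: "nat \<Rightarrow> nat set \<Rightarrow> nat \<Rightarrow> nat" where
  "shifted_rev N D i = (if i \<in> D \<or> i = Suc N then Suc N - prev_in D i else rev_perm N i)"

lemma prev_in_le: "finite D \<Longrightarrow> c \<in> D \<Longrightarrow> c < i \<Longrightarrow> c \<le> prev_in D i"
  unfolding prev_in_def by (intro Max_ge) auto

lemma prev_in_mem: "finite D \<Longrightarrow> prev_in D i = 0 \<or> prev_in D i \<in> D \<and> prev_in D i < i"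
  using Max_in[of "insert 0 {c \<in> D. c < i}"] unfolding prev_in_def by auto

lemma prev_in_eqI:
  assumes "finite D" "q = 0 \<or> q \<in> D \<and> q < i" "\<And>c. c \<in> D \<Longrightarrow> c < i \<Longrightarrow> c \<le> q"
  shows "prev_in D i = q"
  unfolding prev_in_def by (rule Max_eqI) (use assms in auto)

lemma shifted_rev_schub:
  assumes "D \<subseteq> {1..N}"
  shows "shifted_rev N D permutes {1..Suc N} \<and>
    schub (shifted_rev N D) = diagram_prod (Suc N) (\<lambda>i. N - i + (if i \<in> D then 1 else 0))"
  using assms
proof (induction "card ({1..N} - D)" arbitrary: D rule: less_induct)
  case less
  have finD: "finite D" using less.prems finite_subset by blast
  show ?case
  proof (cases "D = {1..N}")
    case True
    have "prev_in D i = i - 1" if "1 \<le> i" "i \<le> Suc N" for i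
      using that True by (intro prev_in_eqI) auto
    then have eq: "shifted_rev N D = rev_perm (Suc N)"
      using True by (auto simp: shifted_rev_def rev_perm_def fun_eq_iff)
    have "diagram_prod (Suc N) (\<lambda>i. N - i + (if i \<in> D then 1 else 0)) = schub_top (Suc N)"
      unfolding schub_top_conv by (rule diagram_prod_cong) (use True in auto)
    then show ?thesis
      unfolding eq using rev_perm_permutes schub_rev_perm by simp
  next
    case False
    define m where "m = Max ({1..N} - D)"
    have m: "m \<in> {1..N}" "m \<notin> D" and after: "\<And>c. m < c \<Longrightarrow> c \<le> N \<Longrightarrow> c \<in> D"
    proof -
      have "{1..N} - D \<noteq> {}" using False less.prems by blast
      then show "m \<in> {1..N}" "m \<notin> D" unfolding m_def using Max_in[of "{1..N} - D"] by auto
      show "c \<in> D" if "m < c" "c \<le> N" for c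
      proof (rule ccontr)
        assume "c \<notin> D"
        then have "c \<le> m" unfolding m_def using that by (intro Max_ge) auto
        then show False using that by simp
      qed
    qed
    define D' where "D' = insert m D"
    have "D' \<subseteq> {1..N}" using m less.prems by (auto simp: D'_def)
    moreover have "{1..N} - D' \<subset> {1..N} - D"
    proof (rule psubsetI)
      show "{1..N} - D' \<subseteq> {1..N} - D" by (auto simp: D'_def)
      have "m \<in> {1..N} - D" "m \<notin> {1..N} - D'" using m by (simp_all add: D'_def)
      then show "{1..N} - D' \<noteq> {1..N} - D" by blast
    qed
    then have "card ({1..N} - D') < card ({1..N} - D)" by (intro psubset_card_mono) auto
    ultimately have IH: "shifted_rev N D' permutes {1..Suc N}"
      "schub (shifted_rev N D') = diagram_prod (Suc N) (\<lambda>i. N - i + (if i \<in> D' then 1 else 0))"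
      using less.hyps by blast+
    have finD': "finite D'" using finD by (simp add: D'_def)
    define p where "p = prev_in D m"
    have p: "p < m" using prev_in_mem[OF finD, of m] m by (auto simp: p_def)
    have p1: "prev_in D' m = p" unfolding p_def prev_in_def D'_def
      by (rule arg_cong[of _ _ Max]) auto
    have p2: "prev_in D' (Suc m) = m"
      using finD' by (intro prev_in_eqI) (auto simp: D'_def)
    have p3: "prev_in D (Suc m) = p" unfolding p_def prev_in_def
      by (rule arg_cong[of _ _ Max]) (use m in \<open>auto simp: less_Suc_eq\<close>)
    have p4: "prev_in D c = prev_in D' c" if "c \<noteq> m" "c \<noteq> Suc m" "c \<le> Suc N" for c
    proof (cases "c < m")
      case True
      then show ?thesis unfolding prev_in_def D'_def by (intro arg_cong[of _ _ Max]) auto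
    next
      case False
      then have mc: "Suc m < c" using that by simp
      then have "Suc m \<in> D" using after[of "Suc m"] that by simp
      then have ge: "Suc m \<le> prev_in D' c"
        using prev_in_le[OF finD' _ mc] by (auto simp: D'_def)
      show ?thesis
      proof (rule prev_in_eqI[OF finD])
        show "prev_in D' c = 0 \<or> prev_in D' c \<in> D \<and> prev_in D' c < c"
          using prev_in_mem[OF finD', of c] ge by (auto simp: D'_def)
        show "e \<le> prev_in D' c" if "e \<in> D" "e < c" for e
          using prev_in_le[OF finD', of e c] that by (simp add: D'_def)
      qed
    qed
    have mem: "Suc m \<in> D \<or> Suc m = Suc N" using after[of "Suc m"] m by auto
    have eq: "shifted_rev N D = shifted_rev N D' \<circ> adj m"
    proof
      fix c
      consider "c = m" | "c = Suc m" | "c \<noteq> m" "c \<noteq> Suc m" by blast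
      then show "shifted_rev N D c = (shifted_rev N D' \<circ> adj m) c"
      proof cases
        case 1
        then show ?thesis using m mem p2 by (auto simp: shifted_rev_def D'_def rev_perm_def)
      next
        case 2
        then show ?thesis using mem p1 p3 by (auto simp: shifted_rev_def D'_def)
      next
        case 3
        then have "c \<in> D \<longleftrightarrow> c \<in> D'" by (simp add: D'_def)
        moreover have "prev_in D c = prev_in D' c" if "c \<in> D' \<or> c = Suc N"
          using p4[OF 3] that \<open>D' \<subseteq> {1..N}\<close> by auto
        ultimately show ?thesis using 3 by (auto simp: shifted_rev_def)
      qed
    qed
    have S': "shifted_rev N D' \<in> S_inf" using IH(1) by (rule S_infI)
    have "shifted_rev N D' (Suc m) < shifted_rev N D' m"
      using mem p1 p2 p m by (auto simp: shifted_rev_def D'_def)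
    then have "divdiff m (schub (shifted_rev N D')) = schub (shifted_rev N D)"
      unfolding eq using divdiff_schub[OF S', of m] m by simp
    moreover have "divdiff m (schub (shifted_rev N D')) = diagram_prod (Suc N) (\<lambda>i. N - i + (if i \<in> D then 1 else 0))"
    proof -
      define c where "c = (\<lambda>i. N - i + (if i \<in> D then 1 else 0 :: nat))"
      have "c m = c (Suc m)" using m after[of "Suc m"] less.prems by (cases "m = N") (auto simp: c_def)
      moreover have "(\<lambda>i. N - i + (if i \<in> D' then 1 else 0)) = c(m := Suc (c m))"
        using m by (auto simp: c_def D'_def fun_eq_iff)
      ultimately show ?thesis
        unfolding IH(2) using divdiff_diagram_prod[of m "Suc N" c] m by (simp add: c_def)
    qed
    moreover have "shifted_rev N D permutes {1..Suc N}"
      unfolding eq using IH(1) m by (intro permutes_comp_adj) auto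
    ultimately show ?thesis by simp
  qed
qed

lemma noncrossing_shifted_rev:
  assumes D: "D \<subseteq> {1..k}" and k: "k \<le> N"
  shows "noncrossing k (rev_perm N) (shifted_rev N D)"
proof -
  have finD: "finite D" using D finite_subset by blast
  define w where "w = shifted_rev N D"
  define r where "r = rev_perm N"
  have wS: "w \<in> S_inf"
  proof -
    have "D \<subseteq> {1..N}" using D k by auto
    then show ?thesis unfolding w_def using shifted_rev_schub by (blast intro: S_infI)
  qed
  have rS: "r \<in> S_inf" unfolding r_def using rev_perm_permutes by (rule S_infI)
  have r: "r c = Suc N - c" if "1 \<le> c" "c \<le> N" for c using that by (simp add: r_def rev_perm_def)
  have r': "r c = c" if "c = 0 \<or> N < c" for c using that by (auto simp: r_def rev_perm_def)
  have wD: "w c = Suc N - prev_in D c" if "c \<in> D \<or> c = Suc N" for c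
    using that by (simp add: w_def shifted_rev_def)
  have w': "w c = r c" if "c \<notin> D" "c \<noteq> Suc N" for c
    using that by (simp add: w_def r_def shifted_rev_def)
  have Dk: "1 \<le> c \<and> c \<le> k" if "c \<in> D" for c using that D by auto
  have between: "w c = r c \<and> c \<notin> D \<and> 1 \<le> c \<and> c < a"
    if a: "a \<in> D \<or> a = Suc N" and c: "r a < r c \<and> r c < w a \<or> r a < w c \<and> w c < w a" "c \<le> N" and aN: "a \<le> N" for a c
  proof -
    have c1: "1 \<le> c"
    proof (rule ccontr)
      assume "\<not> 1 \<le> c"
      then have "c = 0" by simp
      then have "r c = 0" "w c = 0" using r' S_inf_0[OF wS] by auto
      then show False using c by simp
    qed
    have aD: "a \<in> D" using a aN by auto
    note a = prev_in_mem[OF finD, of a] wD[of a] r[of a] Dk[of a]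
    have "c \<notin> D"
    proof
      assume cD: "c \<in> D"
      have nab: "\<not> (prev_in D a < e \<and> e < a)" if "e \<in> D" for e
        using prev_in_le[OF finD that, of a] by auto
      show False
        using c(1)
      proof
        assume "r a < r c \<and> r c < w a"
        then have "prev_in D a < c \<and> c < a" using a aD r[OF c1 c(2)] c1 c(2) aN k by auto
        then show False using nab cD by blast
      next
        assume "r a < w c \<and> w c < w a"
        then have "prev_in D a < prev_in D c \<and> prev_in D c < a"
          using a aD wD[of c] cD k aN by auto
        then show False using nab[of "prev_in D c"] prev_in_mem[OF finD, of c] by auto
      qed
    qed
    then show ?thesis using w'[of c] c c1 r[OF c1 c(2)] a aD aN k by auto
  qed
  have fixhigh: "w c = r c" if "k < c" "c \<noteq> Suc N" for c
    using w'[of c] that Dk[of c] by auto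
  have below: "Suc N - w (Suc N) \<in> D \<or> w (Suc N) = Suc N"
    using wD[of "Suc N"] prev_in_mem[OF finD, of "Suc N"] by auto
  have wle: "w c \<le> Suc N" if "c \<le> Suc N" for c
    using that wD[of c] w'[of c] r[of c] r'[of c] by (cases "c \<in> D \<or> c = Suc N"; cases "c = 0"; force)
  have "noncrossing k r w"
  proof
    show "r \<in> S_inf" "w \<in> S_inf" by fact+
  next
    fix a assume "a \<le> k"
    then show "r a \<le> w a"
      using wD[of a] w'[of a] prev_in_mem[OF finD, of a] r[of a] Dk[of a] k
      by (cases "a \<in> D") auto
  next
    fix b assume "k < b"
    then show "w b \<le> r b"
      using fixhigh[of b] wle[of b] r'[of b] by (cases "b = Suc N") auto
  next
    fix a c assume ac: "a \<le> k" "c \<le> k" "r a < r c \<and> r c < w a \<or> r a < w c \<and> w c < w a"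
    then have "a \<in> D" using w'[of a] k by (cases "a \<in> D") auto
    then show "r a < r c \<and> r c < w a \<and> r a < w c \<and> w c < w a \<and> c < a"
      using between[of a c] ac k by auto
  next
    fix a b assume ab: "a \<le> k" "k < b"
    show "r a < r b \<and> r b < w a \<longleftrightarrow> r a < w b \<and> w b < w a"
    proof (cases "b = Suc N")
      case False
      then show ?thesis using fixhigh[of b] ab by simp
    next
      case True
      have "\<not> (r a < w b \<and> w b < w a)"
      proof
        assume *: "r a < w b \<and> w b < w a"
        then have aD: "a \<in> D" using w'[of a] ab k by (cases "a \<in> D") auto
        have "w b \<noteq> Suc N" using * wle[of a] ab k by auto
        then have q: "Suc N - w b \<in> D" using below True by simp
        define q where "q = Suc N - w b"
        have "prev_in D a < q \<and> q < a"
          using * wD[of a] aD r[of a] Dk[of a] k prev_in_mem[OF finD, of a] wle[of b] True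
          unfolding q_def by auto
        then show False using prev_in_le[OF finD q[folded q_def], of a] by auto
      qed
      moreover have "\<not> r b < w a" using True r'[of b] wle[of a] ab k by auto
      ultimately show ?thesis by blast
    qed
  next
    fix b c assume bc: "k < b" "k < c" "w b < r c \<and> r c < r b \<or> w b < w c \<and> w c < r b"
    have b: "b = Suc N" using bc fixhigh[of b] by (cases "b = Suc N") auto
    then have cb: "c \<noteq> b" using bc(3) by auto
    then have wc: "w c = r c" using fixhigh[of c] bc b by auto
    have cN: "c \<le> N" using bc(3) wc b r'[of b] r'[of c] cb by (cases "N < c") auto
    have "w b \<noteq> Suc N" using bc(3) b r'[of b] by auto
    then have "Suc N - w b \<in> D" using below b by simp
    then have "Suc N - w b \<le> k" using Dk by blast
    then show "w b < r c \<and> r c < r b \<and> w b < w c \<and> w c < r b \<and> b < c"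
      using bc wc r[of c] cN wle[of b] b by auto
  next
    fix b c assume bc: "k < b" "k < c" "w b = r c"
    show "b = c"
    proof (cases "b = Suc N")
      case False
      then show ?thesis using fixhigh[of b] bc S_inf_eq_iff[OF rS] by simp
    next
      case True
      show ?thesis
      proof (rule ccontr)
        assume ne: "b \<noteq> c"
        have cN: "c \<le> N" using bc(3) r'[of c] wle[of b] True ne by (cases "N < c") auto
        then have "w b = Suc N - c" using r[of c] bc by simp
        then have "c \<in> D" using below True bc cN by auto
        then show False using Dk[of c] bc by simp
      qed
    qed
  qed
  then show ?thesis by (simp only: r_def w_def)
qed

lemma noncrossing_rev_perm_imp:
  assumes nc: "noncrossing k (rev_perm N) w" and k: "k \<le> N"
  shows "w = shifted_rev N {a \<in> {1..k}. w a \<noteq> rev_perm N a}"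
proof -
  define D where "D = {a \<in> {1..k}. w a \<noteq> rev_perm N a}"
  define r where "r = rev_perm N"
  interpret noncrossing k r w using nc by (simp only: r_def)
  have D: "D \<subseteq> {1..k}" "D \<subseteq> {1..N}" using k by (auto simp: D_def)
  have finD: "finite D" using D finite_subset by blast
  have r: "r c = Suc N - c" if "1 \<le> c" "c \<le> N" for c using that by (simp add: r_def rev_perm_def)
  have r': "r c = c" if "c = 0 \<or> N < c" for c using that by (auto simp: r_def rev_perm_def)
  have wp: "w permutes {1..Suc N}" using noncrossing_permutes[OF nc rev_perm_permutes k] .
  have fixhigh: "w b = r b" if b: "k < b" "b \<noteq> Suc N" for b
  proof (cases "b \<le> N")
    case False
    then show ?thesis using permutes_not_in[OF wp, of b] r'[of b] b by simp
  next
    case True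
    obtain q where q: "r q = w b" using S_inf_bij[OF u] by (metis bij_pointE)
    show ?thesis
    proof (cases "q \<le> k")
      case False
      then show ?thesis using no_drop[of b q] q b by simp
    next
      case qk: True
      have "q \<noteq> 0" using q r'[of 0] S_inf_0[OF w] w_eq[of b 0] b by (metis less_zeroE)
      then have "r b < r q" using r[of q] r[of b] qk True b k by simp
      then show ?thesis using q down[OF b(1)] by simp
    qed
  qed
  have moved: "w a = Suc N - prev_in D a" if aD: "a \<in> D" for a
  proof -
    have a: "1 \<le> a" "a \<le> k" "w a \<noteq> r a" using aD by (auto simp: D_def r_def)
    then have lt: "r a < w a" using up[of a] by simp
    have wle: "w a \<le> Suc N" using permutes_le_iff[OF wp, of a] a k by simp
    define q where "q = Suc N - w a"
    have q: "w a = Suc N - q" "q < a" using wle lt r[of a] a k by (auto simp: q_def)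
    have "prev_in D a = q"
    proof (rule prev_in_eqI[OF finD])
      show "q = 0 \<or> q \<in> D \<and> q < a"
      proof (cases "q = 0")
        case False
        then have "r q = w a" using r[of q] q a k by simp
        then have "w q \<noteq> r q" using w_eq[of q a] q by auto
        then show ?thesis using False q a by (simp add: D_def r_def)
      qed simp
    next
      fix c assume c: "c \<in> D" "c < a"
      show "c \<le> q"
      proof (rule ccontr)
        assume "\<not> c \<le> q"
        then have cq: "q < c" by simp
        have c': "1 \<le> c" "c \<le> k" "w c \<noteq> r c" using c by (auto simp: D_def r_def)
        then have in1: "r a < r c" "r c < w a" using r[of a] r[of c] c cq a k q by auto
        then have in2: "w c < w a" using low[OF a(2) c'(2)] by simp
        have ltc: "r c < w c" using up[OF c'(2)] c'(3) by simp
        from ascend[OF c'(2) ltc in2] show False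
        proof (elim disjE exE conjE)
          fix p assume p: "k < p" "w c \<le> r p" "r p < w a" "w p \<le> r c"
          have "p = Suc N"
          proof (rule ccontr)
            assume "p \<noteq> Suc N"
            then show False using fixhigh[of p] p ltc by simp
          qed
          then show False using p wle r'[of p] by simp
        next
          fix c' assume c': "c' \<le> k" "w c \<le> r c'" "r c' < w a" "w a \<le> w c'"
          then show False using low[OF a(2) c'(1)] in1 ltc by auto
        qed
      qed
    qed
    then show ?thesis using q by simp
  qed
  have agree: "w c = shifted_rev N D c" if "c \<noteq> Suc N" for c
  proof (cases "c \<in> D")
    case True
    then show ?thesis using moved by (simp add: shifted_rev_def)
  next
    case False
    then have "w c = r c"
      using fixhigh[of c] that r'[of 0] S_inf_0[OF w] by (cases "k < c"; cases "c = 0") (auto simp: D_def r_def)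
    then show ?thesis using False that by (simp add: shifted_rev_def r_def)
  qed
  have sp: "shifted_rev N D permutes {1..Suc N}" using shifted_rev_schub D by blast
  obtain x where x: "shifted_rev N D x = w (Suc N)"
    using permutes_surj[OF sp] by (metis surjD)
  have "x = Suc N"
  proof (rule ccontr)
    assume "x \<noteq> Suc N"
    then show False using agree[of x] x w_eq by simp
  qed
  then have "w = shifted_rev N D" using agree x by (metis ext)
  then show ?thesis by (simp add: D_def)
qed

lemma fixed_values_shifted_rev:
  assumes D: "D \<subseteq> {1..k}" and k: "k \<le> N"
  shows "fixed_values k (rev_perm N) (shifted_rev N D) = rev_perm N ` ({1..k} - D)"
proof -
  have finD: "finite D" using D finite_subset by blast
  have "rev_perm N a \<noteq> shifted_rev N D a" if "a \<in> D" for a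
    using that D k prev_in_mem[OF finD, of a] by (auto simp: shifted_rev_def rev_perm_def)
  moreover have "rev_perm N a = shifted_rev N D a" if "a \<le> k" "a \<notin> D" for a
    using that k by (simp add: shifted_rev_def)
  ultimately have "{a. 1 \<le> a \<and> a \<le> k \<and> rev_perm N a = shifted_rev N D a} = {1..k} - D" by auto
  moreover have "fixed_values k (rev_perm N) (shifted_rev N D)
      = rev_perm N ` {a. 1 \<le> a \<and> a \<le> k \<and> rev_perm N a = shifted_rev N D a}"
    unfolding fixed_values_def by blast
  ultimately show ?thesis by simp
qed

lemma pieri_rev_perm:
  assumes k: "k \<le> N"
  shows "linear_prod k j * schub (rev_perm N)
    = (\<Sum>w\<in>{w. w permutes {1..Suc N}}. pieri_coeff k j (rev_perm N) w * schub w)"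
proof -
  let ?r = "rev_perm N"
  have set: "{w. noncrossing k ?r w} = shifted_rev N ` Pow {1..k}"
    using noncrossing_shifted_rev[OF _ k] noncrossing_rev_perm_imp[OF _ k] by fastforce
  have inj: "inj_on (shifted_rev N) (Pow {1..k})"
  proof (rule inj_onI)
    fix D E assume DE: "D \<in> Pow {1..k}" "E \<in> Pow {1..k}" "shifted_rev N D = shifted_rev N E"
    then have "?r ` ({1..k} - D) = ?r ` ({1..k} - E)"
      using fixed_values_shifted_rev[OF _ k] by (metis PowD)
    then have "{1..k} - D = {1..k} - E"
      by (metis inj_image_eq_iff permutes_inj rev_perm_permutes)
    then show "D = E" using DE by auto
  qed
  have wt: "weight k ?r (shifted_rev N D) j = (\<Prod>a\<in>{1..k} - D. Var (Y (?r a)) - Var (Z j))"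
    if "D \<in> Pow {1..k}" for D
  proof -
    have "inj_on ?r A" for A using permutes_inj[OF rev_perm_permutes] by (auto intro: inj_onI dest: injD)
    then show ?thesis
      using that fixed_values_shifted_rev[OF _ k, of D] by (simp add: weight_def prod.reindex)
  qed
  have sch: "schub (shifted_rev N D) = (\<Prod>a\<in>D. Var (X a) - Var (Y (?r a))) * schub ?r"
    if "D \<in> Pow {1..k}" for D
  proof -
    have D: "D \<subseteq> {1..N}" using that k by auto
    have row: "(\<Prod>b\<in>{1..N - a + (if a \<in> D then 1 else 0)}. Var (X a) - Var (Y b))
      = (if a \<in> D then Var (X a) - Var (Y (?r a)) else 1) * (\<Prod>b\<in>{1..N - a}. Var (X a) - Var (Y b))"
      if "a \<in> {1..N}" for a
    proof (cases "a \<in> D")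
      case True
      have "{1..N - a + 1} = insert (?r a) {1..N - a}" "?r a \<notin> {1..N - a}"
        using that by (auto simp: rev_perm_def)
      then show ?thesis using True by simp
    qed simp
    have "schub (shifted_rev N D) = (\<Prod>a\<in>{1..N}. \<Prod>b\<in>{1..N - a + (if a \<in> D then 1 else 0)}. Var (X a) - Var (Y b))"
    proof -
      have "Suc N \<notin> D" using D by auto
      then show ?thesis
        using shifted_rev_schub[OF D] by (simp add: diagram_prod_def prod.nat_ivl_Suc')
    qed
    also have "\<dots> = (\<Prod>a\<in>{1..N}. if a \<in> D then Var (X a) - Var (Y (?r a)) else 1) * schub_top N"
      by (simp only: prod.cong[OF refl row] prod.distrib schub_top_def)
    also have "(\<Prod>a\<in>{1..N}. if a \<in> D then Var (X a) - Var (Y (?r a)) else 1)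
        = (\<Prod>a\<in>D. Var (X a) - Var (Y (?r a)))"
      using D by (simp add: prod.If_cases Int_absorb1)
    finally show ?thesis by (simp only: schub_rev_perm)
  qed
  have "linear_prod k j * schub ?r
      = (\<Prod>a\<in>{1..k}. (Var (X a) - Var (Y (?r a))) + (Var (Y (?r a)) - Var (Z j))) * schub ?r"
    by (simp add: linear_prod_def)
  also have "\<dots> = (\<Sum>D\<in>Pow {1..k}. (\<Prod>a\<in>D. Var (X a) - Var (Y (?r a)))
      * (\<Prod>a\<in>{1..k} - D. Var (Y (?r a)) - Var (Z j))) * schub ?r"
    by (subst prod_add) simp_all
  also have "\<dots> = (\<Sum>D\<in>Pow {1..k}. weight k ?r (shifted_rev N D) j * schub (shifted_rev N D))"
    unfolding sum_distrib_right
    by (rule sum.cong[OF refl]) (simp only: wt sch mult_ac)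
  also have "\<dots> = (\<Sum>w\<in>{w. noncrossing k ?r w}. weight k ?r w j * schub w)"
    unfolding set by (simp add: sum.reindex[OF inj])
  also have "\<dots> = (\<Sum>w\<in>{w. noncrossing k ?r w}. pieri_coeff k j ?r w * schub w)"
    by (rule sum.cong) (auto simp: pieri_coeff_def)
  also have "\<dots> = (\<Sum>w\<in>{w. w permutes {1..Suc N}}. pieri_coeff k j ?r w * schub w)"
  proof (rule sum.mono_neutral_left)
    show "finite {w. w permutes {1..Suc N}}" by (rule finite_permutations) simp
    show "{w. noncrossing k ?r w} \<subseteq> {w. w permutes {1..Suc N}}"
      using noncrossing_permutes[OF _ rev_perm_permutes k] by blast
  qed (auto simp: pieri_coeff_def)
  finally show ?thesis .
qed

lemma pieri:
  assumes u: "u permutes {1..N}" and k: "k \<le> N"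
  shows "linear_prod k j * schub u = (\<Sum>w\<in>{w. w permutes {1..Suc N}}. pieri_coeff k j u w * schub w)"
proof -
  have "linear_prod k j * schub (inv x)
      = (\<Sum>w\<in>{w. w permutes {1..Suc N}}. pieri_coeff k j (inv x) w * schub w)" if "x permutes {1..N}" for x
    using that
  proof (induction rule: ascent_induct)
    case top
    have "inv (rev_perm N) = rev_perm N" by (rule inv_unique_comp) (simp_all add: fun_eq_iff)
    then show ?case using pieri_rev_perm[OF k] by simp
  next
    case (step x)
    obtain i where i: "1 \<le> i" "i < N" "x i < x (Suc i)" using ex_ascent[OF step.hyps] .
    have "inv (x \<circ> adj i) = inv (adj i) \<circ> inv x"
      using permutes_bij[OF step(1)] S_inf_bij[OF S_inf_adj[OF i(1)]] by (intro o_inv_distrib)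
    also have "inv (adj i) = adj i" by (rule inv_unique_comp) simp_all
    finally have inv: "inv (x \<circ> adj i) = adj i \<circ> inv x" .
    have "x \<circ> adj i permutes {1..N}" using step(1) i by (intro permutes_comp_adj)
    moreover have "perm_length x < perm_length (x \<circ> adj i)"
      using perm_length_ascent[OF S_infI[OF step(1)] i(1,3)] by simp
    ultimately have IH: "linear_prod k j * schub (adj i \<circ> inv x)
      = (\<Sum>w\<in>{w. w permutes {1..Suc N}}. pieri_coeff k j (adj i \<circ> inv x) w * schub w)"
      using step.IH[of "x \<circ> adj i"] by (simp only: inv)
    show "linear_prod k j * schub (inv x)
      = (\<Sum>w\<in>{w. w permutes {1..Suc N}}. pieri_coeff k j (inv x) w * schub w)"
      by (rule pieri_step[OF permutes_inv[OF step(1)] k i(1,2) _ _ i(3) IH])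
         (simp_all add: permutes_inverses[OF step(1)])
  qed
  from this[OF permutes_inv[OF u]] show ?thesis
    using permutes_inv_inv[OF u] by simp
qed

section \<open>Products along paths\<close>

lemma arrow_permutes:
  assumes "u permutes {1..N}" "k \<le> N"
  shows "{w \<in> S_inf. arrow k u w} \<subseteq> {w. w permutes {1..Suc N}}"
  using noncrossing_permutes[OF _ assms] arrow_iff_noncrossing[OF S_infI[OF assms(1)]] by blast

lemma finite_arrow:
  assumes "u \<in> S_inf" shows "finite {w \<in> S_inf. arrow k u w}"
proof -
  obtain N where "u permutes {1..N}" "k \<le> N" using S_inf_permutes[OF assms] .
  from arrow_permutes[OF this] show ?thesis
    by (rule finite_subset) (rule finite_permutations, simp)
qed

lemma pieri_arrow:
  assumes "u \<in> S_inf"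
  shows "linear_prod k j * schub u = (\<Sum>w\<in>{w \<in> S_inf. arrow k u w}. weight k u w j * schub w)"
proof -
  obtain N where N: "u permutes {1..N}" "k \<le> N" using S_inf_permutes[OF assms] .
  note arrow_permutes[OF N]
  moreover have "finite {w. w permutes {1..Suc N}}" by (rule finite_permutations) simp
  ultimately have "(\<Sum>w\<in>{w \<in> S_inf. arrow k u w}. pieri_coeff k j u w * schub w)
      = (\<Sum>w\<in>{w. w permutes {1..Suc N}}. pieri_coeff k j u w * schub w)"
    using arrow_iff_noncrossing[OF assms]
    by (intro sum.mono_neutral_left) (auto simp: pieri_coeff_def intro: S_infI)
  moreover have "pieri_coeff k j u w = weight k u w j" if "arrow k u w" for w
    using that arrow_iff_noncrossing[OF assms] by (simp add: pieri_coeff_def)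
  ultimately show ?thesis using pieri[OF N] by simp
qed

definition paths_from :: "nat list \<Rightarrow> (nat \<Rightarrow> nat) \<Rightarrow> (nat \<Rightarrow> nat) list set" where
  "paths_from ls u =
     {us. length us = Suc (length ls) \<and> set us \<subseteq> S_inf \<and> us ! 0 = u \<and>
          (\<forall>i<length ls. arrow (ls ! i) (us ! i) (us ! Suc i))}"

lemma paths_from_snoc:
  "paths_from (ls @ [l]) u = (\<lambda>(us, w). us @ [w]) `
    (SIGMA us:paths_from ls u. {w \<in> S_inf. arrow l (us ! length ls) w})"
proof (intro equalityI subsetI)
  fix vs assume vs: "vs \<in> paths_from (ls @ [l]) u"
  then have "length vs = Suc (Suc (length ls))" by (simp add: paths_from_def)
  then obtain us w where uw: "vs = us @ [w]" "length us = Suc (length ls)"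
    by (metis length_Suc_conv_rev)
  have ar0: "arrow ((ls @ [l]) ! i) (vs ! i) (vs ! Suc i)" if "i < Suc (length ls)" for i
    using vs that by (simp add: paths_from_def)
  then have ar: "arrow (ls ! i) (us ! i) (us ! Suc i)" if "i < length ls" for i
    using that uw by (metis Suc_less_eq less_SucI nth_append)
  have "arrow l (us ! length ls) w" using ar0[of "length ls"] uw by (simp add: nth_append)
  moreover have "us \<in> paths_from ls u" "w \<in> S_inf"
    using vs uw ar by (auto simp: paths_from_def nth_append)
  ultimately show "vs \<in> (\<lambda>(us, w). us @ [w]) `
      (SIGMA us:paths_from ls u. {w \<in> S_inf. arrow l (us ! length ls) w})"
    using uw by force
next
  fix vs assume "vs \<in> (\<lambda>(us, w). us @ [w]) `
      (SIGMA us:paths_from ls u. {w \<in> S_inf. arrow l (us ! length ls) w})"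
  then obtain us w where "vs = us @ [w]" "us \<in> paths_from ls u" "w \<in> S_inf" "arrow l (us ! length ls) w"
    by auto
  then show "vs \<in> paths_from (ls @ [l]) u"
    by (auto simp: paths_from_def nth_append less_Suc_eq)
qed

lemma path_weight_snoc:
  assumes "length us = Suc (length ls)"
  shows "path_weight (ls @ [l]) (us @ [w])
    = path_weight ls us * weight l (us ! length ls) w (Suc (length ls))"
  using assms by (simp add: path_weight_def nth_append)

lemma paths_from_nth_in_S_inf: "us \<in> paths_from ls u \<Longrightarrow> i \<le> length ls \<Longrightarrow> us ! i \<in> S_inf"
  unfolding paths_from_def by (auto intro!: subsetD[of "set us" S_inf] nth_mem)

lemma pieri_paths:
  assumes "u \<in> S_inf"
  shows "finite (paths_from ls u) \<and>
    schub u * (\<Prod>i<length ls. linear_prod (ls ! i) (Suc i))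
      = (\<Sum>us\<in>paths_from ls u. path_weight ls us * schub (us ! length ls))"
proof (induction ls rule: rev_induct)
  case Nil
  have "paths_from [] u = {[u]}"
    using assms by (auto simp: paths_from_def length_Suc_conv)
  then show ?case by (simp add: path_weight_def)
next
  case (snoc l ls)
  let ?m = "length ls"
  let ?S = "\<lambda>us. {w \<in> S_inf. arrow l (us ! ?m) w}"
  have fin: "finite (?S us)" if "us \<in> paths_from ls u" for us
    using paths_from_nth_in_S_inf[OF that, of ?m] by (intro finite_arrow) simp
  have inj: "inj_on (\<lambda>(us, w). us @ [w]) A" for A :: "((nat \<Rightarrow> nat) list \<times> (nat \<Rightarrow> nat)) set"
    by (auto intro!: inj_onI)
  have "schub u * (\<Prod>i<length (ls @ [l]). linear_prod ((ls @ [l]) ! i) (Suc i))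
      = linear_prod l (Suc ?m) * (schub u * (\<Prod>i<?m. linear_prod (ls ! i) (Suc i)))"
    by (simp add: nth_append mult_ac)
  also have "\<dots> = (\<Sum>us\<in>paths_from ls u. path_weight ls us * (linear_prod l (Suc ?m) * schub (us ! ?m)))"
    by (simp only: snoc[THEN conjunct2] sum_distrib_left mult.left_commute)
  also have "\<dots> = (\<Sum>us\<in>paths_from ls u. \<Sum>w\<in>?S us.
      path_weight ls us * (weight l (us ! ?m) w (Suc ?m) * schub w))"
    by (rule sum.cong[OF refl])
       (simp only: pieri_arrow[OF paths_from_nth_in_S_inf[OF _ order_refl]] sum_distrib_left)
  also have "\<dots> = (\<Sum>(us, w)\<in>(SIGMA us:paths_from ls u. ?S us).
      path_weight ls us * (weight l (us ! ?m) w (Suc ?m) * schub w))"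
    using snoc fin by (intro sum.Sigma) auto
  also have "\<dots> = (\<Sum>(us, w)\<in>(SIGMA us:paths_from ls u. ?S us).
      path_weight (ls @ [l]) (us @ [w]) * schub ((us @ [w]) ! Suc ?m))"
    by (rule sum.cong[OF refl])
       (auto simp: path_weight_snoc paths_from_def nth_append mult.assoc)
  also have "\<dots> = (\<Sum>vs\<in>paths_from (ls @ [l]) u. path_weight (ls @ [l]) vs * schub (vs ! Suc ?m))"
    unfolding paths_from_snoc case_prod_unfold
    by (simp add: sum.reindex[OF inj[unfolded case_prod_unfold]])
  finally show ?case
    using snoc fin unfolding paths_from_snoc by (auto simp del: prod.lessThan_Suc)
qed

definition path_ends :: "nat list \<Rightarrow> (nat \<Rightarrow> nat) \<Rightarrow> (nat \<Rightarrow> nat) set" where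
  "path_ends ls u = (\<lambda>us. us ! length ls) ` paths_from ls u"

lemma path_ends_props:
  assumes "u \<in> S_inf"
  shows "finite (path_ends ls u)" "path_ends ls u \<subseteq> S_inf"
  using pieri_paths[OF assms] paths_from_nth_in_S_inf by (auto simp: path_ends_def)

lemma Path_conv: "Path ls u w = {us \<in> paths_from ls u. us ! length ls = w}"
  by (auto simp: Path_def paths_from_def)

lemma d_coeff_nonzero: "d_coeff u ls w \<noteq> 0 \<Longrightarrow> w \<in> path_ends ls u"
  unfolding d_coeff_def Path_conv path_ends_def by (auto elim!: sum.not_neutral_contains_not_neutral)

lemma pieri_d_coeff:
  assumes "u \<in> S_inf"
  shows "schub u * (\<Prod>i<length ls. linear_prod (ls ! i) (Suc i))
    = (\<Sum>w\<in>path_ends ls u. d_coeff u ls w * schub w)"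
proof -
  have "(\<Sum>w\<in>path_ends ls u. d_coeff u ls w * schub w)
      = (\<Sum>w\<in>path_ends ls u. \<Sum>us\<in>{us \<in> paths_from ls u. us ! length ls = w}.
          path_weight ls us * schub (us ! length ls))"
    unfolding d_coeff_def Path_conv sum_distrib_right by (intro sum.cong) auto
  also have "\<dots> = (\<Sum>us\<in>paths_from ls u. path_weight ls us * schub (us ! length ls))"
    using pieri_paths[OF assms] by (intro sum.group) (auto simp: path_ends_def)
  finally show ?thesis using pieri_paths[OF assms] by simp
qed

lemma transpose_X [simp]:
  "transpose (X i) (X l) (Y j) = Y j" "transpose (X i) (X l) (Z j) = Z j"
  by (simp_all add: transpose_def)

lemma swap_d_coeff [simp]: "swap (X i) (X l) (d_coeff u ls w) = d_coeff u ls w"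
  by (simp add: d_coeff_def path_weight_def weight_def)

section \<open>The dominant case\<close>

lemma perm_code_eq_0:
  assumes "\<And>j. i < j \<Longrightarrow> v i < v j" shows "perm_code v i = 0"
proof -
  have "{j. i < j \<and> v j < v i} = {}" using assms by (auto dest: less_asym)
  then show ?thesis unfolding perm_code_def by (metis card.empty)
qed

lemma perm_code_outside:
  assumes "v permutes {1..N}" "N < i" shows "perm_code v i = 0"
  using permutes_not_in[OF assms(1)] assms(2) by (intro perm_code_eq_0) simp

lemma dominant_antimono:
  assumes "dominant v" "1 \<le> i" "i \<le> j" shows "perm_code v j \<le> perm_code v i"
  using assms(3,2)
proof (induction j rule: dec_induct)
  case (step j)
  then show ?case using assms(1,2) unfolding dominant_def by (meson le_trans)
qed simp

lemma down_closed_eq_atLeastAtMost: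
  fixes A :: "nat set"
  assumes "finite A" "0 \<notin> A" "\<And>i j. j \<in> A \<Longrightarrow> 1 \<le> i \<Longrightarrow> i \<le> j \<Longrightarrow> i \<in> A"
  shows "A = {1..card A}"
proof (cases "A = {}")
  case False
  have "A = {1..Max A}"
  proof (intro equalityI subsetI)
    fix i assume "i \<in> A"
    then show "i \<in> {1..Max A}" using assms(1,2) by (cases "i = 0") auto
  next
    fix i assume "i \<in> {1..Max A}"
    then show "i \<in> A" using assms(3)[OF Max_in[OF assms(1) False]] by auto
  qed
  then show ?thesis by (metis card_atLeastAtMost add_diff_cancel_right' Suc_eq_plus1)
qed simp

definition y_to_z :: "mpoly \<Rightarrow> mpoly" where
  "y_to_z = poly_subst (\<lambda>a. case a of Y j \<Rightarrow> Var (Z j) | _ \<Rightarrow> Var a)"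

lemma schubert_xz_conv: "v \<in> S_inf \<Longrightarrow> schubert_xz v = y_to_z (schub v)"
  by (simp add: schubert_xz_def y_to_z_def schubert_xy_eq_schub)

lemma y_to_z_divdiff: "y_to_z (divdiff i P) = divdiff i (y_to_z P)"
  unfolding divdiff_conv_dd
proof (rule dd_unique[symmetric])
  have "y_to_z (swap (X i) (X (Suc i)) P) = swap (X i) (X (Suc i)) (y_to_z P)"
    unfolding y_to_z_def swap_def poly_subst_comp
    by (rule arg_cong[where f = "\<lambda>g. poly_subst g P"])
       (auto simp: fun_eq_iff transpose_def split: var.split)
  moreover have "y_to_z ((Var (X i) - Var (X (Suc i))) * dd (X i) (X (Suc i)) P)
      = y_to_z P - y_to_z (swap (X i) (X (Suc i)) P)"
    by (subst dd_eq) (simp_all add: y_to_z_def)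
  ultimately show "(Var (X i) - Var (X (Suc i))) * y_to_z (dd (X i) (X (Suc i)) P)
      = y_to_z P - swap (X i) (X (Suc i)) (y_to_z P)"
    by (simp add: y_to_z_def)
qed simp

lemma y_to_z_schub_dominant:
  assumes N: "dom_approx v permutes {1..N}" and dom: "dominant (dom_approx v)"
  shows "y_to_z (schub (dom_approx v)) = (\<Prod>i<length (lam v). linear_prod (lam v ! i) (Suc i))"
proof -
  define c where "c = perm_code (dom_approx v)"
  define A where "A j = {i. 1 \<le> i \<and> j \<le> c i}" for j
  have lp: "lam_part v j = card (A j)" for j by (simp add: lam_part_def A_def c_def)
  have c0: "c i = 0" if "N < i" for i using perm_code_outside[OF N that] by (simp add: c_def)
  have AN: "A j \<subseteq> {1..N}" if "1 \<le> j" for j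
    using c0 that by (auto simp: A_def) (metis not_le le_zero_eq not_one_le_zero)
  have A: "A j = {1..lam_part v j}" if j: "1 \<le> j" for j
    unfolding lp
  proof (rule down_closed_eq_atLeastAtMost)
    show "finite (A j)" using AN[OF j] finite_subset by blast
    show "i \<in> A j" if "l \<in> A j" "1 \<le> i" "i \<le> l" for i l
      using dominant_antimono[OF dom that(2,3)] that by (auto simp: A_def c_def)
  qed (simp add: A_def)
  define B where "B = {j. 1 \<le> j \<and> lam_part v j \<noteq> 0}"
  have B_iff: "j \<in> B \<longleftrightarrow> 1 \<le> j \<and> (\<exists>i\<in>{1..N}. j \<le> c i)" for j
  proof (cases "1 \<le> j")
    case True
    have "lam_part v j \<noteq> 0 \<longleftrightarrow> A j \<noteq> {}" using A[OF True] by (cases "lam_part v j = 0") auto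
    then show ?thesis using AN[OF True] True unfolding B_def by (auto simp: A_def)
  qed (simp add: B_def)
  have B: "B = {1..card B}"
  proof (rule down_closed_eq_atLeastAtMost)
    have "B \<subseteq> (\<Union>i\<in>{1..N}. {..c i})" using B_iff by auto
    then show "finite B" by (rule finite_subset) auto
  qed (auto simp: B_iff intro: le_trans)
  have "y_to_z (schub (dom_approx v)) = (\<Prod>i\<in>{1..N}. \<Prod>j\<in>{1..c i}. Var (X i) - Var (Z j))"
    unfolding schub_dominant[OF N dom] by (simp add: diagram_prod_def y_to_z_def c_def)
  also have "\<dots> = (\<Prod>i\<in>{1..N}. \<Prod>j\<in>{j \<in> {1..card B}. j \<le> c i}. Var (X i) - Var (Z j))"
  proof (rule prod.cong[OF refl])
    fix i assume i: "i \<in> {1..N}"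
    have "{1..c i} = {j \<in> {1..card B}. j \<le> c i}"
      using i B_iff unfolding B[symmetric] by auto
    then show "(\<Prod>j\<in>{1..c i}. Var (X i) - Var (Z j))
        = (\<Prod>j\<in>{j \<in> {1..card B}. j \<le> c i}. Var (X i) - Var (Z j))" by simp
  qed
  also have "\<dots> = (\<Prod>j\<in>{1..card B}. \<Prod>i\<in>{i \<in> {1..N}. j \<le> c i}. Var (X i) - Var (Z j))"
    by (rule prod.swap_restrict) auto
  also have "\<dots> = (\<Prod>j\<in>{1..card B}. linear_prod (lam_part v j) j)"
  proof (rule prod.cong[OF refl])
    fix j assume "j \<in> {1..card B}"
    then have j: "1 \<le> j" by simp
    have "{i \<in> {1..N}. j \<le> c i} = A j" using AN[OF j] by (auto simp: A_def)
    then show "(\<Prod>i\<in>{i \<in> {1..N}. j \<le> c i}. Var (X i) - Var (Z j)) = linear_prod (lam_part v j) j"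
      unfolding linear_prod_def A[OF j, symmetric] by simp
  qed
  also have "\<dots> = (\<Prod>i<card B. linear_prod (lam_part v (Suc i)) (Suc i))"
    by (simp only: One_nat_def prod.atLeast1_atMost_eq)
  also have "\<dots> = (\<Prod>i<length (lam v). linear_prod (lam v ! i) (Suc i))"
    by (rule prod.cong) (simp_all add: lam_def B_def One_nat_def del: upt_Suc)
  finally show ?thesis .
qed

section \<open>Reduction to the dominant case\<close>

lemma dom_approx_word:
  assumes "v permutes {1..N}" "\<And>i. p < i \<Longrightarrow> v i < v (Suc i)"
  shows "\<exists>is. (\<forall>i\<in>set is. 1 \<le> i \<and> i < p) \<and> dom_approx v = v \<circ> word_prod is \<and>
    dom_approx v permutes {1..N} \<and> dominant (dom_approx v) \<and>
    perm_length (dom_approx v) = perm_length v + length is \<and>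
    schub v = foldr divdiff is (schub (dom_approx v))"
  using assms
proof (induction "N * N - perm_length v" arbitrary: v rule: less_induct)
  case less
  have S: "v \<in> S_inf" using less.prems(1) by (rule S_infI)
  show ?case
  proof (cases "dominant v")
    case True
    then have "dom_approx v = v" by (simp add: dom_approx.simps)
    then show ?thesis using True less.prems by (intro exI[of _ "[]"]) simp
  next
    case False
    define A where "A = {i. 1 \<le> i \<and> perm_code v i < perm_code v (Suc i)}"
    define i where "i = last_code_ascent v"
    have "A \<subseteq> {..N}"
    proof
      fix l assume "l \<in> A"
      then have "perm_code v (Suc l) \<noteq> 0" by (auto simp: A_def)
      then have "\<not> N < Suc l" using perm_code_outside[OF less.prems(1), of "Suc l"] by auto
      then show "l \<in> {..N}" by simp
    qed
    then have "finite A" by (rule finite_subset) simp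
    moreover have "A \<noteq> {}"
    proof -
      obtain l where "1 \<le> l" "\<not> perm_code v (Suc l) \<le> perm_code v l"
        using False unfolding dominant_def by blast
      then have "l \<in> A" by (simp add: A_def)
      then show ?thesis by blast
    qed
    ultimately have "i \<in> A" using Max_in unfolding i_def last_code_ascent_def A_def by blast
    then have i: "1 \<le> i" "perm_code v i < perm_code v (Suc i)" by (auto simp: A_def)
    have asc: "v i < v (Suc i)"
      using perm_code_descent_less[OF S, of i] i(2) S_inf_eq_iff[OF S, of i "Suc i"]
      by (cases "v i" "v (Suc i)" rule: linorder_cases) auto
    have iN: "i < N"
      using perm_code_outside[OF less.prems(1), of "Suc i"] i(2) by (cases "N < Suc i") auto
    have ip: "i < p"
    proof (rule ccontr)
      assume ip: "\<not> i < p"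
      have "v (Suc i) < v j" if "Suc i < j" for j
        using Suc_leI[OF that]
      proof (induction j rule: dec_induct)
        case base
        then show ?case using less.prems(2)[of "Suc i"] ip by simp
      next
        case (step j)
        then show ?case using less.prems(2)[of j] ip by simp
      qed
      then have "perm_code v (Suc i) = 0" by (rule perm_code_eq_0)
      then show False using i(2) by simp
    qed
    define v' where "v' = v \<circ> adj i"
    have v': "v' permutes {1..N}" "v' \<in> S_inf"
      unfolding v'_def using less.prems(1) S i iN by (simp_all only: permutes_comp_adj S_inf_comp_adj)
    have len: "perm_length v' = Suc (perm_length v)"
      unfolding v'_def using perm_length_ascent[OF S i(1) asc] .
    have "perm_length v' \<le> N * N" using v' perm_length_le by blast
    then have "N * N - perm_length v' < N * N - perm_length v" using len by simp
    moreover have "v' l < v' (Suc l)" if "p < l" for l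
      using less.prems(2)[OF that] ip that by (simp add: v'_def)
    ultimately obtain js where js: "\<forall>i\<in>set js. 1 \<le> i \<and> i < p" "dom_approx v' = v' \<circ> word_prod js"
      "dom_approx v' permutes {1..N}" "dominant (dom_approx v')"
      "perm_length (dom_approx v') = perm_length v' + length js"
      "schub v' = foldr divdiff js (schub (dom_approx v'))"
      using less.hyps[of v'] v'(1) by blast
    have da: "dom_approx v = dom_approx v'"
      using False dom_approx.simps[of v] by (simp only: v'_def i_def if_False)
    have "schub v = divdiff i (schub v')"
      using divdiff_schub[OF v'(2) i(1)] asc by (simp add: v'_def)
    then have "schub v = foldr divdiff (i # js) (schub (dom_approx v))"
      using js(6) by (simp add: da)
    moreover have "dom_approx v = v \<circ> word_prod (i # js)"
      using js(2) by (simp only: da v'_def word_prod_Cons comp_assoc)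
    ultimately have "(\<forall>i\<in>set (i # js). 1 \<le> i \<and> i < p) \<and> dom_approx v = v \<circ> word_prod (i # js) \<and>
      dom_approx v permutes {1..N} \<and> dominant (dom_approx v) \<and>
      perm_length (dom_approx v) = perm_length v + length (i # js) \<and>
      schub v = foldr divdiff (i # js) (schub (dom_approx v))"
      using js i ip len da by simp
    then show ?thesis by blast
  qed
qed

lemma y_to_z_foldr_divdiff: "y_to_z (foldr divdiff is P) = foldr divdiff is (y_to_z P)"
  by (induction "is") (simp_all add: y_to_z_divdiff)

lemma foldr_divdiff_mult_sym:
  assumes "\<And>i. i \<in> set is \<Longrightarrow> swap (X i) (X (Suc i)) A = A"
  shows "foldr divdiff is (A * P) = A * foldr divdiff is P"
  using assms by (induction "is") (simp_all add: divdiff_conv_dd dd_mult_sym)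

lemma foldr_divdiff_sum: "foldr divdiff is (sum f A) = (\<Sum>x\<in>A. foldr divdiff is (f x))"
  by (induction "is") (simp_all add: divdiff_conv_dd dd_sum)

lemma swap_schub:
  assumes "u \<in> S_inf" "1 \<le> i" "u i < u (Suc i)"
  shows "swap (X i) (X (Suc i)) (schub u) = schub u"
proof -
  have "dd (X i) (X (Suc i)) (schub u) = 0"
    using divdiff_schub[OF assms(1,2)] assms(3) by (simp add: divdiff_conv_dd)
  then show ?thesis using dd_eq[of "X i" "X (Suc i)" "schub u"] by simp
qed

theorem theorem3p1:
  fixes u v :: "nat \<Rightarrow> nat"
  assumes "u \<in> S_inf" and "v \<in> S_inf"
    and "\<exists>p>0. (\<forall>i. 1 \<le> i \<and> i < p \<longrightarrow> perm_length (u \<circ> adj i) > perm_length u) \<and>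
                (\<forall>i>p. perm_length (v \<circ> adj i) > perm_length v)"
  shows "finite {w \<in> S_inf. e_coeff u v w \<noteq> 0} \<and>
    schubert_xy u * schubert_xz v =
      (\<Sum>w\<in>{w \<in> S_inf. e_coeff u v w \<noteq> 0}. e_coeff u v w * schubert_xy w)"
proof -
  obtain p where up: "\<forall>i. 1 \<le> i \<and> i < p \<longrightarrow> perm_length (u \<circ> adj i) > perm_length u"
    and vp: "\<forall>i>p. perm_length (v \<circ> adj i) > perm_length v"
    using assms(3) by blast
  have pu: "u i < u (Suc i)" if "1 \<le> i" "i < p" for i
    using up that perm_length_adj_gt_iff[OF assms(1) that(1)] by blast
  have pv: "v i < v (Suc i)" if "p < i" for i
  proof -
    have "1 \<le> i" using that by simp
    then show ?thesis using vp that perm_length_adj_gt_iff[OF assms(2)] by blast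
  qed
  obtain N where N: "v permutes {1..N}" using S_inf_permutes[OF assms(2)] .
  obtain js where js: "\<forall>i\<in>set js. 1 \<le> i \<and> i < p" "dom_approx v = v \<circ> word_prod js"
    "dom_approx v permutes {1..N}" "dominant (dom_approx v)"
    "perm_length (dom_approx v) = perm_length v + length js"
    "schub v = foldr divdiff js (schub (dom_approx v))"
    using dom_approx_word[OF N, of p] pv by blast
  define x where "x = word_prod js"
  have js1: "\<forall>i\<in>set js. 1 \<le> i" using js(1) by blast
  have x: "x \<in> S_inf" unfolding x_def using js1 by (rule word_prod_S_inf)
  have x_eq: "inv v \<circ> dom_approx v = x"
    using S_inf_inj[OF assms(2)] by (simp add: js(2) x_def o_assoc)
  have len_x: "perm_length x = length js"
  proof (rule antisym)
    show "perm_length x \<le> length js"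
      using perm_length_comp_word_prod_le[OF S_inf_id js1] by (simp add: x_def)
    show "length js \<le> perm_length x"
      using perm_length_comp_le[OF assms(2) x] js(2,5) by (simp add: x_def)
  qed
  have x_inv: "w \<circ> inv x \<circ> x = w" "w \<circ> x \<circ> inv x = w" for w :: "nat \<Rightarrow> nat"
    using S_inf_bij[OF x] by (simp_all add: comp_assoc bij_is_inj inj_iff[symmetric] surj_iff[THEN iffD1] bij_is_surj)
  let ?L = "lam v"
  define W where "W = path_ends ?L u"
  have W: "finite W" "W \<subseteq> S_inf" using path_ends_props[OF assms(1)] by (simp_all add: W_def)
  have e: "e_coeff u v w = (if perm_length (w \<circ> x) = perm_length w + length js then d_coeff u ?L (w \<circ> x) else 0)" for w
    by (simp only: e_coeff_def Let_def x_eq len_x)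
  have e': "e_coeff u v (w \<circ> inv x)
      = (if perm_length (w \<circ> inv x) + length js = perm_length w then d_coeff u ?L w else 0)" for w
    unfolding e x_inv by (simp only: eq_commute)
  define E where "E = {w \<in> S_inf. e_coeff u v w \<noteq> 0}"
  define W' where "W' = (\<lambda>w. w \<circ> inv x) ` W"
  have inj: "inj_on (\<lambda>w. w \<circ> inv x) W" by (rule inj_onI) (metis x_inv(1))
  have EW: "E \<subseteq> W'"
  proof
    fix w assume "w \<in> E"
    then have "d_coeff u ?L (w \<circ> x) \<noteq> 0" by (auto simp: E_def e split: if_splits)
    then have "w \<circ> x \<in> W" unfolding W_def by (rule d_coeff_nonzero)
    then have "w \<circ> x \<circ> inv x \<in> W'" unfolding W'_def by blast
    then show "w \<in> W'" by (simp only: x_inv)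
  qed
  have W': "finite W'" "W' \<subseteq> S_inf"
    using W x by (auto simp: W'_def intro!: S_inf_comp S_inf_inv simp del: comp_apply)
  have "schub u * y_to_z (schub v) = foldr divdiff js (schub u * y_to_z (schub (dom_approx v)))"
    unfolding js(6) y_to_z_foldr_divdiff
    using js(1) pu by (intro foldr_divdiff_mult_sym[symmetric] swap_schub assms(1)) auto
  also have "schub u * y_to_z (schub (dom_approx v)) = (\<Sum>w\<in>W. d_coeff u ?L w * schub w)"
    unfolding y_to_z_schub_dominant[OF js(3,4)] W_def by (rule pieri_d_coeff[OF assms(1)])
  also have "foldr divdiff js \<dots> = (\<Sum>w\<in>W. d_coeff u ?L w * foldr divdiff js (schub w))"
    by (simp add: foldr_divdiff_sum foldr_divdiff_mult_sym)
  also have "\<dots> = (\<Sum>w\<in>W. e_coeff u v (w \<circ> inv x) * schub (w \<circ> inv x))"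
  proof (rule sum.cong[OF refl])
    fix w assume "w \<in> W"
    then have "w \<in> S_inf" using W by blast
    from foldr_divdiff_schub[OF this js1]
    have fd: "foldr divdiff js (schub w) = (if perm_length (w \<circ> inv x) + length js = perm_length w
        then schub (w \<circ> inv x) else 0)"
      by (simp only: x_def)
    show "d_coeff u ?L w * foldr divdiff js (schub w) = e_coeff u v (w \<circ> inv x) * schub (w \<circ> inv x)"
      by (simp only: e' fd mult_zero_left mult_zero_right split: if_split) simp
  qed
  also have "\<dots> = (\<Sum>w\<in>W'. e_coeff u v w * schub w)"
    by (rule sum.reindex_cong[OF inj, symmetric]) (simp_all only: W'_def)
  also have "\<dots> = (\<Sum>w\<in>E. e_coeff u v w * schub w)"
    using W' EW by (intro sum.mono_neutral_right) (auto simp: E_def)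
  also have "\<dots> = (\<Sum>w\<in>E. e_coeff u v w * schubert_xy w)"
    by (rule sum.cong[OF refl]) (simp add: E_def schubert_xy_eq_schub)
  finally have "schubert_xy u * schubert_xz v = (\<Sum>w\<in>E. e_coeff u v w * schubert_xy w)"
    by (simp add: schubert_xy_eq_schub schubert_xz_conv assms(1,2))
  moreover have "finite E" using EW W' finite_subset by blast
  ultimately show ?thesis by (simp only: E_def simp_thms)
qed

end
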